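(* Let $Q(\zeta)=|\zeta|^2$ and $p=\sqrt2$ or $p=-\sqrt2$, and let $R_{N,k}$ be the rescaled $k$-point correlation function at $p$ of the planar symplectic ensemble with potential $Q$. Then for every $k\ge1$, as $N\to\infty$, $R_{N,k}(z_1,\dots,z_k)$ converges, uniformly for $z_1,\dots,z_k$ in compact subsets of $\mathbb{C}$, to $$R_k(z_1,\dots,z_k)=\prod_{j=1}^k(\bar z_j-z_j)\,\operatorname{Pf}\big[K_{\rm edge}^{\mathbb R}(z_j,z_l)\big]_{j,l=1}^k,$$ where $$K_{\rm edge}^{\mathbb R}(z,w)=e^{-|z|^2-|w|^2}\begin{pmatrix}\kappa_{\rm edge}^{\mathbb R}(z,w)&\kappa_{\rm edge}^{\mathbb R}(z,\bar w)\\ \kappa_{\rm edge}^{\mathbb R}(\bar z,w)&\kappa_{\rm edge}^{\mathbb R}(\bar z,\bar w)\end{pmatrix},$$ $$\kappa_{\rm edge}^{\mathbb R}(z,w)=\sqrt\pi\,e^{z^2+w^2}\int_{-\infty}^0W(f_w,f_z)(u)\,du,\qquad f_z(u)=\tfrac12\operatorname{erfc}\big(\sqrt2(z-u)\big),$$ and $W(f,g)=fg'-f'g$ is the Wronskian (derivatives with respect to $u$).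
   Context: Write $dA(\zeta)=\frac1\pi d^2\zeta$ for Lebesgue measure on $\mathbb C$ divided by $\pi$. The planar symplectic ensemble with potential $Q$ is the probability measure on $\mathbb C^N$ $$d\mathbf P_N(\zeta_1,\dots,\zeta_N)=\frac1{Z_N}e^{-\mathbf H_N(\zeta_1,\dots,\zeta_N)}\prod_{j=1}^NdA(\zeta_j),$$ $$\mathbf H_N=\sum_{j\ne k}\log\frac1{|\zeta_j-\zeta_k||\zeta_j-\bar\zeta_k|}+\sum_{j=1}^N\Big(\log\frac1{|\zeta_j-\bar\zeta_j|^2}+NQ(\zeta_j)\Big),$$ where the first sum is over ordered pairs and $Z_N$ is the normalising constant. Its $k$-point correlation function is $$\mathbf R_{N,k}(\zeta_1,\dots,\zeta_k)=\frac1{Z_N}\frac{N!}{(N-k)!}\int_{\mathbb C^{N-k}}e^{-\mathbf H_N}\prod_{j=k+1}^NdA(\zeta_j).$$ For $Q(\zeta)=|\zeta|^2$ the limiting support (droplet) is the disc $S$ of centre $0$ and radius $\sqrt2$, and the micro-scale is $r_N=\sqrt{2/N}$. For a boundary point $p\in\partial S$, with $e^{i\theta}$ the outer unit normal to $\partial S$ at $p$ (so $\theta=0$ for $p=\sqrt2$, $\theta=\pi$ for $p=-\sqrt2$), the rescaled $k$-point function is $R_{N,k}(z_1,\dots,z_k)=r_N^{2k}\,\mathbf R_{N,k}(\zeta_1,\dots,\zeta_k)$ with $\zeta_j=p+e^{i\theta}r_Nz_j$. $\operatorname{Pf}[K(z_j,z_l)]_{j,l=1}^k$ is the Pfaffian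 of the $2k\times2k$ skew-symmetric matrix with $2\times2$ blocks $K(z_j,z_l)$. *)

theory Defs
  imports
    "HOL-Complex_Analysis.Complex_Analysis"
    "HOL-Combinatorics.Permutations"
    "Jordan_Normal_Form.Matrix"
begin

section \<open>The planar symplectic ensemble\<close>

text \<open>Points of $\mathbb C^N$ are functions \<^typ>\<open>nat \<Rightarrow> complex\<close>, with coordinates indexed by
  \<open>0, \<dots>, N - 1\<close> instead of \<open>1, \<dots>, N\<close>.\<close>

definition dA :: "complex measure" where
  "dA = scale_measure (ennreal (1 / pi)) lborel"

text \<open>The Hamiltonian is \<open>\<infinity>\<close> where two points coincide or are conjugate, or where some point is
  real. Hence the values are extended reals, with \<open>log (1 / 0) = \<infinity>\<close> (whereas
  \<open>ln (1 / 0) = 0\<close> for the total functions on the reals) and \<open>exp (- \<infinity>) = 0\<close>.\<close>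

definition log_recip :: "real \<Rightarrow> ereal" where
  "log_recip t = (if t = 0 then \<infinity> else ereal (ln (1 / t)))"

definition exp_minus :: "ereal \<Rightarrow> real" where
  "exp_minus h = (if h = \<infinity> then 0 else exp (- real_of_ereal h))"

definition Hamiltonian :: "(complex \<Rightarrow> real) \<Rightarrow> nat \<Rightarrow> (nat \<Rightarrow> complex) \<Rightarrow> ereal" where
  "Hamiltonian Q N \<zeta> =
     (\<Sum>(j, l) \<in> {(j, l). j < N \<and> l < N \<and> j \<noteq> l}.
        log_recip (cmod (\<zeta> j - \<zeta> l) * cmod (\<zeta> j - cnj (\<zeta> l))))
     + (\<Sum>j<N. log_recip ((cmod (\<zeta> j - cnj (\<zeta> j)))\<^sup>2) + ereal (real N * Q (\<zeta> j)))"

definition partition_function :: "(complex \<Rightarrow> real) \<Rightarrow> nat \<Rightarrow> real" where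
  "partition_function Q N =
     (\<integral>\<zeta>. exp_minus (Hamiltonian Q N \<zeta>) \<partial>(Pi\<^sub>M {..<N} (\<lambda>_. dA)))"

text \<open>The first \<open>k\<close> coordinates are \<open>\<zeta>\<close>, the remaining ones \<open>\<omega>\<close> are integrated out. The value is only
  meaningful for \<open>k \<le> N\<close>.\<close>

definition correlation ::
    "(complex \<Rightarrow> real) \<Rightarrow> nat \<Rightarrow> nat \<Rightarrow> (nat \<Rightarrow> complex) \<Rightarrow> real" where
  "correlation Q N k \<zeta> =
     1 / partition_function Q N * (fact N / fact (N - k)) *
     (\<integral>\<omega>. exp_minus (Hamiltonian Q N (merge {..<k} {k..<N} (\<zeta>, \<omega>)))
        \<partial>(Pi\<^sub>M {k..<N} (\<lambda>_. dA)))"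

section \<open>Rescaling for the potential $|\zeta|^2$\<close>

definition Ginibre_potential :: "complex \<Rightarrow> real" where
  "Ginibre_potential \<zeta> = (cmod \<zeta>)\<^sup>2"

definition micro_scale :: "nat \<Rightarrow> real" where
  "micro_scale N = sqrt (2 / real N)"

text \<open>\<open>\<theta>\<close> is meant to be the argument of the outer unit normal at the boundary point \<open>p\<close>.\<close>

definition rescaled_correlation ::
    "complex \<Rightarrow> real \<Rightarrow> nat \<Rightarrow> nat \<Rightarrow> (nat \<Rightarrow> complex) \<Rightarrow> real" where
  "rescaled_correlation p \<theta> N k z =
     micro_scale N ^ (2 * k) *
     correlation Ginibre_potential N k
       (\<lambda>j. p + exp (\<i> * of_real \<theta>) * of_real (micro_scale N) * z j)"

section \<open>Pfaffians\<close>

text \<open>\<open>Pf A\<close> is the Pfaffian of a skew-symmetric matrix of even size \<open>2m\<close>, here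
  $\frac{1}{2^m m!}\sum_{\sigma\in S_{2m}}\operatorname{sgn}(\sigma)
  \prod_{i<m} A_{\sigma(2i),\sigma(2i+1)}$.\<close>

definition Pf :: "complex mat \<Rightarrow> complex" where
  "Pf A = (let m = dim_row A div 2 in
     (\<Sum>\<sigma> | \<sigma> permutes {..<2 * m}.
        of_int (sign \<sigma>) * (\<Prod>i<m. A $$ (\<sigma> (2 * i), \<sigma> (2 * i + 1))))
     / (2 ^ m * fact m))"

text \<open>The \<open>2k \<times> 2k\<close> matrix with the \<open>2 \<times> 2\<close> blocks \<open>B j l\<close> for \<open>j, l < k\<close>.\<close>

definition block_matrix :: "nat \<Rightarrow> (nat \<Rightarrow> nat \<Rightarrow> complex mat) \<Rightarrow> complex mat" where
  "block_matrix k B =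
     Matrix.mat (2 * k) (2 * k) (\<lambda>(r, c). B (r div 2) (c div 2) $$ (r mod 2, c mod 2))"

section \<open>The edge kernel\<close>

text \<open>The entire function $\operatorname{erfc} z = 1 - \frac{2}{\sqrt\pi}\int_0^z e^{-t^2}\,dt$.\<close>

definition erfc :: "complex \<Rightarrow> complex" where
  "erfc z = 1 - 2 / of_real (sqrt pi) * contour_integral (linepath 0 z) (\<lambda>t. exp (- t\<^sup>2))"

definition f_edge :: "complex \<Rightarrow> real \<Rightarrow> complex" where
  "f_edge z u = 1 / 2 * erfc (of_real (sqrt 2) * (z - of_real u))"

definition Wronskian :: "(real \<Rightarrow> complex) \<Rightarrow> (real \<Rightarrow> complex) \<Rightarrow> real \<Rightarrow> complex" where
  "Wronskian f g u =
     f u * vector_derivative g (at u) - vector_derivative f (at u) * g u"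

definition kappa_edge :: "complex \<Rightarrow> complex \<Rightarrow> complex" where
  "kappa_edge z w =
     of_real (sqrt pi) * exp (z\<^sup>2 + w\<^sup>2) *
     (LINT u:{..0}|lborel. Wronskian (f_edge w) (f_edge z) u)"

definition K_edge :: "complex \<Rightarrow> complex \<Rightarrow> complex mat" where
  "K_edge z w =
     of_real (exp (- (cmod z)\<^sup>2 - (cmod w)\<^sup>2)) \<cdot>\<^sub>m
     mat_of_rows_list 2
       [[kappa_edge z w, kappa_edge z (cnj w)],
        [kappa_edge (cnj z) w, kappa_edge (cnj z) (cnj w)]]"

definition limiting_correlation :: "nat \<Rightarrow> (nat \<Rightarrow> complex) \<Rightarrow> complex" where
  "limiting_correlation k z =
     (\<Prod>j<k. cnj (z j) - z j) * Pf (block_matrix k (\<lambda>j l. K_edge (z j) (z l)))"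

end

theory Submission
  imports Defs "Jordan_Normal_Form.Determinant" "HOL-Probability.Distributions" "HOL-Real_Asymp.Real_Asymp"
begin

text \<open>
  The Boltzmann factor of the ensemble is the Vandermonde determinant in the \<open>2 N\<close> points
  \<open>\<zeta>\<^sub>j\<close>, \<open>cnj \<zeta>\<^sub>j\<close>, times one factor per particle. Expand the determinant in monic polynomials
  that are skew-orthogonal for the Gaussian weight: integrating out a particle then forces its two
  polynomials to be the partners \<open>2 i\<close>, \<open>2 i + 1\<close>, and the terms that survive are exactly those of a
  Pfaffian.

  At the edge the kernel is \<open>edge_kernel N z w\<close>, antisymmetric and holomorphic. Its derivative in \<open>z\<close>
  has a closed form in terms of the truncated exponentials \<open>exp (- t) * (\<Sum>l\<le>n. t ^ l / fact l)\<close> with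
  \<open>t = n + O(sqrt n)\<close>, which tend to \<open>erfc / 2\<close> by Laplace's method. The limiting kernel, an integral of
  Wronskians, has the limiting derivative: its \<open>z\<close>-derivative has an integrand with an elementary
  antiderivative. As both kernels vanish on the diagonal, the mean value inequality carries
  the locally uniform convergence over from the derivatives to the kernels.
\<close>

section \<open>Alternating sums over pairs\<close>

text \<open>The kernel is a sum of \<open>N\<close> terms that is not estimated term by term.
  Differentiating \<open>edge_sum\<close> in its first argument telescopes it to
  \<open>X * edge_sum\<close> plus two explicit terms, and the Gaussian factor in
  \<open>edge_kernel\<close> cancels \<open>X * edge_sum\<close>. So the derivative of the kernel no
  longer contains the kernel itself, and only explicit expressions have to be taken to the limit.
  Complex arguments are reached along horizontal rays: \<open>erfc\<close> and the truncated
  exponentials both become integrals over \<open>{0..}\<close>, to which dominated convergence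
  applies. Uniformity is not tracked through these estimates. The limits are taken along arbitrary
  convergent sequences of points, and compactness turns that into uniform convergence. The limiting
  kernel is an integral over a half-line. It is cut off at \<open>- T\<close> before it is
  differentiated, and the boundary term at \<open>- T\<close> is controlled by an explicit
  bound.\<close>

lemma prod_double: "(\<Prod>a<2 * n. f a) = (\<Prod>j<n. f (2 * j) * f (2 * j + 1))"
  for f :: "nat \<Rightarrow> 'a::comm_monoid_mult"
  by (induction n) (simp_all add: mult.assoc)

lemma prod_split_lessThan:
  "k \<le> N \<Longrightarrow> (\<Prod>j<N. f j) = (\<Prod>j<k. f j) * (\<Prod>j\<in>{k..<N}. f j)"
  for f :: "nat \<Rightarrow> 'a::comm_monoid_mult"
  by (simp add: prod.atLeastLessThan_concat lessThan_atLeast0)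

text \<open>Exchanging the places \<open>2 * j\<close> and \<open>2 * j + 1\<close> reverses the
  sign of the permutation, so the subtracted, transposed term contributes the same sum once more:
  antisymmetrising a factor only doubles the result. The set \<open>J\<close> is there because in
  one application only the integrated particles carry an antisymmetric factor.\<close>

lemma alternating_sum_pairs:
  fixes B :: "nat \<Rightarrow> nat \<Rightarrow> nat \<Rightarrow> 'a::comm_ring_1"
  assumes "J \<subseteq> {..<n}"
  shows "(\<Sum>\<sigma> | \<sigma> permutes {..<2 * n}. of_int (sign \<sigma>) *
      (\<Prod>j<n. B j (\<sigma> (2 * j)) (\<sigma> (2 * j + 1)) -
               (if j \<in> J then B j (\<sigma> (2 * j + 1)) (\<sigma> (2 * j)) else 0))) =
    2 ^ card J * (\<Sum>\<sigma> | \<sigma> permutes {..<2 * n}. of_int (sign \<sigma>) *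
      (\<Prod>j<n. B j (\<sigma> (2 * j)) (\<sigma> (2 * j + 1))))"
proof -
  have "finite J" using assms finite_subset by blast
  then show ?thesis using assms
  proof (induction J rule: finite_induct)
    case (insert m J)
    define F where "F = (\<lambda>J \<sigma> j. B j (\<sigma> (2 * j)) (\<sigma> (2 * j + 1)) -
               (if j \<in> J then B j (\<sigma> (2 * j + 1)) (\<sigma> (2 * j)) else 0))"
    define t where "t = Transposition.transpose (2 * m) (2 * m + 1)"
    let ?S = "{\<sigma>. \<sigma> permutes {..<2 * n}}"
    have m: "m < n" "m \<notin> J" using insert by auto
    have t: "t permutes {..<2 * n}"
      unfolding t_def by (rule permutes_swap_id) (use m in auto)
    have sgt: "sign t = -1" unfolding t_def by (simp add: sign_swap_id)
    have perm: "permutation \<sigma>" if "\<sigma> permutes {..<2 * n}" for \<sigma>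
      using that permutation_permutes by blast
    have tj: "t (2 * j) = 2 * j" "t (2 * j + 1) = 2 * j + 1" if "j \<noteq> m" for j
      using that Suc_double_not_eq_double [of j m] double_not_eq_Suc_double [of j m]
      unfolding t_def Transposition.transpose_def by simp_all
    have tm: "t (2 * m) = 2 * m + 1" "t (2 * m + 1) = 2 * m" unfolding t_def by auto
    have split: "(\<Prod>j<n. G j) = G m * (\<Prod>j\<in>{..<n} - {m}. G j)" for G :: "nat \<Rightarrow> 'a"
      using m by (simp add: prod.remove)
    have rest: "(\<Prod>j\<in>{..<n} - {m}. F (insert m J) \<sigma> j) = (\<Prod>j\<in>{..<n} - {m}. F J \<sigma> j)" for \<sigma>
      by (rule prod.cong) (auto simp: F_def)
    have rest_t: "(\<Prod>j\<in>{..<n} - {m}. F J (\<sigma> \<circ> t) j) = (\<Prod>j\<in>{..<n} - {m}. F J \<sigma> j)" for \<sigma>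
      by (rule prod.cong) (use tj in \<open>auto simp: F_def\<close>)
    have FJm: "F J \<sigma> m = B m (\<sigma> (2 * m)) (\<sigma> (2 * m + 1))" for \<sigma>
      using m by (simp add: F_def)
    have Fm: "F (insert m J) \<sigma> m = F J \<sigma> m - F J (\<sigma> \<circ> t) m" for \<sigma>
      unfolding FJm using tm by (simp add: F_def)
    have "(\<Sum>\<sigma>\<in>?S. of_int (sign \<sigma>) * (\<Prod>j<n. F (insert m J) \<sigma> j)) =
        (\<Sum>\<sigma>\<in>?S. of_int (sign \<sigma>) * (\<Prod>j<n. F J \<sigma> j)) -
        (\<Sum>\<sigma>\<in>?S. of_int (sign \<sigma>) * (\<Prod>j<n. F J (\<sigma> \<circ> t) j))"
    proof (subst sum_subtractf [symmetric], rule sum.cong [OF refl])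
      fix \<sigma>
      have "(\<Prod>j<n. F (insert m J) \<sigma> j) = (\<Prod>j<n. F J \<sigma> j) - (\<Prod>j<n. F J (\<sigma> \<circ> t) j)"
        unfolding split [of "F (insert m J) \<sigma>"] split [of "F J \<sigma>"] split [of "F J (\<sigma> \<circ> t)"]
          rest rest_t Fm by (rule left_diff_distrib)
      then show "of_int (sign \<sigma>) * (\<Prod>j<n. F (insert m J) \<sigma> j) =
          of_int (sign \<sigma>) * (\<Prod>j<n. F J \<sigma> j) - of_int (sign \<sigma>) * (\<Prod>j<n. F J (\<sigma> \<circ> t) j)"
        by (simp add: right_diff_distrib)
    qed
    also have "(\<Sum>\<sigma>\<in>?S. of_int (sign \<sigma>) * (\<Prod>j<n. F J (\<sigma> \<circ> t) j)) =
        - (\<Sum>\<sigma>\<in>?S. of_int (sign (\<sigma> \<circ> t)) * (\<Prod>j<n. F J (\<sigma> \<circ> t) j))"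
      unfolding sum_negf [symmetric]
      by (rule sum.cong)
        (use t sgt in \<open>auto simp: sign_compose [OF perm perm]\<close>)
    also have "(\<Sum>\<sigma>\<in>?S. of_int (sign (\<sigma> \<circ> t)) * (\<Prod>j<n. F J (\<sigma> \<circ> t) j)) =
        (\<Sum>\<sigma>\<in>?S. of_int (sign \<sigma>) * (\<Prod>j<n. F J \<sigma> j))"
      by (rule sum_permutations_compose_right [OF t, symmetric])
    finally show ?case
      using insert by (simp add: F_def)
  qed simp
qed

text \<open>Composing with the transposition of two points of equal \<open>g\<close>-value keeps
  \<open>g \<circ> \<sigma>\<close> and reverses the sign, so the sum equals its own
  negative.\<close>

lemma alternating_sum_noninj:
  fixes F :: "('b \<Rightarrow> 'c) \<Rightarrow> 'a::field_char_0"
  assumes "finite S" "\<not> inj_on g S"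
  shows "(\<Sum>\<sigma> | \<sigma> permutes S. of_int (sign \<sigma>) * F (g \<circ> \<sigma>)) = 0"
proof -
  obtain a b where ab: "a \<in> S" "b \<in> S" "a \<noteq> b" "g a = g b"
    using assms(2) unfolding inj_on_def by blast
  define t where "t = Transposition.transpose a b"
  have t: "t permutes S" unfolding t_def by (rule permutes_swap_id) (use ab in auto)
  have sgt: "sign t = -1" using ab unfolding t_def by (simp add: sign_swap_id)
  have "g (t x) = g x" for x using ab by (simp add: t_def Transposition.transpose_def)
  then have gt: "g \<circ> (t \<circ> \<sigma>) = g \<circ> \<sigma>" for \<sigma> by (simp add: fun_eq_iff)
  have perm: "permutation \<sigma>" if "\<sigma> permutes S" for \<sigma>
    using that assms(1) permutation_permutes by blast
  let ?s = "\<Sum>\<sigma> | \<sigma> permutes S. of_int (sign \<sigma>) * F (g \<circ> \<sigma>)"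
  have "?s = (\<Sum>\<sigma> | \<sigma> permutes S. of_int (sign (t \<circ> \<sigma>)) * F (g \<circ> (t \<circ> \<sigma>)))"
    by (rule setum_permutations_compose_left [OF t])
  also have "\<dots> = - ?s"
    unfolding sum_negf [symmetric] gt
    by (rule sum.cong) (use t sgt in \<open>auto simp: sign_compose [OF perm perm]\<close>)
  finally show ?thesis by simp
qed

text \<open>One extension \<open>\<rho>\<close> exists since the complements of \<open>S\<close> and
  of its image are equinumerous; the others are \<open>\<rho> \<circ> \<tau>\<close> with
  \<open>\<tau>\<close> permuting \<open>T - S\<close>.\<close>

lemma card_permutes_extending:
  assumes T: "finite T" "S \<subseteq> T" and i: "inj_on i S" "i ` S \<subseteq> T"
  shows "card {\<pi>. \<pi> permutes T \<and> (\<forall>x\<in>S. \<pi> x = i x)} = fact (card T - card S)"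
proof -
  have fS: "finite S" using T finite_subset by blast
  have "card (T - S) = card (T - i ` S)"
    using T i fS by (simp add: card_Diff_subset card_image finite_subset)
  then obtain h where h: "bij_betw h (T - S) (T - i ` S)"
    using T(1) finite_same_card_bij by (metis finite_Diff)
  define \<rho> where "\<rho> x = (if x \<in> S then i x else if x \<in> T then h x else x)" for x
  have "bij_betw \<rho> S (i ` S)" unfolding bij_betw_def inj_on_def \<rho>_def
    using i(1) by (auto simp: inj_on_def)
  moreover have "bij_betw \<rho> (T - S) (T - i ` S)"
    using h by (rule bij_betw_cong [THEN iffD1, rotated]) (auto simp: \<rho>_def)
  ultimately have "bij_betw \<rho> (S \<union> (T - S)) (i ` S \<union> (T - i ` S))"
    by (rule bij_betw_combine) auto
  moreover have "S \<union> (T - S) = T" "i ` S \<union> (T - i ` S) = T" using T i by auto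
  ultimately have "bij_betw \<rho> T T" by simp
  then have \<rho>: "\<rho> permutes T"
    by (rule bij_imp_permutes) (use T(2) in \<open>auto simp: \<rho>_def\<close>)
  have "{\<pi>. \<pi> permutes T \<and> (\<forall>x\<in>S. \<pi> x = i x)} = (\<lambda>\<tau>. \<rho> \<circ> \<tau>) ` {\<tau>. \<tau> permutes (T - S)}"
  proof (intro subset_antisym subsetI)
    fix \<pi> assume "\<pi> \<in> {\<pi>. \<pi> permutes T \<and> (\<forall>x\<in>S. \<pi> x = i x)}"
    then have \<pi>: "\<pi> permutes T" "\<And>x. x \<in> S \<Longrightarrow> \<pi> x = \<rho> x" by (auto simp: \<rho>_def)
    have "inv_into UNIV \<rho> \<circ> \<pi> permutes T" using \<pi> \<rho> by (simp add: permutes_compose permutes_inv)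
    moreover have "(inv_into UNIV \<rho> \<circ> \<pi>) x = x" if "x \<in> T - (T - S)" for x
      using \<pi>(2) [of x] that permutes_inverses(2) [OF \<rho>] by simp
    ultimately have "inv_into UNIV \<rho> \<circ> \<pi> permutes (T - S)"
      by (rule permutes_superset) 
    moreover have "\<pi> = \<rho> \<circ> (inv_into UNIV \<rho> \<circ> \<pi>)" 
      using permutes_inverses(1) [OF \<rho>] by (simp add: fun_eq_iff)
    ultimately show "\<pi> \<in> (\<lambda>\<tau>. \<rho> \<circ> \<tau>) ` {\<tau>. \<tau> permutes (T - S)}" by blast
  next
    fix \<pi> assume "\<pi> \<in> (\<lambda>\<tau>. \<rho> \<circ> \<tau>) ` {\<tau>. \<tau> permutes (T - S)}"
    then obtain \<tau> where \<tau>: "\<tau> permutes (T - S)" "\<pi> = \<rho> \<circ> \<tau>" by blast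
    then have "\<tau> permutes T" using permutes_subset by blast
    then have "\<pi> permutes T" using \<tau> \<rho> by (simp add: permutes_compose)
    moreover have "\<pi> x = i x" if "x \<in> S" for x
      using that \<tau> by (simp add: \<rho>_def permutes_not_in)
    ultimately show "\<pi> \<in> {\<pi>. \<pi> permutes T \<and> (\<forall>x\<in>S. \<pi> x = i x)}" by blast
  qed
  moreover have "inj_on (\<lambda>\<tau>. \<rho> \<circ> \<tau>) {\<tau>. \<tau> permutes (T - S)}"
    by (rule inj_onI) (use permutes_inj[OF \<rho>] in \<open>auto simp: fun_eq_iff inj_eq\<close>)
  ultimately show ?thesis
    using T fS by (simp add: card_image card_permutations card_Diff_subset)
qed

definition pair_lift :: "(nat \<Rightarrow> nat) \<Rightarrow> nat \<Rightarrow> nat" where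
  "pair_lift \<pi> a = 2 * \<pi> (a div 2) + a mod 2"

lemma pair_lift_even [simp]: "pair_lift \<pi> (2 * j) = 2 * \<pi> j"
  and pair_lift_odd [simp]: "pair_lift \<pi> (2 * j + 1) = 2 * \<pi> j + 1"
  and pair_lift_odd' [simp]: "pair_lift \<pi> (Suc (2 * j)) = Suc (2 * \<pi> j)"
  by (auto simp: pair_lift_def)

lemma pair_lift_compose: "pair_lift (\<pi> \<circ> \<rho>) = pair_lift \<pi> \<circ> pair_lift \<rho>"
  by (auto simp: fun_eq_iff pair_lift_def)

lemma pair_lift_id: "pair_lift id = id"
  by (auto simp: fun_eq_iff pair_lift_def)

lemma pair_lift_transpose:
  "pair_lift (Transposition.transpose a b) =
    Transposition.transpose (2 * a) (2 * b) \<circ> Transposition.transpose (2 * a + 1) (2 * b + 1)"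
proof
  fix x :: nat
  have *: "2 * c + 1 \<noteq> 2 * d" "2 * d \<noteq> 2 * c + 1" for c d :: nat
    by presburger+
  have "x = 2 * (x div 2) \<or> x = 2 * (x div 2) + 1" by presburger
  then obtain j where "x = 2 * j \<or> x = 2 * j + 1" by blast
  then show "pair_lift (Transposition.transpose a b) x =
    (Transposition.transpose (2 * a) (2 * b) \<circ> Transposition.transpose (2 * a + 1) (2 * b + 1)) x"
  proof
    assume "x = 2 * j"
    then show ?thesis using * [of a] * [of b]
      by (simp only: pair_lift_even o_apply Transposition.transpose_def) (simp add: eq_commute)
  next
    assume "x = 2 * j + 1"
    then show ?thesis using * [of _ a] * [of _ b]
      by (simp only: pair_lift_odd o_apply Transposition.transpose_def) (simp add: eq_commute)
  qed
qed

text \<open>A transposition lifts to two disjoint transpositions, so every lift is even: moving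
  partner pairs as rigid blocks costs no sign.\<close>

lemma pair_lift_permutes:
  assumes "\<pi> permutes {..<n}"
  shows "pair_lift \<pi> permutes {..<2 * n} \<and> sign (pair_lift \<pi>) = 1"
  using assms finite_lessThan [of n]
proof (induction rule: permutes_induct)
  case id
  show ?case unfolding pair_lift_id using permutes_id sign_id by blast
next
  case (swap a b p)
  have t: "Transposition.transpose (2 * a) (2 * b) permutes {..<2 * n}"
    "Transposition.transpose (2 * a + 1) (2 * b + 1) permutes {..<2 * n}"
    by (rule permutes_swap_id; use swap in auto)+
  then have "pair_lift (Transposition.transpose a b) permutes {..<2 * n}"
    unfolding pair_lift_transpose by (rule permutes_compose [rotated])
  moreover have "sign (pair_lift (Transposition.transpose a b)) = 1"
    using t unfolding pair_lift_transpose
    by (subst sign_compose) (auto simp: sign_swap_id permutation_swap_id)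
  moreover have "pair_lift p permutes {..<2 * n}" "sign (pair_lift p) = 1"
    using swap by auto
  moreover have "permutation (pair_lift (Transposition.transpose a b))" "permutation (pair_lift p)"
    using calculation permutation_permutes finite_lessThan by blast+
  ultimately show ?case
    unfolding pair_lift_compose by (simp only: permutes_compose sign_compose simp_thms mult_1)
qed

text \<open>A permutation \<open>\<sigma>\<close> with consecutive pairs in the places \<open>j \<ge> k\<close> is \<open>pair_lift \<pi> \<circ> \<tau>\<close> for a
  permutation \<open>\<tau>\<close> of the first \<open>2 k\<close> places; \<open>\<pi>\<close> is only determined on \<open>{k..<N}\<close>, which
  gives the factor \<open>fact k\<close>.\<close>

lemma sum_over_consecutive_pairs:
  fixes A :: "nat \<Rightarrow> nat \<Rightarrow> nat \<Rightarrow> 'a::field_char_0"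
  assumes kN: "k \<le> N"
  shows "fact k * (\<Sum>\<sigma> | \<sigma> permutes {..<2 * N}. of_int (sign \<sigma>) *
      ((\<Prod>j<k. A j (\<sigma> (2 * j)) (\<sigma> (2 * j + 1))) *
       (\<Prod>j\<in>{k..<N}. if even (\<sigma> (2 * j)) \<and> \<sigma> (2 * j + 1) = \<sigma> (2 * j) + 1
                       then s (\<sigma> (2 * j) div 2) else 0))) =
    (\<Sum>\<pi> | \<pi> permutes {..<N}. (\<Prod>j\<in>{k..<N}. s (\<pi> j)) *
      (\<Sum>\<tau> | \<tau> permutes {..<2 * k}. of_int (sign \<tau>) *
        (\<Prod>j<k. A j (pair_lift \<pi> (\<tau> (2 * j))) (pair_lift \<pi> (\<tau> (2 * j + 1))))))"
    (is "_ * sum ?f ?S = (\<Sum>\<pi>\<in>?P. _ \<pi> * sum (_ \<pi>) ?T)")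
proof -
  define good where "good \<sigma> \<longleftrightarrow> (\<forall>j\<in>{k..<N}. even (\<sigma> (2 * j)) \<and> \<sigma> (2 * j + 1) = \<sigma> (2 * j) + 1)"
    for \<sigma> :: "nat \<Rightarrow> nat"
  define R where "R \<sigma> \<pi> \<longleftrightarrow> (\<forall>j\<in>{k..<N}. \<pi> j = \<sigma> (2 * j) div 2)" for \<sigma> \<pi> :: "nat \<Rightarrow> nat"
  define Good where "Good = {\<sigma>\<in>?S. good \<sigma>}"
  have finS: "finite ?S" "finite ?P" by (simp_all add: finite_permutations)
  then have finG: "finite Good" unfolding Good_def by simp
  have "?f \<sigma> = 0" if "\<sigma> \<in> ?S - Good" for \<sigma>
  proof -
    from that obtain j where "j \<in> {k..<N}" "\<not> (even (\<sigma> (2 * j)) \<and> \<sigma> (2 * j + 1) = \<sigma> (2 * j) + 1)"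
      unfolding Good_def good_def by auto
    then have "(\<Prod>j\<in>{k..<N}. if even (\<sigma> (2 * j)) \<and> \<sigma> (2 * j + 1) = \<sigma> (2 * j) + 1
                       then s (\<sigma> (2 * j) div 2) else 0) = 0"
      by (intro prod_zero) auto
    then show ?thesis by (simp only: mult_zero_right)
  qed
  then have "sum ?f ?S = sum ?f Good"
    by (intro sum.mono_neutral_right) (use finS in \<open>auto simp: Good_def\<close>)
  then have "fact k * sum ?f ?S = (\<Sum>\<sigma>\<in>Good. fact k * ?f \<sigma>)"
    by (simp only: sum_distrib_left)
  also have "\<dots> = (\<Sum>\<sigma>\<in>Good. \<Sum>\<pi> | \<pi> \<in> ?P \<and> R \<sigma> \<pi>. ?f \<sigma>)"
  proof (rule sum.cong [OF refl])
    fix \<sigma> assume "\<sigma> \<in> Good"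
    then have \<sigma>: "\<sigma> permutes {..<2 * N}" "good \<sigma>" unfolding Good_def by auto
    have inj: "inj_on (\<lambda>j. \<sigma> (2 * j) div 2) {k..<N}"
    proof (rule inj_onI)
      fix i j assume ij: "i \<in> {k..<N}" "j \<in> {k..<N}" "\<sigma> (2 * i) div 2 = \<sigma> (2 * j) div 2"
      then have "\<sigma> (2 * i) = \<sigma> (2 * j)"
        using \<sigma>(2) unfolding good_def by (metis dvd_mult_div_cancel)
      then have "2 * i = 2 * j" by (rule injD [OF permutes_inj [OF \<sigma>(1)]])
      then show "i = j" by simp
    qed
    have sub': "{k..<N} \<subseteq> {..<N}" by auto
    have im: "(\<lambda>j. \<sigma> (2 * j) div 2) ` {k..<N} \<subseteq> {..<N}"
    proof safe
      fix j assume "j \<in> {k..<N}"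
      then have "\<sigma> (2 * j) \<in> {..<2 * N}" using \<sigma>(1) by (simp only: permutes_in_image) simp
      then show "\<sigma> (2 * j) div 2 < N" by auto
    qed
    have "{\<pi>. \<pi> \<in> ?P \<and> R \<sigma> \<pi>} =
        {\<pi>. \<pi> permutes {..<N} \<and> (\<forall>x\<in>{k..<N}. \<pi> x = \<sigma> (2 * x) div 2)}"
      unfolding R_def by simp
    then have "card {\<pi>. \<pi> \<in> ?P \<and> R \<sigma> \<pi>} = fact k"
      using card_permutes_extending [OF finite_lessThan sub' inj im] kN by simp
    then show "fact k * ?f \<sigma> = (\<Sum>\<pi> | \<pi> \<in> ?P \<and> R \<sigma> \<pi>. ?f \<sigma>)"
      by (simp only: sum_constant of_nat_fact)
  qed
  also have "\<dots> = (\<Sum>\<pi>\<in>?P. \<Sum>\<sigma> | \<sigma> \<in> Good \<and> R \<sigma> \<pi>. ?f \<sigma>)"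
    by (rule sum.swap_restrict [OF finG finS(2)])
  also have "\<dots> = (\<Sum>\<pi> | \<pi> permutes {..<N}. (\<Prod>j\<in>{k..<N}. s (\<pi> j)) *
      (\<Sum>\<tau> | \<tau> permutes {..<2 * k}. of_int (sign \<tau>) *
        (\<Prod>j<k. A j (pair_lift \<pi> (\<tau> (2 * j))) (pair_lift \<pi> (\<tau> (2 * j + 1))))))"
  proof (rule sum.cong [OF refl])
    fix \<pi> assume "\<pi> \<in> ?P"
    then have \<pi>: "\<pi> permutes {..<N}" by simp
    define l where "l = pair_lift \<pi>"
    have l: "l permutes {..<2 * N}" "sign l = 1" using pair_lift_permutes [OF \<pi>] by (auto simp: l_def)
    have l_eq: "l (2 * j) = 2 * \<pi> j" "l (2 * j + 1) = 2 * \<pi> j + 1" for j by (simp_all add: l_def)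
    have sub: "{..<2 * k} \<subseteq> {..<2 * N}" using kN by auto
    have fixed: "\<tau> (2 * j) = 2 * j" "\<tau> (2 * j + 1) = 2 * j + 1"
      if "\<tau> permutes {..<2 * k}" "j \<in> {k..<N}" for \<tau> j
      using that by (auto intro!: permutes_not_in)
    \<comment> \<open>Undoing the block permutation \<open>l\<close> fixes every place from
      \<open>2 * k\<close> on, so what is left permutes the first \<open>2 * k\<close>
      places.\<close>
    have "{\<sigma>. \<sigma> \<in> Good \<and> R \<sigma> \<pi>} = (\<lambda>\<tau>. l \<circ> \<tau>) ` ?T"
    proof (intro subset_antisym subsetI)
      fix \<sigma> assume "\<sigma> \<in> {\<sigma>. \<sigma> \<in> Good \<and> R \<sigma> \<pi>}"
      then have \<sigma>: "\<sigma> permutes {..<2 * N}" "good \<sigma>" "R \<sigma> \<pi>" unfolding Good_def by auto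
      have eq: "\<sigma> (2 * j) = l (2 * j)" "\<sigma> (2 * j + 1) = l (2 * j + 1)" if "j \<in> {k..<N}" for j
        using \<sigma>(2,3) that unfolding good_def R_def l_eq by auto
      have "inv_into UNIV l \<circ> \<sigma> permutes {..<2 * N}"
        by (rule permutes_compose [OF \<sigma>(1) permutes_inv [OF l(1)]])
      moreover have "(inv_into UNIV l \<circ> \<sigma>) x = x" if "x \<in> {..<2 * N} - {..<2 * k}" for x
      proof -
        have "x div 2 \<in> {k..<N}" using that by auto
        moreover have "x = 2 * (x div 2) \<or> x = 2 * (x div 2) + 1" by presburger
        ultimately have "\<sigma> x = l x" using eq by metis
        then show ?thesis using permutes_inverses(2) [OF l(1)] by simp
      qed
      ultimately have "inv_into UNIV l \<circ> \<sigma> permutes {..<2 * k}"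
        by (rule permutes_superset)
      moreover have "\<sigma> = l \<circ> (inv_into UNIV l \<circ> \<sigma>)"
        using permutes_inverses(1) [OF l(1)] by (simp add: fun_eq_iff)
      ultimately show "\<sigma> \<in> (\<lambda>\<tau>. l \<circ> \<tau>) ` ?T" by blast
    next
      fix \<sigma> assume "\<sigma> \<in> (\<lambda>\<tau>. l \<circ> \<tau>) ` ?T"
      then obtain \<tau> where \<tau>: "\<tau> permutes {..<2 * k}" "\<sigma> = l \<circ> \<tau>" by blast
      then have "\<sigma> permutes {..<2 * N}"
        using permutes_compose [OF permutes_subset [OF \<tau>(1) sub] l(1)] by simp
      then show "\<sigma> \<in> {\<sigma>. \<sigma> \<in> Good \<and> R \<sigma> \<pi>}"
        unfolding Good_def good_def R_def using fixed [OF \<tau>(1)] by (simp add: \<tau>(2) l_def)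
    qed
    moreover have "inj_on (\<lambda>\<tau>. l \<circ> \<tau>) ?T"
      using fun.inj_map [OF permutes_inj [OF l(1)]] by (rule inj_on_subset) simp
    ultimately have "(\<Sum>\<sigma> | \<sigma> \<in> Good \<and> R \<sigma> \<pi>. ?f \<sigma>) = (\<Sum>\<tau>\<in>?T. ?f (l \<circ> \<tau>))"
      by (simp only: sum.reindex o_def)
    also have "\<dots> = (\<Sum>\<tau>\<in>?T. (\<Prod>j\<in>{k..<N}. s (\<pi> j)) * (of_int (sign \<tau>) *
        (\<Prod>j<k. A j (l (\<tau> (2 * j))) (l (\<tau> (2 * j + 1))))))"
    proof (rule sum.cong [OF refl])
      fix \<tau> assume "\<tau> \<in> ?T"
      then have \<tau>: "\<tau> permutes {..<2 * k}" by simp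
      have "permutation l" "permutation \<tau>"
        using l(1) \<tau> permutation_permutes finite_lessThan by blast+
      then have sg: "sign (l \<circ> \<tau>) = sign \<tau>" by (simp add: sign_compose l(2))
      have "(\<Prod>j\<in>{k..<N}. if even ((l \<circ> \<tau>) (2 * j)) \<and> (l \<circ> \<tau>) (2 * j + 1) = (l \<circ> \<tau>) (2 * j) + 1
                       then s ((l \<circ> \<tau>) (2 * j) div 2) else 0) = (\<Prod>j\<in>{k..<N}. s (\<pi> j))"
        by (rule prod.cong [OF refl]) (simp only: o_apply fixed [OF \<tau>] l_eq, simp)
      then show "?f (l \<circ> \<tau>) = (\<Prod>j\<in>{k..<N}. s (\<pi> j)) * (of_int (sign \<tau>) *
        (\<Prod>j<k. A j (l (\<tau> (2 * j))) (l (\<tau> (2 * j + 1)))))"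
        by (simp only: sg o_apply mult_ac)
    qed
    finally show "(\<Sum>\<sigma> | \<sigma> \<in> Good \<and> R \<sigma> \<pi>. ?f \<sigma>) = (\<Prod>j\<in>{k..<N}. s (\<pi> j)) *
      (\<Sum>\<tau> | \<tau> permutes {..<2 * k}. of_int (sign \<tau>) *
        (\<Prod>j<k. A j (pair_lift \<pi> (\<tau> (2 * j))) (pair_lift \<pi> (\<tau> (2 * j + 1)))))"
      by (simp only: sum_distrib_left l_def)
  qed
  finally show ?thesis .
qed

text \<open>An injective restriction to \<open>{..<k}\<close> has \<open>fact (N - k)\<close>
  extensions. As \<open>h\<close> vanishes on the other functions, the sum may run over all of
  \<open>{..<k} \<rightarrow>\<^sub>E {..<N}\<close>, which is the index set obtained by expanding a
  product of \<open>k\<close> sums.\<close>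

lemma sum_permutes_restrict:
  fixes h :: "(nat \<Rightarrow> nat) \<Rightarrow> 'a::field_char_0"
  assumes kN: "k \<le> N"
    and dep: "\<And>\<pi>. \<pi> permutes {..<N} \<Longrightarrow> h (restrict \<pi> {..<k}) = h \<pi>"
    and zero: "\<And>i. i \<in> {..<k} \<rightarrow>\<^sub>E {..<N} \<Longrightarrow> \<not> inj_on i {..<k} \<Longrightarrow> h i = 0"
  shows "(\<Sum>\<pi> | \<pi> permutes {..<N}. h \<pi>) = fact (N - k) * (\<Sum>i\<in>{..<k} \<rightarrow>\<^sub>E {..<N}. h i)"
proof -
  let ?E = "{..<k} \<rightarrow>\<^sub>E {..<N}" and ?P = "{\<pi>. \<pi> permutes {..<N}}"
  have fin: "finite ?E" "finite ?P" by (simp_all add: finite_permutations finite_PiE)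
  have "restrict \<pi> {..<k} \<in> ?E" if "\<pi> \<in> ?P" for \<pi>
  proof -
    have "\<pi> x \<in> {..<N}" if "x < k" for x
      using that kN \<open>\<pi> \<in> ?P\<close> permutes_in_image [of \<pi> "{..<N}" x] by simp
    then show ?thesis by auto
  qed
  then have "(\<Sum>\<pi>\<in>?P. h \<pi>) = (\<Sum>i\<in>?E. \<Sum>\<pi> | \<pi> \<in> ?P \<and> restrict \<pi> {..<k} = i. h \<pi>)"
    by (intro sum.group [symmetric] fin image_subsetI)
  also have "\<dots> = (\<Sum>i\<in>?E. fact (N - k) * h i)"
  proof (rule sum.cong [OF refl])
    fix i assume i: "i \<in> ?E"
    have "(\<Sum>\<pi> | \<pi> \<in> ?P \<and> restrict \<pi> {..<k} = i. h \<pi>) =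
        (\<Sum>\<pi> | \<pi> \<in> ?P \<and> restrict \<pi> {..<k} = i. h i)"
      by (rule sum.cong) (use dep in auto)
    also have "\<dots> = of_nat (card {\<pi>. \<pi> \<in> ?P \<and> restrict \<pi> {..<k} = i}) * h i" by simp
    also have "\<dots> = fact (N - k) * h i"
    proof (cases "inj_on i {..<k}")
      case True
      have "{\<pi>. \<pi> \<in> ?P \<and> restrict \<pi> {..<k} = i} = {\<pi>. \<pi> permutes {..<N} \<and> (\<forall>x\<in>{..<k}. \<pi> x = i x)}"
        using i by (auto simp: PiE_def extensional_def restrict_def fun_eq_iff)
      moreover have "card \<dots> = fact (card {..<N} - card {..<k})"
        by (rule card_permutes_extending) (use True i kN in auto)
      ultimately show ?thesis by simp
    qed (use zero i in simp)
    finally show "(\<Sum>\<pi> | \<pi> \<in> ?P \<and> restrict \<pi> {..<k} = i. h \<pi>) = fact (N - k) * h i" .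
  qed
  finally show ?thesis by (simp only: sum_distrib_left)
qed

section \<open>Pfaffians of kernels of finite rank\<close>

abbreviation index_matrix :: "nat \<Rightarrow> (nat \<Rightarrow> nat \<Rightarrow> complex) \<Rightarrow> complex mat" where
  "index_matrix k f \<equiv> Matrix.mat (2 * k) (2 * k) (\<lambda>(a, b). f a b)"

lemma Pf_mat:
  "Pf (index_matrix k f) =
    (\<Sum>\<sigma> | \<sigma> permutes {..<2 * k}.
      of_int (sign \<sigma>) * (\<Prod>i<k. f (\<sigma> (2 * i)) (\<sigma> (2 * i + 1)))) / (2 ^ k * fact k)"
proof -
  have "(\<Prod>i<k. index_matrix k f $$ (\<sigma> (2 * i), \<sigma> (2 * i + 1))) =
      (\<Prod>i<k. f (\<sigma> (2 * i)) (\<sigma> (2 * i + 1)))" if "\<sigma> permutes {..<2 * k}" for \<sigma>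
  proof (rule prod.cong [OF refl])
    fix i assume "i \<in> {..<k}"
    then have "\<sigma> (2 * i) \<in> {..<2 * k}" "\<sigma> (2 * i + 1) \<in> {..<2 * k}"
      unfolding permutes_in_image [OF that] by auto
    then show "index_matrix k f $$ (\<sigma> (2 * i), \<sigma> (2 * i + 1)) =
        f (\<sigma> (2 * i)) (\<sigma> (2 * i + 1))" by simp
  qed
  then show ?thesis unfolding Pf_def Let_def by simp
qed

text \<open>The entries are antisymmetric, so by \<open>alternating_sum_pairs\<close> one half of
  each suffices at the price of \<open>2 ^ k\<close>. Expanding the product of the \<open>k\<close>
  sums then gives one term for each choice \<open>i\<close> of indices.\<close>

lemma Pf_sum_of_rank_two:
  fixes u v :: "nat \<Rightarrow> nat \<Rightarrow> complex"
  shows "2 ^ k * fact k * Pf (index_matrix k (\<lambda>a b. \<Sum>n<N. c n * (u n a * v n b - v n a * u n b))) =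
    2 ^ k * (\<Sum>i\<in>{..<k} \<rightarrow>\<^sub>E {..<N}. (\<Prod>j<k. c (i j)) *
      (\<Sum>\<sigma> | \<sigma> permutes {..<2 * k}.
        of_int (sign \<sigma>) * (\<Prod>j<k. u (i j) (\<sigma> (2 * j)) * v (i j) (\<sigma> (2 * j + 1)))))"
proof -
  define B where "B a b = (\<Sum>n<N. c n * (u n a * v n b))" for a b
  have "(\<Sum>n<N. c n * (u n a * v n b - v n a * u n b)) = B a b - B b a" for a b
    unfolding B_def sum_subtractf [symmetric] by (simp add: algebra_simps)
  then have "2 ^ k * fact k * Pf (index_matrix k (\<lambda>a b. \<Sum>n<N. c n * (u n a * v n b - v n a * u n b))) =
    (\<Sum>\<sigma> | \<sigma> permutes {..<2 * k}. of_int (sign \<sigma>) *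
      (\<Prod>j<k. B (\<sigma> (2 * j)) (\<sigma> (2 * j + 1)) - B (\<sigma> (2 * j + 1)) (\<sigma> (2 * j))))"
    unfolding Pf_mat by simp
  also have "\<dots> = 2 ^ k * (\<Sum>\<sigma> | \<sigma> permutes {..<2 * k}. of_int (sign \<sigma>) *
      (\<Prod>j<k. B (\<sigma> (2 * j)) (\<sigma> (2 * j + 1))))"
    using alternating_sum_pairs [of "{..<k}" k "\<lambda>_. B"] by simp
  also have "(\<Sum>\<sigma> | \<sigma> permutes {..<2 * k}. of_int (sign \<sigma>) *
      (\<Prod>j<k. B (\<sigma> (2 * j)) (\<sigma> (2 * j + 1)))) =
    (\<Sum>\<sigma> | \<sigma> permutes {..<2 * k}. \<Sum>i\<in>{..<k} \<rightarrow>\<^sub>E {..<N}. (\<Prod>j<k. c (i j)) * (of_int (sign \<sigma>) *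
      (\<Prod>j<k. u (i j) (\<sigma> (2 * j)) * v (i j) (\<sigma> (2 * j + 1)))))"
    unfolding B_def by (subst prod_sum_PiE) (simp_all add: sum_distrib_left prod.distrib mult_ac)
  also have "\<dots> = (\<Sum>i\<in>{..<k} \<rightarrow>\<^sub>E {..<N}. (\<Prod>j<k. c (i j)) *
      (\<Sum>\<sigma> | \<sigma> permutes {..<2 * k}.
        of_int (sign \<sigma>) * (\<Prod>j<k. u (i j) (\<sigma> (2 * j)) * v (i j) (\<sigma> (2 * j + 1)))))"
    by (subst sum.swap) (simp only: sum_distrib_left)
  finally show ?thesis .
qed

text \<open>Invariance of a determinant under transposition, in Leibniz form.\<close>

lemma alternating_sum_inverse:
  fixes q :: "'b \<Rightarrow> 'b \<Rightarrow> 'a::comm_ring_1"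
  assumes "finite S"
  shows "(\<Sum>\<tau> | \<tau> permutes S. of_int (sign \<tau>) * (\<Prod>a\<in>S. q (\<tau> a) a)) =
    (\<Sum>\<sigma> | \<sigma> permutes S. of_int (sign \<sigma>) * (\<Prod>a\<in>S. q a (\<sigma> a)))"
proof -
  have "of_int (sign (inv_into UNIV \<sigma>)) * (\<Prod>a\<in>S. q (inv_into UNIV \<sigma> a) a) =
      of_int (sign \<sigma>) * (\<Prod>a\<in>S. q a (\<sigma> a))" if "\<sigma> permutes S" for \<sigma>
  proof -
    have "permutation \<sigma>" using that assms permutation_permutes by blast
    moreover have "(\<Prod>a\<in>S. q (inv_into UNIV \<sigma> a) a) = (\<Prod>a\<in>S. q a (\<sigma> a))"
      by (subst prod.permute [OF that]) (simp add: permutes_inverses(2) [OF that] o_def)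
    ultimately show ?thesis by (simp only: sign_inverse)
  qed
  then show ?thesis
    by (subst sum_permutations_inverse) (intro sum.cong; simp)
qed

text \<open>Here \<open>q a b\<close> stands for polynomial \<open>a\<close> at point
  \<open>b\<close>, and \<open>c\<close> for the skew pairing, which is nonzero only between
  partners. A permutation survives if the places from \<open>k\<close> on hold partner pairs, and
  then the other places hold the remaining partner pairs in any order. The \<open>1 / 2\<close> in
  the kernel supplies a factor \<open>2 ^ k\<close>, which completes the \<open>2 ^ (N - k)\<close>
  from the antisymmetry of \<open>c\<close> to \<open>2 ^ N\<close>.\<close>

lemma integrate_out_pairs:
  fixes q :: "nat \<Rightarrow> nat \<Rightarrow> complex" and s :: "nat \<Rightarrow> complex"
  assumes kN: "k \<le> N" and s: "\<And>n. s n \<noteq> 0"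
    and c: "\<And>a b. c a b = (if even a \<and> b = a + 1 then s (a div 2) else 0) -
                         (if even b \<and> a = b + 1 then s (b div 2) else 0)"
  shows "(\<Sum>\<sigma> | \<sigma> permutes {..<2 * N}. of_int (sign \<sigma>) *
      ((\<Prod>j<k. q (\<sigma> (2 * j)) (2 * j) * q (\<sigma> (2 * j + 1)) (2 * j + 1)) *
       (\<Prod>j\<in>{k..<N}. c (\<sigma> (2 * j)) (\<sigma> (2 * j + 1))))) =
    2 ^ N * fact (N - k) * (\<Prod>n<N. s n) * Pf (index_matrix k (\<lambda>a b. \<Sum>n<N. 1 / (2 * s n) * (q (2 * n) a * q (2 * n + 1) b - q (2 * n + 1) a * q (2 * n) b)))"
    (is "?lhs = _ * _ * _ * ?Pf")
proof -
  define A where "A j a b = q a (2 * j) * q b (2 * j + 1)" for j a b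
  define c' where "c' a b = (if even a \<and> b = a + 1 then s (a div 2) else 0)" for a b
  define D where "D i = (\<Sum>\<tau> | \<tau> permutes {..<2 * k}. of_int (sign \<tau>) *
        (\<Prod>j<k. A j (pair_lift i (\<tau> (2 * j))) (pair_lift i (\<tau> (2 * j + 1)))))" for i
  define h where "h i = (\<Prod>j<k. 1 / s (i j)) * D i" for i
  note split = prod_split_lessThan [OF kN]
  \<comment> \<open>Only the places from \<open>k\<close> on carry the antisymmetric
    \<open>c\<close>; \<open>B\<close> keeps its positive half \<open>c'\<close> there.\<close>
  define B where "B j = (if j < k then A j else c')" for j
  have B1: "(\<Prod>j<N. B j (\<sigma> (2 * j)) (\<sigma> (2 * j + 1)) -
          (if j \<in> {k..<N} then B j (\<sigma> (2 * j + 1)) (\<sigma> (2 * j)) else 0)) =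
      (\<Prod>j<k. A j (\<sigma> (2 * j)) (\<sigma> (2 * j + 1))) *
      (\<Prod>j\<in>{k..<N}. c (\<sigma> (2 * j)) (\<sigma> (2 * j + 1)))" for \<sigma>
    unfolding split by (intro arg_cong2 [where f = "(*)"] prod.cong refl) (simp_all add: B_def c c'_def)
  have B2: "(\<Prod>j<N. B j (\<sigma> (2 * j)) (\<sigma> (2 * j + 1))) =
      (\<Prod>j<k. A j (\<sigma> (2 * j)) (\<sigma> (2 * j + 1))) *
      (\<Prod>j\<in>{k..<N}. c' (\<sigma> (2 * j)) (\<sigma> (2 * j + 1)))" for \<sigma>
    unfolding split by (intro arg_cong2 [where f = "(*)"] prod.cong refl) (simp_all add: B_def)
  have "{k..<N} \<subseteq> {..<N}" by auto
  from alternating_sum_pairs [OF this, of B]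
  have "?lhs = 2 ^ (N - k) * (\<Sum>\<sigma> | \<sigma> permutes {..<2 * N}. of_int (sign \<sigma>) *
      ((\<Prod>j<k. A j (\<sigma> (2 * j)) (\<sigma> (2 * j + 1))) *
      (\<Prod>j\<in>{k..<N}. c' (\<sigma> (2 * j)) (\<sigma> (2 * j + 1)))))"
    unfolding B1 B2 unfolding A_def by simp
  then have "fact k * ?lhs = 2 ^ (N - k) * (\<Sum>\<pi> | \<pi> permutes {..<N}. (\<Prod>j\<in>{k..<N}. s (\<pi> j)) * D \<pi>)"
    unfolding D_def sum_over_consecutive_pairs [OF kN, symmetric] c'_def by simp
  \<comment> \<open>The full product of the \<open>s n\<close> is invariant under
    \<open>\<pi>\<close>, so the factors at the integrated places are that product divided by the
    factors at the first \<open>k\<close> places. This gives the kernel its weights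
    \<open>1 / s n\<close>.\<close>
  also have "(\<Sum>\<pi> | \<pi> permutes {..<N}. (\<Prod>j\<in>{k..<N}. s (\<pi> j)) * D \<pi>) =
      (\<Prod>n<N. s n) * (\<Sum>\<pi> | \<pi> permutes {..<N}. h \<pi>)"
    unfolding sum_distrib_left
  proof (rule sum.cong [OF refl])
    fix \<pi> assume "\<pi> \<in> {\<pi>. \<pi> permutes {..<N}}"
    then have "(\<Prod>n<N. s n) = (\<Prod>n<N. s (\<pi> n))"
      using prod.permute [of \<pi> "{..<N}" s] by (simp add: o_def)
    moreover have "(\<Prod>j<k. s (\<pi> j)) \<noteq> 0" using s by simp
    ultimately show "(\<Prod>j\<in>{k..<N}. s (\<pi> j)) * D \<pi> = (\<Prod>n<N. s n) * h \<pi>"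
      unfolding h_def split by (simp add: prod_dividef)
  qed
  also have "(\<Sum>\<pi> | \<pi> permutes {..<N}. h \<pi>) = fact (N - k) * (\<Sum>i\<in>{..<k} \<rightarrow>\<^sub>E {..<N}. h i)"
  proof (rule sum_permutes_restrict [OF kN])
    fix \<pi> :: "nat \<Rightarrow> nat"
    have lift: "pair_lift (restrict \<pi> {..<k}) (\<tau> b) = pair_lift \<pi> (\<tau> b)"
      if "\<tau> permutes {..<2 * k}" "b < 2 * k" for \<tau> b
    proof -
      have "\<tau> b < 2 * k" using that permutes_in_image [OF that(1), of b] by simp
      then have "\<tau> b div 2 < k" by simp
      then show ?thesis by (simp add: pair_lift_def)
    qed
    have "D (restrict \<pi> {..<k}) = D \<pi>"
      unfolding D_def by (intro sum.cong refl arg_cong2 [where f = "(*)"] prod.cong) (simp add: lift)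
    then show "h (restrict \<pi> {..<k}) = h \<pi>" unfolding h_def by simp
  next
    fix i :: "nat \<Rightarrow> nat"
    assume "\<not> inj_on i {..<k}"
    then obtain a b where ab: "a < k" "b < k" "a \<noteq> b" "i a = i b" by (auto simp: inj_on_def)
    \<comment> \<open>A repeated index puts equal rows into the determinant
      \<open>D i\<close>.\<close>
    have "\<not> inj_on (pair_lift i) {..<2 * k}"
    proof
      assume "inj_on (pair_lift i) {..<2 * k}"
      from inj_onD [OF this, of "2 * a" "2 * b"] ab show False by simp
    qed
    then have "D i = 0"
      unfolding D_def
      using alternating_sum_noninj [of "{..<2 * k}" "pair_lift i"
          "\<lambda>g. \<Prod>j<k. A j (g (2 * j)) (g (2 * j + 1))"] by simp
    then show "h i = 0" unfolding h_def by simp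
  qed
  finally have 1: "fact k * ?lhs = 2 ^ (N - k) * ((\<Prod>n<N. s n) * (fact (N - k) *
      (\<Sum>i\<in>{..<k} \<rightarrow>\<^sub>E {..<N}. h i)))" .
  have D: "D i = (\<Sum>\<sigma> | \<sigma> permutes {..<2 * k}.
        of_int (sign \<sigma>) * (\<Prod>j<k. q (2 * i j) (\<sigma> (2 * j)) * q (2 * i j + 1) (\<sigma> (2 * j + 1))))" for i
    using alternating_sum_inverse [of "{..<2 * k}" "\<lambda>a. q (pair_lift i a)"]
    unfolding D_def A_def prod_double by simp
  have "2 ^ k * fact k * ?Pf = 2 ^ k * (\<Sum>i\<in>{..<k} \<rightarrow>\<^sub>E {..<N}. (\<Prod>j<k. 1 / (2 * s (i j))) * D i)"
    unfolding D by (rule Pf_sum_of_rank_two)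
  also have "\<dots> = (\<Sum>i\<in>{..<k} \<rightarrow>\<^sub>E {..<N}. h i)"
    unfolding h_def by (simp add: sum_distrib_left prod_dividef prod.distrib)
  finally have 2: "(\<Sum>i\<in>{..<k} \<rightarrow>\<^sub>E {..<N}. h i) = 2 ^ k * fact k * ?Pf" ..
  have 3: "(2::complex) ^ N = 2 ^ (N - k) * 2 ^ k" using kN by (simp add: power_add [symmetric])
  have "fact k * ?lhs = fact k * (2 ^ N * fact (N - k) * (\<Prod>n<N. s n) * ?Pf)"
    unfolding 1 2 3 by (simp only: mult_ac)
  then show ?thesis by (simp only: mult_cancel_left fact_nonzero simp_thms)
qed

section \<open>The Boltzmann factor as an alternant\<close>

text \<open>Passing to monomials is a unit lower triangular change of basis, so the determinant is
  the same for all monic families. The Newton polynomials vanish at the earlier nodes, which makes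
  their matrix triangular with the inner products on the diagonal.\<close>

lemma alternant_eq_vandermonde:
  fixes x :: "nat \<Rightarrow> 'a::idom"
  assumes q: "\<And>i. degree (q i) = i" "\<And>i. lead_coeff (q i) = 1"
  shows "(\<Sum>\<sigma> | \<sigma> permutes {..<n}. of_int (sign \<sigma>) * (\<Prod>a<n. poly (q (\<sigma> a)) (x a))) =
    (\<Prod>b<n. \<Prod>a<b. x b - x a)"
proof -
  define M where "M p = Matrix.mat n n (\<lambda>(i, a). poly (p i) (x a))" for p :: "nat \<Rightarrow> 'a poly"
  define V where "V = Matrix.mat n n (\<lambda>(l, a). x a ^ l)"
  have M: "M p \<in> carrier_mat n n" for p unfolding M_def by simp
  have V: "V \<in> carrier_mat n n" unfolding V_def by simp
  have indep: "Determinant.det (M p) = Determinant.det V"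
    if p: "\<And>i. degree (p i) = i" "\<And>i. lead_coeff (p i) = 1" for p
  proof -
    define C where "C = Matrix.mat n n (\<lambda>(i, l). coeff (p i) l)"
    have C: "C \<in> carrier_mat n n" unfolding C_def by simp
    have "Determinant.det C = prod_list (diag_mat C)"
      by (rule det_lower_triangular [OF _ C]) (use p in \<open>auto simp: C_def coeff_eq_0\<close>)
    also have "diag_mat C = map (\<lambda>_. 1) [0..<n]"
      unfolding diag_mat_def C_def using p by (auto intro!: map_cong)
    also have "prod_list \<dots> = (1::'a)" by (simp add: prod_list_replicate map_replicate_const)
    finally have "Determinant.det C = 1" .
    moreover have "M p = C * V"
    proof (rule eq_matI)
      fix i a assume "i < dim_row (C * V)" "a < dim_col (C * V)"
      then have ia: "i < n" "a < n" using C V by auto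
      have "poly (p i) (x a) = (\<Sum>l\<le>i. coeff (p i) l * x a ^ l)"
        using p by (simp add: poly_altdef)
      also have "\<dots> = (\<Sum>l\<in>{0..<n}. coeff (p i) l * x a ^ l)"
        by (rule sum.mono_neutral_left) (use ia p in \<open>auto simp: coeff_eq_0\<close>)
      finally show "M p $$ (i, a) = (C * V) $$ (i, a)"
        using ia by (simp add: M_def C_def V_def scalar_prod_def)
    qed (use M [of p] C V in auto)
    ultimately show ?thesis using det_mult [OF C V] by simp
  qed
  define newton where "newton i = (\<Prod>l<i. [:- x l, 1:])" for i
  have "degree (newton i) = i \<and> lead_coeff (newton i) = 1" for i
  proof (induction i)
    case (Suc i)
    have eq: "newton (Suc i) = newton i * [:- x i, 1:]" by (simp add: newton_def)
    have "newton i \<noteq> 0" unfolding newton_def by simp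
    then have "degree (newton (Suc i)) = degree (newton i) + degree [:- x i, 1:]"
      unfolding eq by (intro degree_mult_eq) auto
    moreover have "lead_coeff (newton (Suc i)) = lead_coeff (newton i) * lead_coeff [:- x i, 1:]"
      unfolding eq by (rule lead_coeff_mult)
    ultimately show ?case using Suc [THEN conjunct1] Suc [THEN conjunct2] by simp
  qed (simp add: newton_def)
  then have "\<And>i. degree (newton i) = i" "\<And>i. lead_coeff (newton i) = 1" by blast+
  from indep [OF q] indep [OF this]
  have "Determinant.det (M q) = Determinant.det (M newton)" by (rule trans [OF _ sym])
  also have "\<dots> = prod_list (diag_mat (M newton))"
  proof (rule det_upper_triangular [OF _ M])
    show "upper_triangular (M newton)"
      by (auto simp: upper_triangular_def M_def newton_def poly_prod)
  qed
  also have "diag_mat (M newton) = map (\<lambda>b. \<Prod>a<b. x b - x a) [0..<n]"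
    unfolding diag_mat_def M_def by (auto simp: newton_def poly_prod intro!: map_cong prod.cong)
  also have "prod_list \<dots> = (\<Prod>b<n. \<Prod>a<b. x b - x a)"
    by (simp add: prod.distinct_set_conv_list [symmetric] lessThan_atLeast0)
  finally have det: "Determinant.det (M q) = (\<Prod>b<n. \<Prod>a<b. x b - x a)" .
  have "Determinant.det (M q) =
      (\<Sum>\<sigma> | \<sigma> permutes {..<n}. of_int (sign \<sigma>) * (\<Prod>a<n. poly (q a) (x (\<sigma> a))))"
    unfolding det_def' [OF M] lessThan_atLeast0
    by (intro sum.cong refl arg_cong2 [where f = "(*)"] prod.cong)
      (auto simp: M_def permutes_in_image)
  then show ?thesis
    unfolding det [symmetric]
    using alternating_sum_inverse [of "{..<n}" "\<lambda>i a. poly (q i) (x a)"] by simp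
qed

text \<open>The order of the points puts a particle and its conjugate on consecutive places. This is
  also the layout of the \<open>2 \<times> 2\<close> blocks in the limiting Pfaffian.\<close>

definition conj_pairs :: "(nat \<Rightarrow> complex) \<Rightarrow> nat \<Rightarrow> complex" where
  "conj_pairs \<zeta> a = (if even a then \<zeta> (a div 2) else cnj (\<zeta> (a div 2)))"

lemma conj_pairs_simps [simp]:
  "conj_pairs \<zeta> (2 * j) = \<zeta> j" "conj_pairs \<zeta> (Suc (2 * j)) = cnj (\<zeta> j)"
  by (simp_all add: conj_pairs_def)

text \<open>The value \<open>- \<infinity>\<close> is excluded because \<open>real_of_ereal\<close>
  sends it to 0, so \<open>exp_minus\<close> takes the value 1 there.\<close>

lemma exp_minus_add:
  assumes "a \<noteq> -\<infinity>" "b \<noteq> -\<infinity>"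
  shows "exp_minus (a + b) = exp_minus a * exp_minus b"
  using assms by (cases a; cases b) (auto simp: exp_minus_def mult_exp_exp)

lemma exp_minus_sum:
  assumes "finite S" "\<And>x. x \<in> S \<Longrightarrow> f x \<noteq> -\<infinity>"
  shows "exp_minus (\<Sum>x\<in>S. f x) = (\<Prod>x\<in>S. exp_minus (f x)) \<and> (\<Sum>x\<in>S. f x) \<noteq> -\<infinity>"
  using assms
proof (induction S rule: finite_induct)
  case (insert x S)
  then have "f x \<noteq> -\<infinity>" "(\<Sum>x\<in>S. f x) \<noteq> -\<infinity>"
    "exp_minus (\<Sum>x\<in>S. f x) = (\<Prod>x\<in>S. exp_minus (f x))" by auto
  then show ?case using insert(1,2) by (simp add: exp_minus_add)
qed (simp add: exp_minus_def)

lemma log_recip_not_MInf [simp]: "log_recip t \<noteq> -\<infinity>"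
  by (simp add: log_recip_def)

lemma exp_minus_log_recip: "t \<ge> 0 \<Longrightarrow> exp_minus (log_recip t) = t"
  by (auto simp: exp_minus_def log_recip_def ln_div)

lemma prod_ordered_pairs:
  fixes g :: "nat \<Rightarrow> nat \<Rightarrow> 'a::comm_monoid_mult"
  assumes "\<And>j l. g j l = g l j"
  shows "(\<Prod>(j, l) \<in> {(j, l). j < N \<and> l < N \<and> j \<noteq> l}. g j l) = (\<Prod>l<N. \<Prod>j<l. (g j l)\<^sup>2)"
proof -
  have "{(j, l). j < N \<and> l < N \<and> j \<noteq> l} = (SIGMA j:{..<N}. {..<N} - {j})" by auto
  then have "(\<Prod>(j, l) \<in> {(j, l). j < N \<and> l < N \<and> j \<noteq> l}. g j l) =
      (\<Prod>j<N. \<Prod>l\<in>{..<N} - {j}. g j l)"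
    by (simp add: prod.Sigma)
  also have "\<dots> = (\<Prod>l<N. \<Prod>j<l. (g j l)\<^sup>2)"
  proof (induction N)
    case (Suc N)
    have "(\<Prod>l\<in>{..<Suc N} - {j}. g j l) = (\<Prod>l\<in>{..<N} - {j}. g j l) * g j N" if "j < N" for j
    proof -
      have "{..<Suc N} - {j} = insert N ({..<N} - {j})" using that by auto
      then show ?thesis by (simp add: mult.commute)
    qed
    moreover have "{..<Suc N} - {N} = {..<N}" by auto
    ultimately have "(\<Prod>j<Suc N. \<Prod>l\<in>{..<Suc N} - {j}. g j l) =
        (\<Prod>j<N. \<Prod>l\<in>{..<N} - {j}. g j l) * ((\<Prod>j<N. g j N) * (\<Prod>j<N. g N j))"
      by (simp add: prod.distrib mult.assoc)
    also have "(\<Prod>j<N. g N j) = (\<Prod>j<N. g j N)" using assms by (intro prod.cong) auto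
    finally show ?case using Suc by (simp add: power2_eq_square prod.distrib mult_ac)
  qed simp
  finally show ?thesis .
qed

text \<open>Each squared modulus is a number times its conjugate. Two particles give all four
  differences between their points. The self-term gives two factors: one completes the Vandermonde
  product, the other stays behind as the weight \<open>\<zeta> j - cnj (\<zeta> j)\<close>. Where
  the Hamiltonian is \<open>\<infinity>\<close>, both sides vanish.\<close>

lemma boltzmann_factor:
  "complex_of_real (exp_minus (Hamiltonian Q N \<zeta>)) =
    (\<Prod>b<2 * N. \<Prod>a<b. conj_pairs \<zeta> b - conj_pairs \<zeta> a) *
    (\<Prod>j<N. (\<zeta> j - cnj (\<zeta> j)) * of_real (exp (- (real N * Q (\<zeta> j)))))"
proof -
  define g where "g j l = cmod (\<zeta> j - \<zeta> l) * cmod (\<zeta> j - cnj (\<zeta> l))" for j l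
  have "cmod (\<zeta> j - cnj (\<zeta> l)) = cmod (\<zeta> l - cnj (\<zeta> j))" for j l
  proof -
    have "\<zeta> l - cnj (\<zeta> j) = - cnj (\<zeta> j - cnj (\<zeta> l))" by simp
    then show ?thesis by (metis complex_mod_cnj norm_minus_cancel)
  qed
  then have g_sym: "g j l = g l j" for j l
    unfolding g_def by (simp add: norm_minus_commute)
  let ?P = "{(j, l). j < N \<and> l < N \<and> j \<noteq> l}"
  have "?P \<subseteq> {..<N} \<times> {..<N}" by auto
  then have fin: "finite ?P" by (rule finite_subset) simp
  have "exp_minus (Hamiltonian Q N \<zeta>) = (\<Prod>(j, l) \<in> ?P. exp_minus (log_recip (g j l))) *
      (\<Prod>j<N. exp_minus (log_recip ((cmod (\<zeta> j - cnj (\<zeta> j)))\<^sup>2) + ereal (real N * Q (\<zeta> j))))"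
    unfolding Hamiltonian_def g_def
    using exp_minus_sum [OF fin, of "\<lambda>(j, l). log_recip (cmod (\<zeta> j - \<zeta> l) * cmod (\<zeta> j - cnj (\<zeta> l)))"]
      exp_minus_sum [of "{..<N}" "\<lambda>j. log_recip ((cmod (\<zeta> j - cnj (\<zeta> j)))\<^sup>2) + ereal (real N * Q (\<zeta> j))"]
    by (subst exp_minus_add) (auto simp: case_prod_unfold)
  also have "(\<Prod>(j, l) \<in> ?P. exp_minus (log_recip (g j l))) = (\<Prod>(j, l) \<in> ?P. g j l)"
    by (rule prod.cong) (auto simp: exp_minus_log_recip g_def)
  also have "\<dots> = (\<Prod>l<N. \<Prod>j<l. (g j l)\<^sup>2)" by (rule prod_ordered_pairs [OF g_sym])
  also have "(\<Prod>j<N. exp_minus (log_recip ((cmod (\<zeta> j - cnj (\<zeta> j)))\<^sup>2) + ereal (real N * Q (\<zeta> j)))) =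
      (\<Prod>j<N. (cmod (\<zeta> j - cnj (\<zeta> j)))\<^sup>2 * exp (- (real N * Q (\<zeta> j))))"
    by (rule prod.cong) (auto simp: exp_minus_add exp_minus_log_recip, simp add: exp_minus_def)
  finally have 1: "exp_minus (Hamiltonian Q N \<zeta>) = (\<Prod>l<N. (\<Prod>j<l. (g j l)\<^sup>2) *
      ((cmod (\<zeta> l - cnj (\<zeta> l)))\<^sup>2 * exp (- (real N * Q (\<zeta> l)))))"
    by (simp add: prod.distrib)
  have sq: "complex_of_real ((g j l)\<^sup>2) =
      (\<zeta> l - \<zeta> j) * (\<zeta> l - cnj (\<zeta> j)) * ((cnj (\<zeta> l) - \<zeta> j) * (cnj (\<zeta> l) - cnj (\<zeta> j)))" for j l
  proof -
    have "complex_of_real ((g j l)\<^sup>2) = complex_of_real ((g l j)\<^sup>2)" by (simp only: g_sym)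
    also have "\<dots> = complex_of_real ((cmod (\<zeta> l - \<zeta> j))\<^sup>2) * complex_of_real ((cmod (\<zeta> l - cnj (\<zeta> j)))\<^sup>2)"
      by (simp add: g_def power_mult_distrib)
    also have "\<dots> = (\<zeta> l - \<zeta> j) * cnj (\<zeta> l - \<zeta> j) * ((\<zeta> l - cnj (\<zeta> j)) * cnj (\<zeta> l - cnj (\<zeta> j)))"
      by (simp only: complex_norm_square)
    finally show ?thesis by (simp add: mult_ac)
  qed
  have sq': "complex_of_real ((cmod (\<zeta> l - cnj (\<zeta> l)))\<^sup>2) =
      (cnj (\<zeta> l) - \<zeta> l) * (\<zeta> l - cnj (\<zeta> l))" for l
    by (simp only: complex_norm_square complex_cnj_diff complex_cnj_cnj mult.commute)
  have "(\<Prod>b<2 * N. \<Prod>a<b. conj_pairs \<zeta> b - conj_pairs \<zeta> a) =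
      (\<Prod>l<N. (\<Prod>j<l. complex_of_real ((g j l)\<^sup>2)) * (cnj (\<zeta> l) - \<zeta> l))"
    unfolding prod_double [of _ N]
  proof (rule prod.cong [OF refl])
    fix l
    have "(\<Prod>a<2 * l. conj_pairs \<zeta> (2 * l) - conj_pairs \<zeta> a) *
        (\<Prod>a<2 * l + 1. conj_pairs \<zeta> (2 * l + 1) - conj_pairs \<zeta> a) =
        (\<Prod>j<l. (\<zeta> l - \<zeta> j) * (\<zeta> l - cnj (\<zeta> j))) *
        ((\<Prod>j<l. (cnj (\<zeta> l) - \<zeta> j) * (cnj (\<zeta> l) - cnj (\<zeta> j))) * (cnj (\<zeta> l) - \<zeta> l))"
      by (simp add: prod_double)
    also have "\<dots> = (\<Prod>j<l. complex_of_real ((g j l)\<^sup>2)) * (cnj (\<zeta> l) - \<zeta> l)"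
      unfolding sq by (simp only: prod.distrib mult_ac)
    finally show "(\<Prod>a<2 * l. conj_pairs \<zeta> (2 * l) - conj_pairs \<zeta> a) *
        (\<Prod>a<2 * l + 1. conj_pairs \<zeta> (2 * l + 1) - conj_pairs \<zeta> a) =
        (\<Prod>j<l. complex_of_real ((g j l)\<^sup>2)) * (cnj (\<zeta> l) - \<zeta> l)" .
  qed
  then show ?thesis
    unfolding 1 by (simp add: prod.distrib sq' mult_ac del: of_real_power)
qed

section \<open>Complex Gaussian moments\<close>

lemma lborel_complex: "lborel = distr (lborel \<Otimes>\<^sub>M lborel) borel (\<lambda>(x, y). Complex x y)"
proof (rule lborel_eqI)
  have meas: "(\<lambda>(x, y). Complex x y) \<in> borel_measurable (lborel \<Otimes>\<^sub>M lborel)"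
    by (simp add: Complex_eq case_prod_unfold)
  fix l u :: complex
  assume le: "\<And>b. b \<in> Basis \<Longrightarrow> l \<bullet> b \<le> u \<bullet> b"
  have "(\<lambda>(x, y). Complex x y) -` box l u = {Re l<..<Re u} \<times> {Im l<..<Im u}"
    by (auto simp: in_box_complex_iff)
  then have "emeasure (distr (lborel \<Otimes>\<^sub>M lborel) borel (\<lambda>(x, y). Complex x y)) (box l u) =
      emeasure (lborel \<Otimes>\<^sub>M lborel) ({Re l<..<Re u} \<times> {Im l<..<Im u})"
    by (subst emeasure_distr [OF meas]) (auto simp: space_pair_measure)
  also have "\<dots> = ennreal (Re u - Re l) * ennreal (Im u - Im l)"
    using le [of 1] le [of \<i>] by (subst lborel.emeasure_pair_measure_Times) (auto simp: Basis_complex_def)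
  also have "\<dots> = ennreal (\<Prod>b\<in>Basis. (u - l) \<bullet> b)"
    using le [of 1] le [of \<i>] by (simp add: Basis_complex_def ennreal_mult)
  finally show "emeasure (distr (lborel \<Otimes>\<^sub>M lborel) borel (\<lambda>(x, y). Complex x y)) (box l u) =
      ennreal (\<Prod>b\<in>Basis. (u - l) \<bullet> b)" .
qed simp

lemma integrable_lborel_pair_mult:
  fixes f g :: "real \<Rightarrow> real"
  assumes f: "integrable lborel f" and g: "integrable lborel g"
  shows "integrable (lborel \<Otimes>\<^sub>M lborel) (\<lambda>(x, y). f x * g y)"
proof (rule lborel_pair.Fubini_integrable)
  have [measurable]: "f \<in> borel_measurable lborel" "g \<in> borel_measurable lborel" using f g by auto
  show "(\<lambda>(x, y). f x * g y) \<in> borel_measurable (lborel \<Otimes>\<^sub>M lborel)" by measurable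
  have "(\<lambda>x. \<integral>y. norm (f x * g y) \<partial>lborel) = (\<lambda>x. norm (f x) * (\<integral>y. norm (g y) \<partial>lborel))"
    by (simp add: abs_mult)
  then show "integrable lborel (\<lambda>x. \<integral>y. norm (case (x, y) of (x, y) \<Rightarrow> f x * g y) \<partial>lborel)"
    using f by simp
qed (use g in simp)

context
  fixes \<sigma> :: real
  assumes \<sigma>: "\<sigma> > 0"
begin

abbreviation \<phi> :: "real \<Rightarrow> real" where "\<phi> \<equiv> normal_density 0 \<sigma>"

lemma has_bochner_integral_normal_power:
  "has_bochner_integral lborel (\<lambda>x. \<phi> x * x ^ n)
    (if even n then fact n / ((2 / \<sigma>\<^sup>2) ^ (n div 2) * fact (n div 2)) else 0)"
proof (cases "even n")
  case True
  then obtain m where "n = 2 * m" by (auto elim: evenE)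
  then show ?thesis using normal_moment_even [OF \<sigma>, of 0 m] by simp
next
  case False
  then obtain m where "n = 2 * m + 1" by (auto elim: oddE)
  then show ?thesis using normal_moment_odd [OF \<sigma>, of 0 m] by simp
qed

lemma integrable_normal_power: "integrable lborel (\<lambda>x. \<phi> x * x ^ n)"
  and integral_normal_power: "(\<integral>x. \<phi> x * x ^ n \<partial>lborel) =
    (if even n then fact n / ((2 / \<sigma>\<^sup>2) ^ (n div 2) * fact (n div 2)) else 0)"
  using has_bochner_integral_normal_power [of n] by (simp_all only: has_bochner_integral_iff)

text \<open>Integration by parts for a power, read off from the explicit moments. At
  \<open>n = 0\<close> the truncated \<open>n - 1\<close> has coefficient 0.\<close>

lemma integral_normal_power_Suc:
  "(\<integral>x. \<phi> x * x ^ Suc n \<partial>lborel) = \<sigma>\<^sup>2 * (real n * (\<integral>x. \<phi> x * x ^ (n - 1) \<partial>lborel))"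
proof (cases n)
  case (Suc m)
  show ?thesis
  proof (cases "even m")
    case True
    then obtain j where "m = 2 * j" by (auto elim: evenE)
    define t F G where "t = (2 / \<sigma>\<^sup>2) ^ j" and "F = (fact (2 * j) :: real)" and "G = (fact j :: real)"
    have nz: "t \<noteq> 0" "G \<noteq> 0" "\<sigma>\<^sup>2 \<noteq> 0" "1 + real j \<noteq> 0" using \<sigma> by (simp_all add: t_def G_def)
    have "(1 + real (Suc (2 * j))) * ((1 + real (2 * j)) * F) / (2 / \<sigma>\<^sup>2 * t * ((1 + real j) * G)) =
        \<sigma>\<^sup>2 * ((1 + real (2 * j)) * (F / (t * G)))"
    proof -
      have "1 + real (Suc (2 * j)) = 2 * (1 + real j)" by simp
      then show ?thesis using nz by (simp add: divide_simps)
    qed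
    then show ?thesis
      unfolding integral_normal_power Suc
      using \<open>m = 2 * j\<close> by (simp add: t_def F_def G_def)
  next
    case False
    then show ?thesis unfolding Suc integral_normal_power by simp
  qed
next
  case 0
  then show ?thesis unfolding integral_normal_power by simp
qed

lemma integrable_normal_poly:
  "integrable lborel (\<lambda>x. of_real (\<phi> x) * poly p (complex_of_real x))"
proof -
  have "integrable lborel (\<lambda>x. \<Sum>i\<le>degree p. coeff p i * complex_of_real (\<phi> x * x ^ i))"
    using integrable_normal_power
    by (intro Bochner_Integration.integrable_sum integrable_mult_right) (simp only: complex_of_real_integrable_eq)
  then show ?thesis
    by (simp add: poly_altdef sum_distrib_left mult_ac)
qed

text \<open>Stein's identity, extended from monomials to polynomials by linearity.\<close>

lemma stein_normal_poly:
  "(\<integral>x. of_real (\<phi> x) * (complex_of_real x * poly p (of_real x)) \<partial>lborel) =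
    of_real (\<sigma>\<^sup>2) * (\<integral>x. of_real (\<phi> x) * poly (pderiv p) (complex_of_real x) \<partial>lborel)"
proof -
  define E where "E p = (\<integral>x. of_real (\<phi> x) * poly p (complex_of_real x) \<partial>lborel)" for p
  have E_add: "E (p + q) = E p + E q" for p q
    unfolding E_def poly_add distrib_left
    by (rule Bochner_Integration.integral_add) (rule integrable_normal_poly)+
  have E_monom: "E (monom c n) = c * of_real (\<integral>x. \<phi> x * x ^ n \<partial>lborel)" for c n
  proof -
    have "E (monom c n) = (\<integral>x. c * complex_of_real (\<phi> x * x ^ n) \<partial>lborel)"
      unfolding E_def by (simp add: poly_monom mult_ac)
    then show ?thesis by (simp del: of_real_mult of_real_power)
  qed
  have "E (pCons 0 (\<Sum>i\<in>I. monom (f i) i)) = of_real (\<sigma>\<^sup>2) * E (pderiv (\<Sum>i\<in>I. monom (f i) i))"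
    if "finite I" for f I
    using that
  proof (induction I rule: finite_induct)
    case (insert n I)
    have "E (pCons 0 (monom (f n) n)) = of_real (\<sigma>\<^sup>2) * E (pderiv (monom (f n) n))"
      unfolding monom_Suc [symmetric] pderiv_monom E_monom integral_normal_power_Suc
      by (simp add: mult_ac)
    moreover have "pCons 0 (\<Sum>i\<in>insert n I. monom (f i) i) =
        pCons 0 (monom (f n) n) + pCons 0 (\<Sum>i\<in>I. monom (f i) i)"
      using insert by simp
    moreover have "pderiv (\<Sum>i\<in>insert n I. monom (f i) i) =
        pderiv (monom (f n) n) + pderiv (\<Sum>i\<in>I. monom (f i) i)"
      using insert by (simp add: pderiv_add)
    ultimately show ?case using insert by (simp only: E_add distrib_left)
  qed (simp add: E_def)
  from this [of "{..degree p}" "coeff p"] show ?thesis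
    by (simp add: poly_as_sum_of_monoms E_def)
qed

lemma integrable_complex_gauss:
  "integrable (lborel \<Otimes>\<^sub>M lborel)
    (\<lambda>(x, y). of_real (\<phi> x * \<phi> y) * (Complex x y ^ a * cnj (Complex x y) ^ b))"
proof -
  have \<phi>: "\<phi> x \<ge> 0" for x by simp
  define n where "n = a + b"
  have int: "integrable lborel (\<lambda>x. \<phi> x * \<bar>x\<bar> ^ n)" for n
    using integrable_norm [OF integrable_normal_power [of n]] by (simp add: abs_mult power_abs)
  have int': "integrable (lborel \<Otimes>\<^sub>M lborel) (\<lambda>(x, y). 2 ^ n * ((\<phi> x * \<bar>x\<bar> ^ n) * (\<phi> y * \<bar>y\<bar> ^ 0)
      + (\<phi> x * \<bar>x\<bar> ^ 0) * (\<phi> y * \<bar>y\<bar> ^ n)))"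
    using integrable_lborel_pair_mult [OF int int, of n 0] integrable_lborel_pair_mult [OF int int, of 0 n]
    unfolding case_prod_unfold by (intro integrable_mult_right Bochner_Integration.integrable_add)
  show ?thesis
  proof (rule Bochner_Integration.integrable_bound [OF int'])
    show "(\<lambda>(x, y). of_real (\<phi> x * \<phi> y) * (Complex x y ^ a * cnj (Complex x y) ^ b))
        \<in> borel_measurable (lborel \<Otimes>\<^sub>M lborel)"
      unfolding case_prod_unfold complex_cnj unfolding Complex_eq by measurable
    have "norm (of_real (\<phi> x * \<phi> y) * (Complex x y ^ a * cnj (Complex x y) ^ b)) \<le>
        2 ^ n * ((\<phi> x * \<bar>x\<bar> ^ n) * (\<phi> y * \<bar>y\<bar> ^ 0) + (\<phi> x * \<bar>x\<bar> ^ 0) * (\<phi> y * \<bar>y\<bar> ^ n))" for x y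
    proof -
      have "cmod (Complex x y) \<le> \<bar>x\<bar> + \<bar>y\<bar>" using cmod_le [of "Complex x y"] by simp
      also have "\<dots> \<le> 2 * max \<bar>x\<bar> \<bar>y\<bar>" by simp
      finally have "cmod (Complex x y) ^ n \<le> (2 * max \<bar>x\<bar> \<bar>y\<bar>) ^ n" by (intro power_mono) auto
      also have "\<dots> = 2 ^ n * max \<bar>x\<bar> \<bar>y\<bar> ^ n" by (rule power_mult_distrib)
      \<comment> \<open>Splitting the maximum leaves a sum of products of one-variable functions,
        which is integrable over the plane.\<close>
      also have "max \<bar>x\<bar> \<bar>y\<bar> ^ n \<le> \<bar>x\<bar> ^ n + \<bar>y\<bar> ^ n" by (simp add: max_def)
      finally have "cmod (Complex x y) ^ n \<le> 2 ^ n * (\<bar>x\<bar> ^ n + \<bar>y\<bar> ^ n)" by simp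
      then have "\<phi> x * \<phi> y * cmod (Complex x y) ^ n \<le> \<phi> x * \<phi> y * (2 ^ n * (\<bar>x\<bar> ^ n + \<bar>y\<bar> ^ n))"
        by (intro mult_left_mono) auto
      then show ?thesis
        unfolding n_def by (simp add: norm_mult norm_power power_add algebra_simps del: complex_cnj)
    qed
    then show "AE z in lborel \<Otimes>\<^sub>M lborel.
        norm (case z of (x, y) \<Rightarrow> of_real (\<phi> x * \<phi> y) * (Complex x y ^ a * cnj (Complex x y) ^ b)) \<le>
        norm (case z of (x, y) \<Rightarrow> 2 ^ n * ((\<phi> x * \<bar>x\<bar> ^ n) * (\<phi> y * \<bar>y\<bar> ^ 0) +
          (\<phi> x * \<bar>x\<bar> ^ 0) * (\<phi> y * \<bar>y\<bar> ^ n)))"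
      by (intro AE_I2) (force intro: order_trans [OF _ abs_ge_self])
  qed
qed

lemma stein_normal_powers:
  fixes \<alpha> \<beta> \<gamma> \<delta> :: complex
  shows "(\<integral>t. of_real (\<phi> t) * (of_real t * ((\<alpha> + \<beta> * of_real t) ^ a * (\<gamma> + \<delta> * of_real t) ^ b)) \<partial>lborel) =
    (\<integral>t. of_real (\<sigma>\<^sup>2) * (of_real (\<phi> t) *
      (of_nat a * \<beta> * ((\<alpha> + \<beta> * of_real t) ^ (a - 1) * (\<gamma> + \<delta> * of_real t) ^ b) +
       of_nat b * \<delta> * ((\<alpha> + \<beta> * of_real t) ^ a * (\<gamma> + \<delta> * of_real t) ^ (b - 1)))) \<partial>lborel)"
proof -
  define p where "p = [:\<alpha>, \<beta>:] ^ a * [:\<gamma>, \<delta>:] ^ b"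
  have p: "(\<alpha> + \<beta> * of_real t) ^ a * (\<gamma> + \<delta> * of_real t) ^ b = poly p (of_real t)" for t
    by (simp add: p_def algebra_simps)
  have p': "of_nat a * \<beta> * ((\<alpha> + \<beta> * of_real t) ^ (a - 1) * (\<gamma> + \<delta> * of_real t) ^ b) +
      of_nat b * \<delta> * ((\<alpha> + \<beta> * of_real t) ^ a * (\<gamma> + \<delta> * of_real t) ^ (b - 1)) =
      poly (pderiv p) (of_real t)" for t
    unfolding p_def pderiv_mult pderiv_power
    by (simp add: pderiv_pCons algebra_simps)
  show ?thesis
    unfolding p' unfolding p stein_normal_poly by simp
qed

lemma integrable_gauss_coord:
  "integrable (lborel \<Otimes>\<^sub>M lborel)
    (\<lambda>(x, y). of_real (\<phi> x * \<phi> y) * (of_real x * (Complex x y ^ a * cnj (Complex x y) ^ b)))"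
  "integrable (lborel \<Otimes>\<^sub>M lborel)
    (\<lambda>(x, y). of_real (\<phi> x * \<phi> y) * (of_real y * (Complex x y ^ a * cnj (Complex x y) ^ b)))"
proof -
  define m where "m a b = (\<lambda>(x, y). of_real (\<phi> x * \<phi> y) * (Complex x y ^ a * cnj (Complex x y) ^ b))" for a b
  have m: "integrable (lborel \<Otimes>\<^sub>M lborel) (m a b)" for a b
    unfolding m_def by (rule integrable_complex_gauss)
  have "(\<lambda>(x, y). of_real (\<phi> x * \<phi> y) * (of_real x * (Complex x y ^ a * cnj (Complex x y) ^ b))) =
      (\<lambda>z. 1 / 2 * (m (Suc a) b z + m a (Suc b) z))"
  proof -
    have "X = 1 / 2 * (Z + W) \<Longrightarrow> c * (X * (Z ^ a * W ^ b)) =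
        1 / 2 * (c * (Z ^ Suc a * W ^ b) + c * (Z ^ a * W ^ Suc b))" for X Z W c :: complex
      by (erule ssubst) (simp add: algebra_simps)
    moreover have "complex_of_real x = 1 / 2 * (Complex x y + cnj (Complex x y))" for x y
      by (simp add: complex_eq_iff)
    ultimately have "of_real (\<phi> x * \<phi> y) * (of_real x * (Complex x y ^ a * cnj (Complex x y) ^ b)) =
        1 / 2 * (m (Suc a) b (x, y) + m a (Suc b) (x, y))" for x y
      unfolding m_def prod.case by blast
    then show ?thesis by (auto simp: fun_eq_iff)
  qed
  then show "integrable (lborel \<Otimes>\<^sub>M lborel)
    (\<lambda>(x, y). of_real (\<phi> x * \<phi> y) * (of_real x * (Complex x y ^ a * cnj (Complex x y) ^ b)))"
    using m by simp
  have "(\<lambda>(x, y). of_real (\<phi> x * \<phi> y) * (of_real y * (Complex x y ^ a * cnj (Complex x y) ^ b))) =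
      (\<lambda>z. - \<i> / 2 * (m (Suc a) b z - m a (Suc b) z))"
  proof -
    have "X = - \<i> / 2 * (Z - W) \<Longrightarrow> c * (X * (Z ^ a * W ^ b)) =
        - \<i> / 2 * (c * (Z ^ Suc a * W ^ b) - c * (Z ^ a * W ^ Suc b))" for X Z W c :: complex
      by (erule ssubst) (simp add: field_simps)
    moreover have "complex_of_real y = - \<i> / 2 * (Complex x y - cnj (Complex x y))" for x y
      by (simp add: complex_eq_iff)
    ultimately have "of_real (\<phi> x * \<phi> y) * (of_real y * (Complex x y ^ a * cnj (Complex x y) ^ b)) =
        - \<i> / 2 * (m (Suc a) b (x, y) - m a (Suc b) (x, y))" for x y
      unfolding m_def prod.case by blast
    then show ?thesis by (auto simp: fun_eq_iff)
  qed
  then show "integrable (lborel \<Otimes>\<^sub>M lborel)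
    (\<lambda>(x, y). of_real (\<phi> x * \<phi> y) * (of_real y * (Complex x y ^ a * cnj (Complex x y) ^ b)))"
    using m by simp
qed

text \<open>Stein's identity in both coordinates: multiplication by \<open>x + \<i> * y\<close> acts
  as \<open>\<sigma>\<^sup>2\<close> times the \<open>x\<close>-derivative plus \<open>\<i>\<close>
  times the \<open>y\<close>-derivative, that is \<open>2 * \<sigma>\<^sup>2\<close> times the
  Wirtinger derivative in the conjugate variable. So it removes one conjugate factor and leaves the
  powers of \<open>z\<close> alone.\<close>

lemma gauss_moment_Suc:
  defines "J \<equiv> \<lambda>a b. \<integral>(x, y). of_real (\<phi> x * \<phi> y) * (Complex x y ^ a * cnj (Complex x y) ^ b)
     \<partial>(lborel \<Otimes>\<^sub>M lborel)"
  shows "J (Suc a) b = of_real (2 * \<sigma>\<^sup>2) * (of_nat b * J a (b - 1))"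
proof -
  let ?m = "\<lambda>a b x y. Complex x y ^ a * cnj (Complex x y) ^ b"
  let ?w = "\<lambda>x y. complex_of_real (\<phi> x * \<phi> y)"
  let ?L = "lborel \<Otimes>\<^sub>M lborel"
  \<comment> \<open>The derivative along a direction in which \<open>z\<close> changes at rate
    \<open>u\<close> and its conjugate at rate \<open>v\<close>: \<open>1\<close>, \<open>1\<close>
    for \<open>x\<close> and \<open>\<i>\<close>, \<open>- \<i>\<close> for
    \<open>y\<close>.\<close>
  define D where "D u v = (\<lambda>(x, y). of_real (\<sigma>\<^sup>2) *
      (of_nat a * u * (?w x y * ?m (a - 1) b x y) + of_nat b * v * (?w x y * ?m a (b - 1) x y)))" for u v
  have int_D: "integrable ?L (D u v)" for u v
    unfolding D_def case_prod_unfold using integrable_complex_gauss [unfolded case_prod_unfold]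
    by (intro integrable_mult_right Bochner_Integration.integrable_add)
  have D: "(\<integral>z. D u v z \<partial>?L) = of_real (\<sigma>\<^sup>2) * (of_nat a * u * J (a - 1) b + of_nat b * v * J a (b - 1))" for u v
    unfolding J_def D_def case_prod_unfold
    using integrable_complex_gauss [unfolded case_prod_unfold]
    by (subst integral_mult_right_zero, subst Bochner_Integration.integral_add) simp_all
  have z: "Complex x y = \<i> * of_real y + 1 * of_real x" "cnj (Complex x y) = - \<i> * of_real y + 1 * of_real x"
    "Complex x y = of_real x + \<i> * of_real y" "cnj (Complex x y) = of_real x + - \<i> * of_real y" for x y
    by (simp_all add: complex_eq_iff)
  have X: "(\<integral>(x, y). ?w x y * (of_real x * ?m a b x y) \<partial>?L) = (\<integral>z. D 1 1 z \<partial>?L)"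
  proof -
    have inner: "(\<integral>x. ?w x y * (of_real x * ?m a b x y) \<partial>lborel) = (\<integral>x. D 1 1 (x, y) \<partial>lborel)" for y
    proof -
      have "(\<integral>x. ?w x y * (of_real x * ?m a b x y) \<partial>lborel) =
          of_real (\<phi> y) * (\<integral>x. of_real (\<phi> x) * (of_real x * ?m a b x y) \<partial>lborel)"
        unfolding integral_mult_right_zero [symmetric] by (simp add: mult_ac)
      also have "\<dots> = (\<integral>x. D 1 1 (x, y) \<partial>lborel)"
        unfolding z(2) unfolding z(1) stein_normal_powers
        unfolding z(1,2) [symmetric] D_def integral_mult_right_zero [symmetric]
        by (simp add: algebra_simps)
      finally show ?thesis .
    qed
    have "(\<integral>(x, y). ?w x y * (of_real x * ?m a b x y) \<partial>?L) =
        (\<integral>y. (\<integral>x. ?w x y * (of_real x * ?m a b x y) \<partial>lborel) \<partial>lborel)"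
      by (rule lborel_pair.integral_snd [OF integrable_gauss_coord(1), symmetric])
    also have "\<dots> = (\<integral>(x, y). D 1 1 (x, y) \<partial>?L)"
      unfolding inner by (rule lborel_pair.integral_snd) (use int_D in simp)
    finally show ?thesis by simp
  qed
  have Y: "(\<integral>(x, y). ?w x y * (of_real y * ?m a b x y) \<partial>?L) = (\<integral>z. D \<i> (- \<i>) z \<partial>?L)"
  proof -
    have inner: "(\<integral>y. ?w x y * (of_real y * ?m a b x y) \<partial>lborel) = (\<integral>y. D \<i> (- \<i>) (x, y) \<partial>lborel)" for x
    proof -
      have "(\<integral>y. ?w x y * (of_real y * ?m a b x y) \<partial>lborel) =
          of_real (\<phi> x) * (\<integral>y. of_real (\<phi> y) * (of_real y * ?m a b x y) \<partial>lborel)"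
        unfolding integral_mult_right_zero [symmetric] by (simp add: mult_ac)
      also have "\<dots> = (\<integral>y. D \<i> (- \<i>) (x, y) \<partial>lborel)"
        unfolding z(4) unfolding z(3) stein_normal_powers
        unfolding z(3,4) [symmetric] D_def integral_mult_right_zero [symmetric]
        by (simp add: algebra_simps)
      finally show ?thesis .
    qed
    have "(\<integral>(x, y). ?w x y * (of_real y * ?m a b x y) \<partial>?L) =
        (\<integral>x. (\<integral>y. ?w x y * (of_real y * ?m a b x y) \<partial>lborel) \<partial>lborel)"
      using lborel_pair.integral_fst' [OF integrable_gauss_coord(2)] by simp
    also have "\<dots> = (\<integral>z. D \<i> (- \<i>) z \<partial>?L)"
      unfolding inner by (rule lborel_pair.integral_fst' [OF int_D])
    finally show ?thesis .
  qed
  have "J (Suc a) b = (\<integral>(x, y). ?w x y * (of_real x * ?m a b x y) + \<i> * (?w x y * (of_real y * ?m a b x y)) \<partial>?L)"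
    unfolding J_def by (intro arg_cong [where f = "integral\<^sup>L ?L"]) (simp add: fun_eq_iff Complex_eq algebra_simps)
  also have "\<dots> = (\<integral>z. D 1 1 z \<partial>?L) + \<i> * (\<integral>z. D \<i> (- \<i>) z \<partial>?L)"
    unfolding X [symmetric] Y [symmetric]
    using integrable_gauss_coord [of a b] unfolding case_prod_unfold
    by (subst Bochner_Integration.integral_add) simp_all
  also have "\<dots> = of_real (2 * \<sigma>\<^sup>2) * (of_nat b * J a (b - 1))"
    unfolding D by (simp add: algebra_simps)
  finally show ?thesis .
qed

lemma gauss_moment:
  "(\<integral>(x, y). of_real (\<phi> x * \<phi> y) * (Complex x y ^ a * cnj (Complex x y) ^ b)
     \<partial>(lborel \<Otimes>\<^sub>M lborel)) = (if a = b then fact a * of_real ((2 * \<sigma>\<^sup>2) ^ a) else 0)"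
proof (induction a arbitrary: b)
  case 0
  show ?case
  proof (cases b)
    case 0
    have "(\<integral>(x, y). \<phi> x * \<phi> y \<partial>(lborel \<Otimes>\<^sub>M lborel)) = (\<integral>x. \<integral>y. \<phi> x * \<phi> y \<partial>lborel \<partial>lborel)"
      using lborel_pair.integral_fst' [OF integrable_lborel_pair_mult [OF integrable_normal_power integrable_normal_power, of 0 0]]
      by simp
    also have "\<dots> = 1" using \<sigma> by simp
    finally have "complex_of_real (\<integral>(x, y). \<phi> x * \<phi> y \<partial>(lborel \<Otimes>\<^sub>M lborel)) = 1" by simp
    then show ?thesis
      unfolding integral_complex_of_real [symmetric] using 0 by (simp add: case_prod_unfold)
  next
    case (Suc c)
    let ?f = "\<lambda>a b. \<lambda>(x, y). of_real (\<phi> x * \<phi> y) * (Complex x y ^ a * cnj (Complex x y) ^ b)"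
    \<comment> \<open>The recursion needs a positive first exponent; conjugation exchanges the
      two.\<close>
    have "?f 0 b = (\<lambda>z. cnj (?f b 0 z))" by (auto simp: fun_eq_iff)
    then have "(\<integral>z. ?f 0 b z \<partial>(lborel \<Otimes>\<^sub>M lborel)) = cnj (\<integral>z. ?f b 0 z \<partial>(lborel \<Otimes>\<^sub>M lborel))"
      by (simp only: Bochner_Integration.integral_cnj)
    also have "\<dots> = 0" unfolding Suc gauss_moment_Suc by simp
    finally show ?thesis using Suc by simp
  qed
next
  case (Suc a)
  show ?case
    unfolding gauss_moment_Suc Suc.IH by (cases b) (auto simp: algebra_simps)
qed

end

section \<open>Skew-orthogonal polynomials\<close>

lemma dA_eq_density: "dA = density lborel (\<lambda>_. ennreal (1 / pi))"
  unfolding dA_def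
  by (rule measure_eqI) (auto simp: emeasure_density_const)

lemma sigma_finite_dA: "sigma_finite_measure dA"
  unfolding dA_eq_density
  by (subst sigma_finite_measure.sigma_finite_iff_density_finite) (auto intro: lborel.sigma_finite_measure_axioms)

lemma sets_dA [measurable_cong, simp]: "sets dA = sets borel"
  by (simp add: dA_def)

lemma integrable_dA:
  fixes f :: "complex \<Rightarrow> complex"
  assumes "integrable lborel f"
  shows "integrable dA f"
  unfolding dA_eq_density using assms by (subst integrable_density) auto

lemma integral_dA:
  fixes f :: "complex \<Rightarrow> complex"
  assumes [measurable]: "f \<in> borel_measurable borel"
  shows "integral\<^sup>L dA f = of_real (1 / pi) * integral\<^sup>L lborel f"
  unfolding dA_eq_density by (subst integral_density) (auto simp: scaleR_conv_of_real)

text \<open>With \<open>\<sigma>\<^sup>2 = 1 / (2 * c)\<close> the planar weight is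
  \<open>pi / c\<close> times a product of two normal densities, and the \<open>1 / pi\<close> of
  \<open>dA\<close> cancels the \<open>pi\<close>.\<close>

lemma
  assumes c: "c > 0"
  shows integrable_gauss_dA:
      "integrable dA (\<lambda>\<zeta>. \<zeta> ^ a * cnj \<zeta> ^ b * of_real (exp (- (c * (cmod \<zeta>)\<^sup>2))))" (is "integrable _ ?f")
    and gauss_moment_dA:
      "(\<integral>\<zeta>. \<zeta> ^ a * cnj \<zeta> ^ b * of_real (exp (- (c * (cmod \<zeta>)\<^sup>2))) \<partial>dA) =
        (if a = b then fact a / of_real c ^ (a + 1) else 0)"
proof -
  define \<sigma> where "\<sigma> = sqrt (1 / (2 * c))"
  have \<sigma>: "\<sigma> > 0" "\<sigma>\<^sup>2 = 1 / (2 * c)" using c by (simp_all add: \<sigma>_def)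
  let ?\<phi> = "normal_density 0 \<sigma>"
  let ?g = "\<lambda>(x, y). complex_of_real (?\<phi> x * ?\<phi> y) * (Complex x y ^ a * cnj (Complex x y) ^ b)"
  have "sqrt (pi / c) * sqrt (pi / c) = pi / c" using c by simp
  then have dens: "?\<phi> x * ?\<phi> y = c / pi * exp (- (c * (x\<^sup>2 + y\<^sup>2)))" for x y
    unfolding normal_density_def \<sigma>(2) using c by (simp add: field_simps mult_exp_exp)
  have [measurable]: "?f \<in> borel_measurable borel"
    by (intro borel_measurable_continuous_onI continuous_intros)
  have meas: "(\<lambda>(x, y). Complex x y) \<in> borel_measurable (lborel \<Otimes>\<^sub>M lborel)"
    by (simp add: Complex_eq case_prod_unfold)
  have f: "(\<lambda>z. ?f (case z of (x, y) \<Rightarrow> Complex x y)) = (\<lambda>z. of_real (pi / c) * ?g z)"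
    using c by (auto simp: fun_eq_iff dens cmod_power2)
  have "integrable (lborel \<Otimes>\<^sub>M lborel) (\<lambda>z. ?f (case z of (x, y) \<Rightarrow> Complex x y))"
    unfolding f by (rule integrable_mult_right) (rule integrable_complex_gauss [OF \<sigma>(1)])
  then have "integrable lborel ?f"
    by (subst lborel_complex, subst integrable_distr_eq [OF meas]) simp_all
  then show "integrable dA ?f" by (rule integrable_dA)
  have "integral\<^sup>L dA ?f = of_real (1 / pi) * integral\<^sup>L lborel ?f" by (rule integral_dA) simp
  also have "integral\<^sup>L lborel ?f = (\<integral>z. ?f (case z of (x, y) \<Rightarrow> Complex x y) \<partial>(lborel \<Otimes>\<^sub>M lborel))"
    by (subst lborel_complex, subst integral_distr [OF meas]) simp_all
  also have "\<dots> = of_real (pi / c) * (if a = b then fact a * of_real ((2 * \<sigma>\<^sup>2) ^ a) else 0)"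
    unfolding f integral_mult_right_zero gauss_moment [OF \<sigma>(1)] ..
  also have "of_real (1 / pi) * \<dots> = (if a = b then fact a / of_real c ^ (a + 1) else 0)"
    using c by (simp add: \<sigma>(2) power_divide field_simps)
  finally show "integral\<^sup>L dA ?f = (if a = b then fact a / of_real c ^ (a + 1) else 0)" .
qed


text \<open>Monic and of definite parity. The coefficients of the even ones solve the two-term
  recursion \<open>coeff (2 * j) = 2 / c * (j + 1) * coeff (2 * j + 2)\<close>, which makes the
  polynomial of degree \<open>2 * n\<close> skew-orthogonal to every odd monomial except its partner
  of degree \<open>2 * n + 1\<close>.\<close>

definition skew_poly :: "real \<Rightarrow> nat \<Rightarrow> complex poly" where
  "skew_poly c i = (if odd i then monom 1 i
     else (\<Sum>l\<le>i div 2. monom (of_real ((2 / c) ^ (i div 2 - l) * fact (i div 2) / fact l)) (2 * l)))"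

lemma skew_poly_odd [simp]: "skew_poly c (Suc (2 * n)) = monom 1 (Suc (2 * n))"
  by (simp add: skew_poly_def)

lemma coeff_skew_poly_even:
  "coeff (skew_poly c (2 * n)) i =
    (if even i \<and> i div 2 \<le> n then of_real ((2 / c) ^ (n - i div 2) * fact n / fact (i div 2)) else 0)"
proof (cases "even i")
  case True
  then obtain m where "i = 2 * m" by (auto elim: evenE)
  then show ?thesis by (simp add: skew_poly_def coeff_sum)
next
  case False
  then have "2 * l \<noteq> i" for l by auto
  then show ?thesis using False by (simp add: skew_poly_def coeff_sum)
qed

lemma degree_skew_poly: "degree (skew_poly c i) = i"
  and lead_coeff_skew_poly: "lead_coeff (skew_poly c i) = 1"
proof -
  have "degree (skew_poly c i) = i \<and> coeff (skew_poly c i) i = 1"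
  proof (cases "even i")
    case True
    then obtain n where n: "i = 2 * n" by (auto elim: evenE)
    have "degree (skew_poly c i) = i"
      unfolding n by (rule antisym [OF degree_le le_degree]) (auto simp: coeff_skew_poly_even)
    then show ?thesis by (simp add: n coeff_skew_poly_even)
  next
    case False
    then show ?thesis by (simp add: skew_poly_def degree_monom_eq)
  qed
  then show "degree (skew_poly c i) = i" "lead_coeff (skew_poly c i) = 1" by auto
qed

lemma
  assumes c: "c > 0"
  shows integrable_poly_gauss_dA:
      "integrable dA (\<lambda>\<zeta>. poly p \<zeta> * poly q (cnj \<zeta>) * of_real (exp (- (c * (cmod \<zeta>)\<^sup>2))))"
    and poly_gauss_moment_dA:
      "(\<integral>\<zeta>. poly p \<zeta> * poly q (cnj \<zeta>) * of_real (exp (- (c * (cmod \<zeta>)\<^sup>2))) \<partial>dA) =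
        (\<Sum>i\<le>degree p. coeff p i * coeff q i * (fact i / of_real c ^ (i + 1)))"
proof -
  let ?m = "\<lambda>i j \<zeta>. \<zeta> ^ i * cnj \<zeta> ^ j * of_real (exp (- (c * (cmod \<zeta>)\<^sup>2)))"
  have eq: "poly p \<zeta> * poly q (cnj \<zeta>) * of_real (exp (- (c * (cmod \<zeta>)\<^sup>2))) =
      (\<Sum>i\<le>degree p. \<Sum>j\<le>degree q. coeff p i * coeff q j * ?m i j \<zeta>)" for \<zeta>
    unfolding poly_altdef by (subst sum_product, simp only: sum_distrib_right, simp only: mult_ac)
  show "integrable dA (\<lambda>\<zeta>. poly p \<zeta> * poly q (cnj \<zeta>) * of_real (exp (- (c * (cmod \<zeta>)\<^sup>2))))"
    unfolding eq by (intro Bochner_Integration.integrable_sum integrable_mult_right integrable_gauss_dA c)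
  have "(\<integral>\<zeta>. poly p \<zeta> * poly q (cnj \<zeta>) * of_real (exp (- (c * (cmod \<zeta>)\<^sup>2))) \<partial>dA) =
      (\<Sum>i\<le>degree p. \<Sum>j\<le>degree q. coeff p i * coeff q j * (\<integral>\<zeta>. ?m i j \<zeta> \<partial>dA))"
    unfolding eq
    by (subst Bochner_Integration.integral_sum
        | intro sum.cong refl Bochner_Integration.integrable_sum integrable_mult_right integrable_gauss_dA c
        | rule integral_mult_right_zero)+
  also have "\<dots> = (\<Sum>i\<le>degree p. coeff p i * coeff q i * (fact i / of_real c ^ (i + 1)))"
  proof (rule sum.cong [OF refl])
    fix i
    have "(\<Sum>j\<le>degree q. coeff p i * coeff q j * (\<integral>\<zeta>. ?m i j \<zeta> \<partial>dA)) =
        (\<Sum>j\<le>degree q. if j = i then coeff p i * coeff q i * (fact i / of_real c ^ (i + 1)) else 0)"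
      unfolding gauss_moment_dA [OF c] by (rule sum.cong) auto
    also have "\<dots> = coeff p i * coeff q i * (fact i / of_real c ^ (i + 1))"
      by (auto simp: coeff_eq_0)
    finally show "(\<Sum>j\<le>degree q. coeff p i * coeff q j * (\<integral>\<zeta>. ?m i j \<zeta> \<partial>dA)) =
        coeff p i * coeff q i * (fact i / of_real c ^ (i + 1))" .
  qed
  finally show "(\<integral>\<zeta>. poly p \<zeta> * poly q (cnj \<zeta>) * of_real (exp (- (c * (cmod \<zeta>)\<^sup>2))) \<partial>dA) =
        (\<Sum>i\<le>degree p. coeff p i * coeff q i * (fact i / of_real c ^ (i + 1)))" .
qed

text \<open>The factor \<open>\<zeta> - cnj \<zeta>\<close> raises the degree of either
  \<open>p\<close> or \<open>q\<close> by one, and distinct monomials are orthogonal for the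
  Gaussian. Hence only neighbouring coefficients of the two polynomials pair.\<close>

lemma
  fixes c :: real and p q :: "complex poly"
  assumes c: "c > 0"
  defines "w \<equiv> \<lambda>\<zeta>. (\<zeta> - cnj \<zeta>) * complex_of_real (exp (- (c * (cmod \<zeta>)\<^sup>2)))"
  shows integrable_skew_moment: "integrable dA (\<lambda>\<zeta>. poly p \<zeta> * poly q (cnj \<zeta>) * w \<zeta>)"
    and skew_moment: "(\<integral>\<zeta>. poly p \<zeta> * poly q (cnj \<zeta>) * w \<zeta> \<partial>dA) =
      (\<Sum>i\<le>degree p. coeff p i * (coeff q (Suc i) * (fact (Suc i) / of_real c ^ (i + 2)))) -
      (\<Sum>i\<le>degree q. coeff q i * (coeff p (Suc i) * (fact (Suc i) / of_real c ^ (i + 2))))"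
proof -
  let ?e = "\<lambda>\<zeta>. complex_of_real (exp (- (c * (cmod \<zeta>)\<^sup>2)))"
  have eq: "poly p \<zeta> * poly q (cnj \<zeta>) * w \<zeta> =
      poly (pCons 0 p) \<zeta> * poly q (cnj \<zeta>) * ?e \<zeta> - poly p \<zeta> * poly (pCons 0 q) (cnj \<zeta>) * ?e \<zeta>" for \<zeta>
    unfolding w_def by (simp add: algebra_simps)
  show "integrable dA (\<lambda>\<zeta>. poly p \<zeta> * poly q (cnj \<zeta>) * w \<zeta>)"
    unfolding eq by (intro Bochner_Integration.integrable_diff integrable_poly_gauss_dA c)
  have shift: "(\<Sum>i\<le>degree (pCons 0 r). coeff (pCons 0 r) i * g i) =
      (\<Sum>i\<le>degree r. coeff r i * g (Suc i))" for r :: "complex poly" and g :: "nat \<Rightarrow> complex"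
  proof (cases "r = 0")
    case False
    then have "degree (pCons 0 r) = Suc (degree r)" by simp
    then show ?thesis by (simp only: sum.atMost_Suc_shift coeff_pCons_Suc) simp
  qed simp
  have sym: "(\<Sum>i\<le>degree p. coeff p i * coeff r i * g i) = (\<Sum>i\<le>degree r. coeff r i * (coeff p i * g i))"
    for r :: "complex poly" and g :: "nat \<Rightarrow> complex"
  proof -
    have "(\<Sum>i\<le>degree p. coeff p i * coeff r i * g i) = (\<Sum>i\<le>max (degree p) (degree r). coeff p i * coeff r i * g i)"
      by (rule sum.mono_neutral_left) (auto simp: coeff_eq_0)
    also have "\<dots> = (\<Sum>i\<le>degree r. coeff p i * coeff r i * g i)"
      by (rule sum.mono_neutral_right) (auto simp: coeff_eq_0)
    finally show ?thesis by (simp only: mult_ac)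
  qed
  show "(\<integral>\<zeta>. poly p \<zeta> * poly q (cnj \<zeta>) * w \<zeta> \<partial>dA) =
      (\<Sum>i\<le>degree p. coeff p i * (coeff q (Suc i) * (fact (Suc i) / of_real c ^ (i + 2)))) -
      (\<Sum>i\<le>degree q. coeff q i * (coeff p (Suc i) * (fact (Suc i) / of_real c ^ (i + 2))))"
    unfolding eq
    by (subst Bochner_Integration.integral_diff [OF integrable_poly_gauss_dA integrable_poly_gauss_dA])
      (simp_all only: c poly_gauss_moment_dA [OF c] sym, simp_all only: shift mult.assoc, simp)
qed

text \<open>Polynomials of equal parity have no neighbouring coefficients. Against an odd monomial
  only two coefficients of the even polynomial count, those of the degrees just below and just
  above, and for \<open>j < n\<close> their contributions cancel.\<close>

lemma skew_moment_skew_poly: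
  fixes c :: real
  assumes c: "c > 0"
  defines "s \<equiv> \<lambda>n. fact (2 * n + 1) / of_real c ^ (2 * n + 2)"
  shows "(\<integral>\<zeta>. poly (skew_poly c a) \<zeta> * poly (skew_poly c b) (cnj \<zeta>) *
        ((\<zeta> - cnj \<zeta>) * complex_of_real (exp (- (c * (cmod \<zeta>)\<^sup>2)))) \<partial>dA) =
      (if even a \<and> b = a + 1 then s (a div 2) else 0) - (if even b \<and> a = b + 1 then s (b div 2) else 0)"
    (is "?I a b = _")
proof -
  define D where "D p q = (\<Sum>i\<le>degree p. coeff p i * (coeff q (Suc i) * (fact (Suc i) / complex_of_real c ^ (i + 2))))"
    for p q
  have I: "?I a b = D (skew_poly c a) (skew_poly c b) - D (skew_poly c b) (skew_poly c a)" for a b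
    unfolding skew_moment [OF c] D_def ..
  have parity: "coeff (skew_poly c i) j = 0" if "even i \<noteq> even j" for i j
  proof (cases "even i")
    case True
    then obtain n where "i = 2 * n" by (auto elim: evenE)
    then show ?thesis using that by (simp add: coeff_skew_poly_even)
  qed (use that in \<open>auto simp: skew_poly_def\<close>)
  have same: "D (skew_poly c i) (skew_poly c j) = 0" if "even i = even j" for i j
  proof -
    have "coeff (skew_poly c i) l = 0 \<or> coeff (skew_poly c j) (Suc l) = 0" for l
      using parity [of i l] parity [of j "Suc l"] that by auto
    then show ?thesis unfolding D_def by (intro sum.neutral) auto
  qed
  have ev: "D (skew_poly c (2 * n)) (skew_poly c (2 * j + 1)) - D (skew_poly c (2 * j + 1)) (skew_poly c (2 * n)) =
      (if j = n then s n else 0)" for n j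
  proof -
    have D1: "D (skew_poly c (2 * n)) (skew_poly c (2 * j + 1)) = coeff (skew_poly c (2 * n)) (2 * j) * s j"
    proof -
      have "D (skew_poly c (2 * n)) (skew_poly c (2 * j + 1)) =
          (\<Sum>i\<le>2 * n. if i = 2 * j then coeff (skew_poly c (2 * n)) (2 * j) * s j else 0)"
        unfolding D_def degree_skew_poly by (rule sum.cong) (auto simp: s_def)
      then show ?thesis by (simp add: coeff_skew_poly_even)
    qed
    have D2: "D (skew_poly c (2 * j + 1)) (skew_poly c (2 * n)) =
        coeff (skew_poly c (2 * n)) (2 * (j + 1)) * (fact (2 * j + 2) / of_real c ^ (2 * j + 3))"
    proof -
      have "D (skew_poly c (2 * j + 1)) (skew_poly c (2 * n)) = (\<Sum>i\<le>2 * j + 1. if i = 2 * j + 1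
          then coeff (skew_poly c (2 * n)) (2 * (j + 1)) * (fact (2 * j + 2) / of_real c ^ (2 * j + 3)) else 0)"
        unfolding D_def degree_skew_poly
      proof (rule sum.cong [OF refl])
        fix i
        have "coeff (skew_poly c (2 * j + 1)) i = (if i = 2 * j + 1 then 1 else 0)" by auto
        moreover have "Suc (2 * j + 1) = 2 * (j + 1)" "2 * j + 1 + 2 = 2 * j + 3" by simp_all
        ultimately show "coeff (skew_poly c (2 * j + 1)) i * (coeff (skew_poly c (2 * n)) (Suc i) *
            (fact (Suc i) / complex_of_real c ^ (i + 2))) = (if i = 2 * j + 1
          then coeff (skew_poly c (2 * n)) (2 * (j + 1)) * (fact (2 * j + 2) / of_real c ^ (2 * j + 3)) else 0)"
          by (cases "i = 2 * j + 1") (simp_all only: if_True if_False mult_1_left mult_zero_left,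
              simp_all add: mult_ac)
      qed
      then show ?thesis by simp
    qed
    \<comment> \<open>The recursion behind the even polynomials: from \<open>s j\<close> to the next
      Gaussian moment the factor is \<open>2 * (j + 1) / c\<close>.\<close>
    have cancel: "of_real ((2 / c) ^ (n - j) * fact n / fact j) * s j =
        of_real ((2 / c) ^ (n - (j + 1)) * fact n / fact (j + 1)) *
          (fact (2 * j + 2) / of_real c ^ (2 * j + 3))"
      if "j < n"
    proof -
      define P F J A C m where "P = complex_of_real ((2 / c) ^ (n - (j + 1)))" and "F = (fact n :: complex)"
        and "J = (fact j :: complex)" and "A = (fact (2 * j + 1) :: complex)"
        and "C = complex_of_real c ^ (2 * j + 2)" and "m = complex_of_nat (Suc j)"
      note defs = this
      have nz: "J \<noteq> 0" "C \<noteq> 0" "m \<noteq> 0" "complex_of_real c \<noteq> 0"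
        using c unfolding defs by (simp_all del: of_nat_Suc)
      have "n - j = Suc (n - (j + 1))" using that by simp
      then have pw: "(2 / c) ^ (n - j) = 2 / c * (2 / c) ^ (n - (j + 1))" by (simp only: power_Suc)
      have 1: "complex_of_real ((2 / c) ^ (n - j) * fact n / fact j) = 2 / of_real c * P * F / J"
        unfolding pw defs by (simp only: of_real_mult of_real_divide of_real_fact of_real_numeral)
      have 2: "(fact (2 * j + 2) :: complex) = 2 * m * A"
      proof -
        have "(fact (2 * j + 2) :: complex) = of_nat (2 * Suc j) * A" unfolding A_def by simp
        then show ?thesis by (simp add: m_def)
      qed
      have 3: "complex_of_real c ^ (2 * j + 3) = of_real c * C"
        unfolding defs power_add by (simp add: power3_eq_cube power2_eq_square)
      have 4: "complex_of_real ((2 / c) ^ (n - (j + 1)) * fact n / fact (j + 1)) = P * F / (m * J)"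
        unfolding defs by (simp only: of_real_mult of_real_divide of_real_fact Suc_eq_plus1 [symmetric] fact_Suc
            of_real_of_nat_eq)
      have 5: "s j = A / C" by (simp add: s_def defs)
      show ?thesis
        unfolding 1 2 3 4 5 using nz by (simp add: divide_simps)
    qed
    consider "n < j" | "j = n" | "j < n" by linarith
    then show ?thesis
    proof cases
      case 1
      then show ?thesis unfolding D1 D2 coeff_skew_poly_even by simp
    next
      case 2
      then show ?thesis unfolding D1 D2 coeff_skew_poly_even by simp
    next
      case 3
      then show ?thesis using cancel unfolding D1 D2 coeff_skew_poly_even by simp
    qed
  qed
  show ?thesis
  proof (cases "even a = even b")
    case True
    then have "\<not> (even a \<and> b = a + 1)" "\<not> (even b \<and> a = b + 1)" by auto
    then show ?thesis
      unfolding I same [OF True] same [OF True [symmetric]] by (simp only: if_False)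
  next
    case False
    show ?thesis
    proof (cases "even a")
      case True
      then obtain n j where ab: "a = 2 * n" "b = 2 * j + 1" using False by (meson evenE oddE)
      have "(b = a + 1) = (j = n)" "\<not> even b" "a div 2 = n" "even a" unfolding ab by auto
      then show ?thesis unfolding I ev [of n j, folded ab] by (simp only: if_False simp_thms diff_0_right)
    next
      case odd: False
      then obtain n j where ab: "b = 2 * n" "a = 2 * j + 1" using False by (meson evenE oddE)
      have "(a = b + 1) = (j = n)" "\<not> even a" "b div 2 = n" "even b" unfolding ab by auto
      then show ?thesis
        unfolding I using ev [of n j, folded ab] minus_diff_eq [of "D (skew_poly c b) (skew_poly c a)", symmetric]
        by (simp only: if_False simp_thms diff_0)
    qed
  qed
qed

section \<open>Finite correlation functions as Pfaffians\<close>

text \<open>The skew pairing of the partners of degrees \<open>2 * n\<close> and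
  \<open>2 * n + 1\<close> at the weight constant \<open>c = N\<close>.\<close>

definition norming :: "nat \<Rightarrow> nat \<Rightarrow> complex" where
  "norming N n = fact (2 * n + 1) / of_nat N ^ (2 * n + 2)"

text \<open>The sign is opposite to the usual one; it is absorbed by the factors \<open>\<zeta> - cnj \<zeta>\<close>, which
  the limit has as \<open>cnj z - z\<close>.\<close>

definition prekernel :: "nat \<Rightarrow> complex \<Rightarrow> complex \<Rightarrow> complex" where
  "prekernel N x y = (\<Sum>n<N. 1 / (2 * norming N n) *
     (poly (skew_poly (real N) (2 * n)) x * poly (skew_poly (real N) (2 * n + 1)) y -
      poly (skew_poly (real N) (2 * n + 1)) x * poly (skew_poly (real N) (2 * n)) y))"

lemma norming_nonzero: "N > 0 \<Longrightarrow> norming N n \<noteq> 0"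
  unfolding norming_def using fact_nonzero [of "2 * n + 1", where 'a = complex] by (simp del: fact_Suc)

text \<open>\<open>X\<close> is left open so that the statement serves twice: with no fixed particle
  it gives the partition function, with the merged configuration the correlation function. Each term
  of the expanded determinant is a product over the particles, so its integral is a product of skew
  pairings.\<close>

lemma integrated_boltzmann_factor:
  assumes N: "N > 0" and kN: "k \<le> N"
    and X1: "\<And>\<omega> j. j < k \<Longrightarrow> X \<omega> j = \<zeta> j"
    and X2: "\<And>\<omega> j. k \<le> j \<Longrightarrow> j < N \<Longrightarrow> X \<omega> j = \<omega> j"
  shows "complex_of_real (\<integral>\<omega>. exp_minus (Hamiltonian Ginibre_potential N (X \<omega>)) \<partial>(Pi\<^sub>M {k..<N} (\<lambda>_. dA))) =
    (\<Prod>j<k. (\<zeta> j - cnj (\<zeta> j)) * of_real (exp (- (real N * (cmod (\<zeta> j))\<^sup>2)))) *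
    (2 ^ N * fact (N - k) * (\<Prod>n<N. norming N n) *
      Pf (index_matrix k (\<lambda>a b. prekernel N (conj_pairs \<zeta> a) (conj_pairs \<zeta> b))))"
proof -
  interpret product_sigma_finite "\<lambda>_::nat. dA"
    by (rule product_sigma_finite.intro) (rule sigma_finite_dA)
  define q where "q = skew_poly (real N)"
  define w where "w z = (z - cnj z) * complex_of_real (exp (- (real N * (cmod z)\<^sup>2)))" for z
  define c where "c a b = (\<integral>z. poly (q a) z * poly (q b) (cnj z) * w z \<partial>dA)" for a b
  define F where "F \<sigma> j z = poly (q (\<sigma> (2 * j))) z * poly (q (\<sigma> (2 * j + 1))) (cnj z) * w z"
    for \<sigma> :: "nat \<Rightarrow> nat" and j z
  let ?S = "{\<sigma>. \<sigma> permutes {..<2 * N}}"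
  have Npos: "real N > 0" using N by simp
  note split = prod_split_lessThan [OF kN]
  have expand: "complex_of_real (exp_minus (Hamiltonian Ginibre_potential N (X \<omega>))) =
      (\<Sum>\<sigma>\<in>?S. (of_int (sign \<sigma>) * (\<Prod>j<k. F \<sigma> j (\<zeta> j))) * (\<Prod>j\<in>{k..<N}. F \<sigma> j (\<omega> j)))" for \<omega>
  proof -
    have "complex_of_real (exp_minus (Hamiltonian Ginibre_potential N (X \<omega>))) =
        (\<Sum>\<sigma>\<in>?S. of_int (sign \<sigma>) * (\<Prod>a<2 * N. poly (q (\<sigma> a)) (conj_pairs (X \<omega>) a))) *
        (\<Prod>j<N. w (X \<omega> j))"
      unfolding boltzmann_factor w_def Ginibre_potential_def q_def
      by (subst alternant_eq_vandermonde [where q = "skew_poly (real N)",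
            OF degree_skew_poly lead_coeff_skew_poly]) (rule refl)
    also have "\<dots> = (\<Sum>\<sigma>\<in>?S. of_int (sign \<sigma>) * (\<Prod>j<N. F \<sigma> j (X \<omega> j)))"
      unfolding sum_distrib_right F_def prod_double
      by (simp only: prod.distrib conj_pairs_simps Suc_eq_plus1 [symmetric], simp only: mult_ac)
    also have "\<dots> = (\<Sum>\<sigma>\<in>?S. of_int (sign \<sigma>) * ((\<Prod>j<k. F \<sigma> j (\<zeta> j)) * (\<Prod>j\<in>{k..<N}. F \<sigma> j (\<omega> j))))"
      unfolding split by (simp add: X1 X2)
    finally show ?thesis by (simp only: mult.assoc)
  qed
  have int_F: "integrable dA (F \<sigma> j)" for \<sigma> j
    unfolding F_def w_def by (rule integrable_skew_moment [OF Npos])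
  have "complex_of_real (\<integral>\<omega>. exp_minus (Hamiltonian Ginibre_potential N (X \<omega>)) \<partial>(Pi\<^sub>M {k..<N} (\<lambda>_. dA))) =
      (\<Sum>\<sigma>\<in>?S. (of_int (sign \<sigma>) * (\<Prod>j<k. F \<sigma> j (\<zeta> j))) * (\<Prod>j\<in>{k..<N}. c (\<sigma> (2 * j)) (\<sigma> (2 * j + 1))))"
  proof -
    have int: "integrable (Pi\<^sub>M {k..<N} (\<lambda>_. dA)) (\<lambda>\<omega>. \<Prod>j\<in>{k..<N}. F \<sigma> j (\<omega> j))" for \<sigma>
      by (rule product_integrable_prod) (simp_all add: int_F)
    have "(\<integral>\<omega>. (\<Prod>j\<in>{k..<N}. F \<sigma> j (\<omega> j)) \<partial>(Pi\<^sub>M {k..<N} (\<lambda>_. dA))) =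
        (\<Prod>j\<in>{k..<N}. c (\<sigma> (2 * j)) (\<sigma> (2 * j + 1)))" for \<sigma>
      by (subst product_integral_prod) (simp_all add: int_F, simp add: F_def [abs_def] c_def)
    then show ?thesis
      unfolding integral_complex_of_real [symmetric] expand
      using int by (subst Bochner_Integration.integral_sum) simp_all
  qed
  also have "\<dots> = (\<Prod>j<k. w (\<zeta> j)) * (\<Sum>\<sigma>\<in>?S. of_int (sign \<sigma>) *
      ((\<Prod>j<k. poly (q (\<sigma> (2 * j))) (conj_pairs \<zeta> (2 * j)) * poly (q (\<sigma> (2 * j + 1))) (conj_pairs \<zeta> (2 * j + 1))) *
       (\<Prod>j\<in>{k..<N}. c (\<sigma> (2 * j)) (\<sigma> (2 * j + 1)))))"
    unfolding sum_distrib_left F_def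
    by (simp only: prod.distrib conj_pairs_simps Suc_eq_plus1 [symmetric], simp only: mult_ac)
  also have "(\<Sum>\<sigma>\<in>?S. of_int (sign \<sigma>) *
      ((\<Prod>j<k. poly (q (\<sigma> (2 * j))) (conj_pairs \<zeta> (2 * j)) * poly (q (\<sigma> (2 * j + 1))) (conj_pairs \<zeta> (2 * j + 1))) *
       (\<Prod>j\<in>{k..<N}. c (\<sigma> (2 * j)) (\<sigma> (2 * j + 1))))) =
    2 ^ N * fact (N - k) * (\<Prod>n<N. norming N n) *
      Pf (index_matrix k (\<lambda>a b. prekernel N (conj_pairs \<zeta> a) (conj_pairs \<zeta> b)))"
    unfolding prekernel_def q_def [symmetric]
  proof (rule integrate_out_pairs [OF kN, where q = "\<lambda>i a. poly (q i) (conj_pairs \<zeta> a)"])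
    show "norming N n \<noteq> 0" for n using N by (rule norming_nonzero)
    show "c a b = (if even a \<and> b = a + 1 then norming N (a div 2) else 0) -
        (if even b \<and> a = b + 1 then norming N (b div 2) else 0)" for a b
      using skew_moment_skew_poly [OF Npos, of a b] unfolding c_def q_def w_def norming_def by simp
  qed
  finally show ?thesis unfolding w_def .
qed

text \<open>The power of 2 and the skew norms agree in both integrals, and the factorials cancel
  against \<open>fact N / fact (N - k)\<close>, so no constant is left.\<close>

theorem correlation_Ginibre_eq_Pf:
  assumes N: "N > 0" and kN: "k \<le> N"
  shows "complex_of_real (correlation Ginibre_potential N k \<zeta>) =
    (\<Prod>j<k. (\<zeta> j - cnj (\<zeta> j)) * of_real (exp (- (real N * (cmod (\<zeta> j))\<^sup>2)))) *
      Pf (index_matrix k (\<lambda>a b. prekernel N (conj_pairs \<zeta> a) (conj_pairs \<zeta> b)))"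
proof -
  let ?P = "\<Prod>n<N. norming N n"
  have "Pf (Matrix.mat 0 0 f) = 1" for f
    by (simp add: Pf_def sign_id [unfolded id_def])
  then have Z: "complex_of_real (partition_function Ginibre_potential N) = 2 ^ N * fact N * ?P"
    unfolding partition_function_def lessThan_atLeast0
    by (subst integrated_boltzmann_factor [OF N le0]) (simp_all add: lessThan_atLeast0)
  have I: "complex_of_real (\<integral>\<omega>. exp_minus (Hamiltonian Ginibre_potential N (merge {..<k} {k..<N} (\<zeta>, \<omega>)))
        \<partial>(Pi\<^sub>M {k..<N} (\<lambda>_. dA))) =
    (\<Prod>j<k. (\<zeta> j - cnj (\<zeta> j)) * of_real (exp (- (real N * (cmod (\<zeta> j))\<^sup>2)))) *
    (2 ^ N * fact (N - k) * ?P *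
      Pf (index_matrix k (\<lambda>a b. prekernel N (conj_pairs \<zeta> a) (conj_pairs \<zeta> b))))"
    by (rule integrated_boltzmann_factor [OF N kN]) (simp_all add: merge_def)
  have "?P \<noteq> 0" using norming_nonzero [OF N] by simp
  then show ?thesis
    unfolding correlation_def of_real_mult I of_real_divide Z by (simp add: field_simps)
qed

section \<open>The complementary error function\<close>

text \<open>A multiple of \<open>erfc\<close>, written as a real integral along the horizontal ray
  from \<open>c\<close>. This form gives the bounds and is what Laplace's method produces.\<close>

definition gauss_tail :: "complex \<Rightarrow> complex" where
  "gauss_tail c = (\<integral>s. indicator {0..} s *\<^sub>R exp (- (c + complex_of_real s)\<^sup>2) \<partial>lborel)"

lemma norm_exp_minus_square: "norm (exp (- z\<^sup>2)) = exp ((Im z)\<^sup>2 - (Re z)\<^sup>2)" for z :: complex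
  by (simp add: norm_exp_eq_Re power2_eq_square)

lemma integrable_exp_minus_square: "integrable lborel (\<lambda>x::real. exp (- x\<^sup>2))"
  and integral_exp_minus_square: "(\<integral>x. exp (- (x::real)\<^sup>2) \<partial>lborel) = sqrt pi"
  using has_bochner_integral_even_function [OF gaussian_moment_0]
  by (simp_all add: has_bochner_integral_iff)

text \<open>The factor 1 in front of \<open>s\<close> matches the affine substitution rule used on
  this bound.\<close>

lemma norm_gauss_tail_integrand_le:
  "norm (indicator {0..} s *\<^sub>R exp (- (c + complex_of_real s)\<^sup>2)) \<le> exp ((Im c)\<^sup>2) * exp (- (Re c + 1 * s)\<^sup>2)"
  unfolding norm_scaleR norm_exp_minus_square mult_exp_exp by (simp add: indicator_def)

lemma integrable_gauss_tail:
  "integrable lborel (\<lambda>s. indicator {0..} s *\<^sub>R exp (- (c + complex_of_real s)\<^sup>2))"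
proof (rule Bochner_Integration.integrable_bound)
  show "integrable lborel (\<lambda>s. exp ((Im c)\<^sup>2) * exp (- (Re c + 1 * s)\<^sup>2))"
    by (intro integrable_mult_right lborel_integrable_real_affine integrable_exp_minus_square) simp
  show "(\<lambda>s. indicator {0..} s *\<^sub>R exp (- (c + complex_of_real s)\<^sup>2)) \<in> borel_measurable lborel"
    by measurable
  show "AE s in lborel. norm (indicator {0..} s *\<^sub>R exp (- (c + complex_of_real s)\<^sup>2)) \<le>
      norm (exp ((Im c)\<^sup>2) * exp (- (Re c + 1 * s)\<^sup>2))"
    using norm_gauss_tail_integrand_le [of _ c] by (intro AE_I2) simp
qed

lemma norm_gauss_tail_le: "norm (gauss_tail c) \<le> sqrt pi * exp ((Im c)\<^sup>2)"
proof -
  have int: "integrable lborel (\<lambda>s. exp ((Im c)\<^sup>2) * exp (- (Re c + 1 * s)\<^sup>2))"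
    by (intro integrable_mult_right lborel_integrable_real_affine integrable_exp_minus_square) simp
  have "norm (gauss_tail c) \<le> (\<integral>s. exp ((Im c)\<^sup>2) * exp (- (Re c + 1 * s)\<^sup>2) \<partial>lborel)"
    unfolding gauss_tail_def
    by (rule Bochner_Integration.integral_norm_bound_integral [OF integrable_gauss_tail int])
      (rule norm_gauss_tail_integrand_le)
  also have "\<dots> = exp ((Im c)\<^sup>2) * (\<integral>s. exp (- s\<^sup>2) \<partial>lborel)"
    unfolding integral_mult_right_zero
    using lborel_integral_real_affine [of 1 "\<lambda>s. exp (- s\<^sup>2)" "Re c"] by simp
  finally show ?thesis by (simp add: integral_exp_minus_square mult.commute)
qed

lemma norm_gauss_tail_le_right:
  assumes "Re c \<ge> 0"
  shows "norm (gauss_tail c) \<le> sqrt pi * exp ((Im c)\<^sup>2 - (Re c)\<^sup>2)"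
proof -
  have "norm (gauss_tail c) \<le> (\<integral>s. exp ((Im c)\<^sup>2 - (Re c)\<^sup>2) * exp (- s\<^sup>2) \<partial>lborel)"
    unfolding gauss_tail_def
  proof (rule Bochner_Integration.integral_norm_bound_integral [OF integrable_gauss_tail])
    show "integrable lborel (\<lambda>s. exp ((Im c)\<^sup>2 - (Re c)\<^sup>2) * exp (- s\<^sup>2))"
      by (intro integrable_mult_right integrable_exp_minus_square)
    fix s :: real
    show "norm (indicator {0..} s *\<^sub>R exp (- (c + complex_of_real s)\<^sup>2)) \<le>
        exp ((Im c)\<^sup>2 - (Re c)\<^sup>2) * exp (- s\<^sup>2)"
    proof (cases "s \<ge> 0")
      case True
      then have "(Re c + s)\<^sup>2 \<ge> (Re c)\<^sup>2 + s\<^sup>2" using assms by (simp add: power2_sum)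
      then have "exp ((Im c)\<^sup>2 - (Re c + s)\<^sup>2) \<le> exp (((Im c)\<^sup>2 - (Re c)\<^sup>2) + (- s\<^sup>2))" by simp
      then show ?thesis
        using True unfolding exp_add norm_scaleR norm_exp_minus_square by simp
    qed simp
  qed
  then show ?thesis by (simp add: integral_exp_minus_square mult.commute)
qed

lemma erfc_primitive:
  obtains g :: "complex \<Rightarrow> complex" where "\<And>x. (g has_field_derivative exp (- x\<^sup>2)) (at x)"
    and "\<And>z. erfc z = 1 - 2 / of_real (sqrt pi) * (g z - g 0)"
proof -
  have "(\<lambda>x. exp (- x\<^sup>2)) holomorphic_on UNIV" by (intro holomorphic_intros)
  then have "\<exists>g. \<forall>x::complex. (g has_field_derivative exp (- x\<^sup>2)) (at x)"
    by (rule holomorphic_convex_primitive' [OF convex_UNIV open_UNIV]) (intro exI allI, simp)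
  then obtain g where g: "(g has_field_derivative exp (- x\<^sup>2)) (at x)" for x :: complex by blast
  have "erfc z = 1 - 2 / of_real (sqrt pi) * (g z - g 0)" for z
  proof -
    have "((\<lambda>t. exp (- t\<^sup>2)) has_contour_integral g z - g 0) (linepath 0 z)"
      using contour_integral_primitive [of UNIV g "\<lambda>t. exp (- t\<^sup>2)" "linepath 0 z"] g by simp
    then show ?thesis unfolding erfc_def by (simp add: contour_integral_unique)
  qed
  with g show ?thesis by (rule that)
qed

lemma erfc_has_field_derivative [derivative_intros]:
  assumes "(f has_field_derivative f') (at z within S)"
  shows "((\<lambda>z. erfc (f z)) has_field_derivative (- 2 / of_real (sqrt pi) * exp (- (f z)\<^sup>2)) * f') (at z within S)"
proof -
  obtain g where g: "\<And>x. (g has_field_derivative exp (- x\<^sup>2)) (at x)"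
    and erfc: "\<And>z. erfc z = 1 - 2 / of_real (sqrt pi) * (g z - g 0)"
    using erfc_primitive by blast
  have "(erfc has_field_derivative - 2 / of_real (sqrt pi) * exp (- (f z)\<^sup>2)) (at (f z))"
    unfolding erfc [abs_def] by (auto intro!: derivative_eq_intros g)
  from DERIV_chain2 [OF this assms] show ?thesis .
qed

text \<open>For a primitive \<open>g\<close> of \<open>exp (- x\<^sup>2)\<close> the difference
  \<open>g (c + n) - g n\<close> tends to 0, so moving right from \<open>c\<close> and from 0 ends
  at the same value. Hence the tails at \<open>c\<close> and 0 differ by \<open>g 0 - g c\<close>,
  and the tail at 0 is half the Gaussian integral.\<close>

lemma erfc_eq_gauss_tail: "erfc c = 2 / of_real (sqrt pi) * gauss_tail c"
proof -
  obtain g where g: "\<And>x. (g has_field_derivative exp (- x\<^sup>2)) (at x)"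
    and erfc: "\<And>z. erfc z = 1 - 2 / of_real (sqrt pi) * (g z - g 0)"
    using erfc_primitive by blast
  have lim: "(\<lambda>n. g (c + of_nat n) - g (of_nat n)) \<longlonglongrightarrow> 0" for c
  proof (rule Lim_null_comparison)
    show "(\<lambda>n. exp ((cmod c)\<^sup>2 - (real n - cmod c)\<^sup>2) * cmod c) \<longlonglongrightarrow> 0" by real_asymp
    \<comment> \<open>Both points lie in the disc of radius \<open>cmod c\<close> around
      \<open>n\<close>, where the derivative of \<open>g\<close> is tiny.\<close>
    have "cmod (g (c + of_nat n) - g (of_nat n)) \<le> exp ((cmod c)\<^sup>2 - (real n - cmod c)\<^sup>2) * cmod (c + of_nat n - of_nat n)"
      if n: "real n \<ge> cmod c" for n
    proof (rule field_differentiable_bound [of "cball (of_nat n) (cmod c)"])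
      fix \<zeta> :: complex assume "\<zeta> \<in> cball (of_nat n) (cmod c)"
      then have \<zeta>: "cmod (\<zeta> - of_nat n) \<le> cmod c" by (simp add: dist_norm norm_minus_commute)
      have "\<bar>Im \<zeta>\<bar> \<le> cmod c" using abs_Im_le_cmod [of "\<zeta> - of_nat n"] \<zeta> by simp
      then have "(Im \<zeta>)\<^sup>2 \<le> (cmod c)\<^sup>2" using power_mono [of "\<bar>Im \<zeta>\<bar>" "cmod c" 2] by simp
      moreover have "Re \<zeta> \<ge> real n - cmod c" using abs_Re_le_cmod [of "\<zeta> - of_nat n"] \<zeta> by simp
      then have "(Re \<zeta>)\<^sup>2 \<ge> (real n - cmod c)\<^sup>2" using n by (intro power_mono) auto
      ultimately show "cmod (exp (- \<zeta>\<^sup>2)) \<le> exp ((cmod c)\<^sup>2 - (real n - cmod c)\<^sup>2)"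
        unfolding norm_exp_minus_square by simp
      show "(g has_field_derivative exp (- \<zeta>\<^sup>2)) (at \<zeta> within cball (of_nat n) (cmod c))"
        by (rule has_field_derivative_at_within [OF g])
    qed (auto simp: dist_norm)
    moreover have "\<forall>\<^sub>F n in sequentially. cmod c \<le> real n" by real_asymp
    ultimately show "\<forall>\<^sub>F n in sequentially. norm (g (c + of_nat n) - g (of_nat n)) \<le>
        exp ((cmod c)\<^sup>2 - (real n - cmod c)\<^sup>2) * cmod c"
      by (rule_tac eventually_mono [of "\<lambda>n. cmod c \<le> real n"]) simp_all
  qed
  have tail: "(\<lambda>n. g (c + of_nat n) - g c) \<longlonglongrightarrow> gauss_tail c" for c
  proof -
    have "(\<integral>s. indicator {0..real n} s *\<^sub>R exp (- (c + complex_of_real s)\<^sup>2) \<partial>lborel) = g (c + of_nat n) - g c" for n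
    proof -
      have "((\<lambda>s. g (c + of_real s)) has_vector_derivative exp (- (c + of_real s)\<^sup>2)) (at s within {0..real n})" for s
      proof (rule has_vector_derivative_real_field)
        have "((\<lambda>z. c + z) has_field_derivative 1) (at (of_real s))"
          by (auto intro!: derivative_eq_intros)
        from DERIV_chain2 [OF g this]
        show "((\<lambda>z. g (c + z)) has_field_derivative exp (- (c + of_real s)\<^sup>2)) (at (of_real s))" by simp
      qed
      moreover have "continuous_on {0..real n} (\<lambda>s. exp (- (c + complex_of_real s)\<^sup>2))"
        by (intro continuous_intros)
      ultimately show ?thesis
        using integral_FTC_Icc [of 0 "real n" "\<lambda>s. g (c + of_real s)" "\<lambda>s. exp (- (c + of_real s)\<^sup>2)"] by simp
    qed
    moreover have "(\<lambda>n. \<integral>s. indicator {0..real n} s *\<^sub>R exp (- (c + complex_of_real s)\<^sup>2) \<partial>lborel) \<longlonglongrightarrow> gauss_tail c"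
      unfolding gauss_tail_def
    proof (rule integral_dominated_convergence)
      show "integrable lborel (\<lambda>s. norm (indicator {0..} s *\<^sub>R exp (- (c + complex_of_real s)\<^sup>2)))"
        by (intro integrable_norm integrable_gauss_tail)
      show "AE s in lborel. (\<lambda>n. indicator {0..real n} s *\<^sub>R exp (- (c + complex_of_real s)\<^sup>2))
          \<longlonglongrightarrow> indicator {0..} s *\<^sub>R exp (- (c + complex_of_real s)\<^sup>2)"
      proof (intro AE_I2 tendsto_eventually)
        fix s :: real
        have "\<forall>\<^sub>F n in sequentially. s \<le> real n" by real_asymp
        then show "\<forall>\<^sub>F n in sequentially. indicator {0..real n} s *\<^sub>R exp (- (c + complex_of_real s)\<^sup>2) =
            indicator {0..} s *\<^sub>R exp (- (c + complex_of_real s)\<^sup>2)"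
          by eventually_elim (simp add: indicator_def)
      qed
    qed (auto simp: indicator_def intro!: AE_I2)
    ultimately show ?thesis by simp
  qed
  have "gauss_tail 0 = of_real (\<integral>s. indicator {0..} s *\<^sub>R exp (- s\<^sup>2) \<partial>lborel)"
    unfolding gauss_tail_def integral_complex_of_real [symmetric]
    by (intro arg_cong [where f = "integral\<^sup>L lborel"]) (auto simp: fun_eq_iff indicator_def simp flip: exp_of_real)
  also have "(\<integral>s. indicator {0..} s *\<^sub>R exp (- s\<^sup>2) \<partial>lborel) = sqrt pi / 2"
    using gaussian_moment_0 by (rule has_bochner_integral_integral_eq)
  finally have tail0: "gauss_tail 0 = of_real (sqrt pi) / 2" by simp
  have "(\<lambda>n. (g (c + of_nat n) - g (of_nat n)) + (g (0 + of_nat n) - g 0) + (g 0 - g c)) \<longlonglongrightarrow>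
      0 + gauss_tail 0 + (g 0 - g c)"
    by (intro tendsto_add lim tail tendsto_const)
  then have "(\<lambda>n. g (c + of_nat n) - g c) \<longlonglongrightarrow> gauss_tail 0 + (g 0 - g c)" by simp
  from LIMSEQ_unique [OF tail this] have "gauss_tail c = of_real (sqrt pi) / 2 + (g 0 - g c)"
    unfolding tail0 .
  moreover have "1 - 2 / r * (u - v) = 2 / r * (r / 2 + (v - u))" if "r \<noteq> 0" for r u v :: complex
    using that by (simp add: field_simps)
  moreover have "complex_of_real (sqrt pi) \<noteq> 0" by simp
  ultimately show "erfc c = 2 / of_real (sqrt pi) * gauss_tail c"
    unfolding erfc by metis
qed

lemma norm_erfc_le: "norm (erfc c) \<le> 2 * exp ((Im c)\<^sup>2)"
proof -
  have "norm (erfc c) = 2 / sqrt pi * norm (gauss_tail c)"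
    unfolding erfc_eq_gauss_tail by (simp add: norm_mult norm_divide)
  also have "\<dots> \<le> 2 / sqrt pi * (sqrt pi * exp ((Im c)\<^sup>2))"
    by (intro mult_left_mono norm_gauss_tail_le) simp
  finally show ?thesis by simp
qed

lemma norm_erfc_le_right:
  assumes "Re c \<ge> 0"
  shows "norm (erfc c) \<le> 2 * exp ((Im c)\<^sup>2 - (Re c)\<^sup>2)"
proof -
  have "norm (erfc c) = 2 / sqrt pi * norm (gauss_tail c)"
    unfolding erfc_eq_gauss_tail by (simp add: norm_mult norm_divide)
  also have "\<dots> \<le> 2 / sqrt pi * (sqrt pi * exp ((Im c)\<^sup>2 - (Re c)\<^sup>2))"
    by (intro mult_left_mono norm_gauss_tail_le_right assms) simp
  finally show ?thesis by simp
qed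

section \<open>The Laplace method for truncated exponentials\<close>

text \<open>Taylor's theorem on the disc of radius 1/2: there the third derivative
  \<open>2 / (1 + x) ^ 3\<close> is at most 16, and the remainder has the denominator
  \<open>fact 2\<close>, whence 8.\<close>

lemma norm_Ln_second_order:
  assumes "norm h \<le> 1 / 2"
  shows "norm (Ln (1 + h) - h + h\<^sup>2 / 2) \<le> 8 * norm h ^ 3"
proof -
  define f where "f i x = (if i = 0 then Ln (1 + x) else (- 1) ^ (i - 1) * fact (i - 1) / (1 + x) ^ i)"
    for i and x :: complex
  let ?S = "cball (0::complex) (1 / 2)"
  have x: "Re (1 + x) > 0" "1 + x \<noteq> 0" "norm (1 + x) \<ge> 1 / 2" if "x \<in> ?S" for x
  proof -
    have n: "norm x \<le> 1 / 2" using that by (simp add: dist_norm)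
    then show "Re (1 + x) > 0" using abs_Re_le_cmod [of x] by simp
    then show "1 + x \<noteq> 0" by (metis less_irrefl zero_complex.sel(1))
    show "norm (1 + x) \<ge> 1 / 2" using n norm_triangle_ineq2 [of 1 "- x"] by simp
  qed
  have bound: "norm (f 0 h - (\<Sum>i\<le>2. f i 0 * (h - 0) ^ i / fact i)) \<le> 16 * norm (h - 0) ^ Suc 2 / fact 2"
  proof (rule complex_Taylor [where S = ?S])
    fix i :: nat and x assume ix: "x \<in> ?S" "i \<le> 2"
    have "1 + x \<notin> \<real>\<^sub>\<le>\<^sub>0" using x(1) [OF ix(1)] by (auto simp: complex_nonpos_Reals_iff)
    note nz = x(2) [OF ix(1)] this
    have "(f 0 has_field_derivative f (Suc 0) x) (at x within ?S)"
      using nz by (auto simp: f_def [abs_def] inverse_eq_divide intro!: derivative_eq_intros)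
    moreover have "(f 1 has_field_derivative f (Suc 1) x) (at x within ?S)"
    proof -
      have "((\<lambda>x. 1 / (1 + x)) has_field_derivative (0 * (1 + x) - 1 * 1) / ((1 + x) * (1 + x))) (at x within ?S)"
        by (rule DERIV_divide) (use nz in \<open>auto intro!: derivative_eq_intros\<close>)
      then show ?thesis by (simp add: f_def [abs_def] power2_eq_square)
    qed
    moreover have "(f 2 has_field_derivative f (Suc 2) x) (at x within ?S)"
    proof -
      have "((\<lambda>x. - 1 / (1 + x)\<^sup>2) has_field_derivative
          (0 * (1 + x)\<^sup>2 - (- 1) * (2 * (1 + x))) / ((1 + x)\<^sup>2 * (1 + x)\<^sup>2)) (at x within ?S)"
        by (rule DERIV_divide) (use nz in \<open>auto intro!: derivative_eq_intros\<close>)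
      moreover have "(0 * (1 + x)\<^sup>2 - (- 1) * (2 * (1 + x))) / ((1 + x)\<^sup>2 * (1 + x)\<^sup>2) = f (Suc 2) x"
        using nz by (simp add: f_def divide_simps power2_eq_square power3_eq_cube fact_numeral)
      moreover have "f 2 = (\<lambda>x. - 1 / (1 + x)\<^sup>2)" by (simp add: f_def [abs_def])
      ultimately show ?thesis by simp
    qed
    moreover have "i = 0 \<or> i = 1 \<or> i = 2" using ix by auto
    ultimately show "(f i has_field_derivative f (Suc i) x) (at x within ?S)" by blast
  next
    fix x assume "x \<in> ?S"
    note x = x [OF this]
    have "(1 / 2) ^ 3 \<le> norm (1 + x) ^ 3" using x(3) by (intro power_mono) auto
    then have "2 / norm (1 + x) ^ 3 \<le> 2 / (1 / 2) ^ 3" by (intro divide_left_mono) (use x in auto)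
    then show "norm (f (Suc 2) x) \<le> 16"
      by (simp add: f_def norm_divide norm_power norm_mult power3_eq_cube fact_numeral)
  qed (use assms in \<open>auto simp: dist_norm\<close>)
  have poly: "(\<Sum>i\<le>2. f i 0 * (h - 0) ^ i / fact i) = h - h\<^sup>2 / 2"
    by (simp add: f_def numeral_2_eq_2)
  show ?thesis
    using bound unfolding poly by (simp add: f_def algebra_simps power3_eq_cube)
qed

text \<open>The function \<open>s ^ n * exp (- s)\<close> at \<open>s = n + sqrt (2 n) * y\<close>, divided by its value at the
  maximum \<open>s = n\<close>.\<close>

definition laplace_factor :: "nat \<Rightarrow> complex \<Rightarrow> complex" where
  "laplace_factor n y = ((1 + y * of_real (sqrt (2 / n))) * exp (- y * of_real (sqrt (2 / n)))) ^ n"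

text \<open>With \<open>h = y * sqrt (2 / n)\<close> one has
  \<open>n * h\<^sup>2 = 2 * y\<^sup>2\<close>, so the logarithm of the factor is
  \<open>- y\<^sup>2\<close> up to an error of at most \<open>16 * |y|^2 * |h|\<close>. Degree and
  argument both move with \<open>N\<close>, which later yields uniform convergence.\<close>

lemma tendsto_laplace_factor:
  assumes M: "filterlim M at_top sequentially" and y: "y \<longlonglongrightarrow> c"
  shows "(\<lambda>N. laplace_factor (M N) (y N)) \<longlonglongrightarrow> exp (- c\<^sup>2)"
proof -
  define \<delta> where "\<delta> N = complex_of_real (sqrt (2 / real (M N)))" for N
  have "((\<lambda>n. sqrt (2 / real n)) \<longlongrightarrow> 0) sequentially" by real_asymp
  from filterlim_compose [OF this M] have "(\<lambda>N. sqrt (2 / real (M N))) \<longlonglongrightarrow> 0" .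
  from tendsto_of_real [OF this] have \<delta>: "\<delta> \<longlonglongrightarrow> 0" unfolding \<delta>_def [abs_def] by simp
  define h where "h N = y N * \<delta> N" for N
  have h: "h \<longlonglongrightarrow> 0" using tendsto_mult [OF y \<delta>] unfolding h_def [abs_def] by simp
  define R where "R N = of_nat (M N) * (Ln (1 + h N) - h N + (h N)\<^sup>2 / 2)" for N
  have ev: "\<forall>\<^sub>F N in sequentially. norm (h N) < 1 / 2 \<and> M N \<ge> 1"
    using order_tendstoD(2) [OF tendsto_norm [OF h], of "1 / 2"] filterlim_at_top [THEN iffD1, OF M]
    by (auto intro: eventually_conj)
  have sq: "of_nat (M N) * (h N)\<^sup>2 = 2 * (y N)\<^sup>2" if "M N \<ge> 1" for N
  proof -
    have "(\<delta> N)\<^sup>2 = 2 / of_nat (M N)" unfolding \<delta>_def by (simp flip: of_real_power)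
    then show ?thesis using that by (simp add: h_def power_mult_distrib)
  qed
  have "R \<longlonglongrightarrow> 0"
  proof (rule Lim_null_comparison)
    show "(\<lambda>N. 16 * norm (y N) ^ 2 * norm (h N)) \<longlonglongrightarrow> 0"
      using tendsto_mult [OF tendsto_mult [OF tendsto_const tendsto_power [OF tendsto_norm [OF y]]] tendsto_norm [OF h]]
      by simp
    show "\<forall>\<^sub>F N in sequentially. norm (R N) \<le> 16 * norm (y N) ^ 2 * norm (h N)"
      using ev
    proof eventually_elim
      case (elim N)
      have "norm (R N) \<le> real (M N) * (8 * norm (h N) ^ 3)"
        unfolding R_def norm_mult norm_of_nat
        by (intro mult_left_mono norm_Ln_second_order) (use elim in auto)
      also have "\<dots> = 8 * norm (of_nat (M N) * (h N)\<^sup>2) * norm (h N)"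
        by (simp add: norm_mult norm_power power3_eq_cube power2_eq_square)
      also have "\<dots> = 16 * norm (y N) ^ 2 * norm (h N)"
        using elim by (subst sq) (simp_all add: norm_mult norm_power)
      finally show ?case .
    qed
  qed
  then have "(\<lambda>N. exp (R N - (y N)\<^sup>2)) \<longlonglongrightarrow> exp (0 - c\<^sup>2)"
    by (intro tendsto_intros y)
  moreover have "\<forall>\<^sub>F N in sequentially. exp (R N - (y N)\<^sup>2) = laplace_factor (M N) (y N)"
    using ev
  proof eventually_elim
    case (elim N)
    then have "1 + h N \<noteq> 0" by (metis add_eq_0_iff norm_minus_cancel norm_one less_irrefl one_less_numeral_iff
      order_less_trans semiring_norm(76) divide_less_eq_1_pos zero_less_numeral)
    then have "(1 + h N) * exp (- h N) = exp (Ln (1 + h N) - h N)" by (simp add: exp_diff exp_minus divide_inverse)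
    then have "laplace_factor (M N) (y N) = exp (of_nat (M N) * (Ln (1 + h N) - h N))"
      unfolding laplace_factor_def h_def \<delta>_def by (simp add: exp_of_nat_mult)
    also have "of_nat (M N) * (Ln (1 + h N) - h N) = R N - of_nat (M N) * (h N)\<^sup>2 / 2"
      unfolding R_def by (simp add: algebra_simps)
    also have "\<dots> = R N - (y N)\<^sup>2" using sq elim by simp
    finally show ?case ..
  qed
  ultimately show ?thesis by (auto intro: Lim_transform_eventually)
qed

text \<open>Exponential form of \<open>ln (1 + x) \<le> x - x\<^sup>2 / 2\<close> for
  \<open>x \<le> 0\<close>, obtained from the sign of the derivative.\<close>

lemma one_plus_exp_le_neg:
  assumes "- 1 \<le> x" "x \<le> (0::real)"
  shows "(1 + x) * exp (- x) \<le> exp (- x\<^sup>2 / 2)"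
proof (cases "x = - 1")
  case False
  then have x: "- 1 < x" using assms by simp
  have "0 - 0\<^sup>2 / 2 - ln (1 + 0) \<le> x - x\<^sup>2 / 2 - ln (1 + x)"
  proof (rule DERIV_nonpos_imp_nonincreasing [of x 0 "\<lambda>x. x - x\<^sup>2 / 2 - ln (1 + x)"])
    fix t assume t: "x \<le> t" "t \<le> 0"
    have "((\<lambda>x. x - x\<^sup>2 / 2 - ln (1 + x)) has_real_derivative 1 - t - 1 / (1 + t)) (at t)"
      using t x by (auto intro!: derivative_eq_intros simp: field_simps)
    moreover have "1 - t - 1 / (1 + t) = - t\<^sup>2 / (1 + t)" using t x by (simp add: field_simps power2_eq_square)
    moreover have "- t\<^sup>2 / (1 + t) \<le> 0" using t x by (simp add: divide_nonpos_pos)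
    ultimately show "\<exists>y. ((\<lambda>x. x - x\<^sup>2 / 2 - ln (1 + x)) has_real_derivative y) (at t) \<and> y \<le> 0" by auto
  qed (use assms in simp)
  then have "exp (ln (1 + x)) * exp (- x) \<le> exp (- x\<^sup>2 / 2)" unfolding mult_exp_exp by simp
  then show ?thesis using x by simp
qed simp

text \<open>For positive \<open>x\<close> the quadratic gain is damped by \<open>1 + x\<close>,
  because \<open>x - ln (1 + x)\<close> grows only linearly.\<close>

lemma one_plus_exp_le_pos:
  assumes "(0::real) \<le> x"
  shows "(1 + x) * exp (- x) \<le> exp (- x\<^sup>2 / (2 * (1 + x)))"
proof -
  have "0 - 0\<^sup>2 / (2 * (1 + 0)) - ln (1 + 0) \<le> x - x\<^sup>2 / (2 * (1 + x)) - ln (1 + x)"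
  proof (rule DERIV_nonneg_imp_nondecreasing [of 0 x "\<lambda>x. x - x\<^sup>2 / (2 * (1 + x)) - ln (1 + x)"])
    fix t :: real assume t: "0 \<le> t" "t \<le> x"
    define D where "D = 1 - (2 * t * (2 * (1 + t)) - t\<^sup>2 * 2) / (2 * (1 + t) * (2 * (1 + t))) - 1 / (1 + t)"
    have "((\<lambda>x. x - x\<^sup>2 / (2 * (1 + x)) - ln (1 + x)) has_real_derivative D) (at t)"
      unfolding D_def using t by (auto intro!: derivative_eq_intros)
    moreover have "D = t\<^sup>2 / (2 * (1 + t)\<^sup>2)"
      unfolding D_def using t by (simp add: divide_simps) (simp add: power2_eq_square algebra_simps)
    moreover have "t\<^sup>2 / (2 * (1 + t)\<^sup>2) \<ge> 0" by simp
    ultimately show "\<exists>y. ((\<lambda>x. x - x\<^sup>2 / (2 * (1 + x)) - ln (1 + x)) has_real_derivative y) (at t) \<and> 0 \<le> y"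
      by auto
  qed (use assms in simp)
  then have "exp (ln (1 + x)) * exp (- x) \<le> exp (- x\<^sup>2 / (2 * (1 + x)))" unfolding mult_exp_exp by simp
  then show ?thesis using assms by simp
qed

text \<open>A bound free of \<open>n\<close> can only be exponential, as the factor stops decaying
  like a Gaussian once \<open>s\<close> exceeds the order of \<open>sqrt n\<close>. It rests on
  \<open>d \<le> sqrt 2\<close> and on
  \<open>(s / sqrt 2 - 1 / 2) * (1 + s * sqrt 2) = s\<^sup>2 - 1 / 2\<close>.\<close>

lemma real_laplace_factor_le_pos:
  assumes n: "n \<ge> 1" and s: "s \<ge> 0"
  shows "((1 + s * sqrt (2 / n)) * exp (- s * sqrt (2 / n))) ^ n \<le> exp (1 / 2 - s / sqrt 2)"
proof -
  define d where "d = sqrt (2 / real n)"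
  have d: "d > 0" "real n * d\<^sup>2 = 2" "d \<le> sqrt 2"
    using n divide_left_mono [of 1 "real n" 2] by (simp_all add: d_def)
  have "((1 + s * d) * exp (- (s * d))) ^ n \<le> exp (- (s * d)\<^sup>2 / (2 * (1 + s * d))) ^ n"
    using s d by (intro power_mono one_plus_exp_le_pos) auto
  also have "\<dots> = exp (- (real n * d\<^sup>2) * s\<^sup>2 / (2 * (1 + s * d)))"
    by (simp add: exp_of_nat_mult [symmetric] power_mult_distrib)
  also have "\<dots> = exp (- s\<^sup>2 / (1 + s * d))" unfolding d(2) using s d(1) by (simp add: divide_simps)
  also have "\<dots> \<le> exp (1 / 2 - s / sqrt 2)"
  proof -
    have pos: "1 + s * d > 0" using s d by (simp add: add_pos_nonneg)
    have "(s / sqrt 2 - 1 / 2) * (1 + s * d) \<le> s\<^sup>2"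
    proof (cases "s / sqrt 2 - 1 / 2 \<le> 0")
      case True
      then have "(s / sqrt 2 - 1 / 2) * (1 + s * d) \<le> 0" using pos by (simp add: mult_nonpos_nonneg)
      then show ?thesis by (meson order_trans zero_le_power2)
    next
      case False
      then have "(s / sqrt 2 - 1 / 2) * (1 + s * d) \<le> (s / sqrt 2 - 1 / 2) * (1 + s * sqrt 2)"
        using d s by (intro mult_left_mono add_left_mono mult_left_mono) auto
      also have "\<dots> = s\<^sup>2 - 1 / 2 + (s / sqrt 2 - s * sqrt 2 / 2)"
        by (simp add: algebra_simps power2_eq_square)
      also have "s / sqrt 2 - s * sqrt 2 / 2 = 0" by (simp add: real_div_sqrt field_simps)
      finally show ?thesis by simp
    qed
    then have "s / sqrt 2 - 1 / 2 \<le> s\<^sup>2 / (1 + s * d)" using pos by (simp add: pos_le_divide_eq)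
    then show ?thesis by simp
  qed
  finally show ?thesis by (simp add: d_def)
qed

lemma real_laplace_factor_le_neg:
  assumes n: "n \<ge> 1" and s: "s \<le> 0" "- 1 \<le> s * sqrt (2 / n)"
  shows "((1 + s * sqrt (2 / n)) * exp (- s * sqrt (2 / n))) ^ n \<le> exp (- s\<^sup>2)"
proof -
  define d where "d = sqrt (2 / real n)"
  have d: "d > 0" "real n * d\<^sup>2 = 2" using n by (simp_all add: d_def)
  have "((1 + s * d) * exp (- (s * d))) ^ n \<le> exp (- (s * d)\<^sup>2 / 2) ^ n"
    using s d by (intro power_mono one_plus_exp_le_neg) (auto simp: mult_nonpos_nonneg d_def)
  also have "\<dots> = exp (- (real n * d\<^sup>2) * s\<^sup>2 / 2)"
    by (simp add: exp_of_nat_mult [symmetric] power_mult_distrib)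
  finally show ?thesis unfolding d(2) by (simp add: d_def)
qed

text \<open>Compared with the real case, the imaginary part costs at most
  \<open>exp (9 * v\<^sup>2)\<close> in the squared modulus of one factor. Over \<open>n\<close>
  factors the exponents add up to at most \<open>18 * B\<^sup>2\<close>, since
  \<open>n * v\<^sup>2 \<le> 2 * B\<^sup>2\<close>. The condition on \<open>B\<close> keeps
  \<open>1 + x\<close> nonnegative.\<close>

lemma norm_laplace_factor_le:
  assumes n: "n \<ge> 1" and B: "B * sqrt (2 / n) \<le> 1" and y: "\<bar>Im y\<bar> \<le> B" "Re y \<ge> - B"
  shows "norm (laplace_factor n y) \<le> exp (9 * B\<^sup>2) * exp (1 / 2 - Re y / sqrt 2)"
proof -
  define d where "d = sqrt (2 / real n)"
  have d: "d > 0" "real n * d\<^sup>2 = 2" using n by (simp_all add: d_def)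
  define x v where "x = Re y * d" and "v = Im y * d"
  have "real n * v\<^sup>2 = 2 * (Im y)\<^sup>2" using d(2) by (simp add: v_def power_mult_distrib)
  also have "(Im y)\<^sup>2 \<le> B\<^sup>2" using y(1) power_mono [of "\<bar>Im y\<bar>" B 2] by simp
  finally have nv: "real n * v\<^sup>2 \<le> 2 * B\<^sup>2" by simp
  have "norm (1 + y * of_real d) ^ 2 = (1 + x)\<^sup>2 + v\<^sup>2"
    by (simp add: cmod_power2 x_def v_def)
  moreover have "norm (exp (- y * of_real d)) = exp (- x)" by (simp add: x_def norm_exp_eq_Re)
  moreover have "norm (laplace_factor n y) ^ 2 = ((norm (1 + y * of_real d) * norm (exp (- y * of_real d))) ^ 2) ^ n"
    unfolding laplace_factor_def d_def [symmetric] norm_power norm_mult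
    by (simp only: power_mult [symmetric] mult.commute)
  ultimately have sq: "norm (laplace_factor n y) ^ 2 = (((1 + x)\<^sup>2 + v\<^sup>2) * exp (- x) ^ 2) ^ n"
    by (simp only: power_mult_distrib)
  have exp_nv: "exp (9 * v\<^sup>2) ^ n \<le> exp (9 * B\<^sup>2) ^ 2"
    using nv by (simp add: exp_of_nat_mult [symmetric] exp_double [symmetric])
  have "(((1 + x)\<^sup>2 + v\<^sup>2) * exp (- x) ^ 2) ^ n \<le> (exp (9 * B\<^sup>2) * exp (1 / 2 - Re y / sqrt 2)) ^ 2"
  proof (cases "Re y \<ge> 0")
    case True
    then have x: "x \<ge> 0" using d by (simp add: x_def)
    have "(1 + x)\<^sup>2 + v\<^sup>2 \<le> (1 + x)\<^sup>2 * (1 + 9 * v\<^sup>2)"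
    proof -
      have "1 * v\<^sup>2 \<le> (1 + x)\<^sup>2 * (9 * v\<^sup>2)" using x by (intro mult_mono) (auto simp: one_le_power)
      then show ?thesis by (simp add: distrib_left)
    qed
    also have "\<dots> \<le> (1 + x)\<^sup>2 * exp (9 * v\<^sup>2)" by (intro mult_left_mono exp_ge_add_one_self) simp
    finally have "((1 + x)\<^sup>2 + v\<^sup>2) * exp (- x) ^ 2 \<le> (1 + x)\<^sup>2 * exp (9 * v\<^sup>2) * exp (- x) ^ 2"
      by (intro mult_right_mono) auto
    then have "(((1 + x)\<^sup>2 + v\<^sup>2) * exp (- x) ^ 2) ^ n \<le> ((1 + x)\<^sup>2 * exp (9 * v\<^sup>2) * exp (- x) ^ 2) ^ n"
      by (intro power_mono) auto
    also have "\<dots> = exp (9 * v\<^sup>2) ^ n * (((1 + x) * exp (- x)) ^ n) ^ 2"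
      by (simp only: power_mult_distrib power_mult [symmetric] mult_ac)
    also have "\<dots> \<le> exp (9 * B\<^sup>2) ^ 2 * exp (1 / 2 - Re y / sqrt 2) ^ 2"
      using real_laplace_factor_le_pos [OF n True] exp_nv x
      by (intro mult_mono power_mono) (auto simp: x_def d_def)
    finally show ?thesis by (simp only: power_mult_distrib)
  next
    case False
    have "Re y * d \<ge> - B * d" using y d by (intro mult_right_mono) auto
    moreover have "B * d \<le> 1" using B by (simp add: d_def)
    ultimately have x: "- 1 \<le> x" "x < 0"
      using False d by (simp_all add: x_def mult_neg_pos)
    have "(1 + x)\<^sup>2 \<le> exp x ^ 2" using x by (intro power_mono exp_ge_add_one_self) auto
    \<comment> \<open>The origin of the constant 9: on this side
      \<open>exp x \<ge> exp (- 1) \<ge> 1 / 3\<close>.\<close>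
    moreover have "1 \<le> 9 * exp x ^ 2"
    proof -
      have "1 / 3 \<le> exp (- 1 :: real)"
        using exp_le by (simp add: exp_minus field_simps)
      also have "\<dots> \<le> exp x" using x(1) by (simp only: exp_le_cancel_iff)
      finally have "(1 / 3) ^ 2 \<le> exp x ^ 2" by (intro power_mono) auto
      then show ?thesis by (simp add: power2_eq_square)
    qed
    then have "1 * v\<^sup>2 \<le> 9 * exp x ^ 2 * v\<^sup>2" by (intro mult_right_mono) auto
    ultimately have "(1 + x)\<^sup>2 + v\<^sup>2 \<le> exp x ^ 2 * (1 + 9 * v\<^sup>2)" by (simp add: algebra_simps)
    also have "\<dots> \<le> exp x ^ 2 * exp (9 * v\<^sup>2)" by (intro mult_left_mono exp_ge_add_one_self) simp
    finally have "((1 + x)\<^sup>2 + v\<^sup>2) * exp (- x) ^ 2 \<le> exp x ^ 2 * exp (9 * v\<^sup>2) * exp (- x) ^ 2"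
      by (intro mult_right_mono) auto
    also have "\<dots> = exp (9 * v\<^sup>2) * (exp x * exp (- x)) ^ 2" by (simp only: power_mult_distrib mult_ac)
    also have "\<dots> = exp (9 * v\<^sup>2)" by (simp add: mult_exp_exp)
    finally have "(((1 + x)\<^sup>2 + v\<^sup>2) * exp (- x) ^ 2) ^ n \<le> exp (9 * v\<^sup>2) ^ n"
      by (intro power_mono) auto
    also have "\<dots> \<le> exp (9 * B\<^sup>2) ^ 2 * 1" using exp_nv by simp
    also have "\<dots> \<le> exp (9 * B\<^sup>2) ^ 2 * exp (1 / 2 - Re y / sqrt 2) ^ 2"
    proof (intro mult_left_mono one_le_power)
      have "Re y / sqrt 2 \<le> 0" using False by (simp add: divide_nonpos_pos)
      then have "0 \<le> 1 / 2 - Re y / sqrt 2" by linarith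
      then show "1 \<le> exp (1 / 2 - Re y / sqrt 2)" by (simp only: one_le_exp_iff)
    qed simp
    finally show ?thesis by (simp only: power_mult_distrib)
  qed
  then show ?thesis unfolding sq [symmetric] by (rule power2_le_imp_le) simp
qed

lemma has_bochner_integral_power_exp:
  "has_bochner_integral lborel (\<lambda>v::real. indicator {0..} v *\<^sub>R (v ^ m * exp (- v))) (fact m)"
proof (rule has_bochner_integral_nn_integral)
  have "(\<integral>\<^sup>+ v. ennreal (indicator {0..} v *\<^sub>R (v ^ m * exp (- v))) \<partial>lborel) =
      (\<integral>\<^sup>+ v. ennreal (v ^ m * exp (- v)) * indicator {0..} v \<partial>lborel)"
    by (intro nn_integral_cong) (simp add: indicator_def)
  then show "(\<integral>\<^sup>+ v. ennreal (indicator {0..} v *\<^sub>R (v ^ m * exp (- v))) \<partial>lborel) = ennreal (fact m)"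
    using nn_intergal_power_times_exp_Ici [of m] by (simp add: ennreal_of_nat_eq_real_of_nat)
qed (auto simp: indicator_def)

lemma integrable_exp_decay:
  assumes "a > 0"
  shows "integrable lborel (\<lambda>s::real. indicator {0..} s *\<^sub>R exp (- (a * s)))"
proof -
  have "integrable lborel (\<lambda>v::real. indicator {0..} v *\<^sub>R (v ^ 0 * exp (- v)))"
    using has_bochner_integral_power_exp [of 0] by (rule integrable.intros)
  then have "integrable lborel (\<lambda>s. indicator {0..} (0 + a * s) *\<^sub>R ((0 + a * s) ^ 0 * exp (- (0 + a * s))))"
    by (rule lborel_integrable_real_affine) (use assms in simp)
  moreover have "indicator {0..} (a * s) = (indicator {0..} s :: real)" for s
    using assms by (auto simp: indicator_def zero_le_mult_iff)
  ultimately show ?thesis by simp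
qed


lemma sqrt_two_mult:
  assumes "n \<ge> 1"
  shows "sqrt (2 * real n) = real n * sqrt (2 / real n)"
proof -
  have "2 * real n = (real n)\<^sup>2 * (2 / real n)" using assms by (simp add: power2_eq_square)
  then have "sqrt (2 * real n) = sqrt ((real n)\<^sup>2 * (2 / real n))" by (simp only:)
  then show ?thesis unfolding real_sqrt_mult by simp
qed

section \<open>Stirling's formula\<close>

definition stirling_ratio :: "nat \<Rightarrow> real" where
  "stirling_ratio n = sqrt (2 * n) * n ^ n * exp (- n) / fact n"

text \<open>After the substitution \<open>v = n + sqrt (2 * n) * s\<close> the Gamma integral for
  \<open>fact n\<close> becomes the integral of \<open>g n\<close>, with exactly the constants of
  \<open>stirling_ratio\<close>; the bounds on both half-lines let \<open>g n\<close> pass to the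
  Gaussian.\<close>

lemma tendsto_stirling_ratio: "stirling_ratio \<longlonglongrightarrow> 1 / sqrt pi"
proof -
  define g where "g n s = indicator {- sqrt (n / 2)..} s *
      ((1 + s * sqrt (2 / n)) * exp (- s * sqrt (2 / n))) ^ n" for n :: nat and s :: real
  have int_g: "stirling_ratio n * (\<integral>s. g n s \<partial>lborel) = 1" if n: "n \<ge> 1" for n
  proof -
    let ?f = "\<lambda>v::real. indicator {0..} v *\<^sub>R (v ^ n * exp (- v))"
    have eq: "?f (real n + sqrt (2 * n) * s) = n ^ n * exp (- n) * g n s" for s
    proof -
      note rt1 = sqrt_two_mult [OF n]
      have "sqrt (2 * real n) * sqrt (real n / 2) = sqrt ((real n)\<^sup>2)"
        unfolding real_sqrt_mult [symmetric] by (simp add: power2_eq_square)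
      then have rt2: "sqrt (2 * real n) * sqrt (real n / 2) = real n" by simp
      have "(0 \<le> real n + sqrt (2 * n) * s) = (- sqrt (n / 2) \<le> s)"
      proof -
        have "real n + sqrt (2 * n) * s = sqrt (2 * n) * (sqrt (n / 2) + s)" using rt2 by (simp add: algebra_simps)
        then show ?thesis using n by (auto simp: zero_le_mult_iff)
      qed
      then have "indicator {0..} (real n + sqrt (2 * n) * s) = (indicator {- sqrt (n / 2)..} s :: real)"
        by (simp add: indicator_def)
      moreover have "real n + sqrt (2 * n) * s = real n * (1 + s * sqrt (2 / n))"
        unfolding of_nat_mult of_nat_numeral rt1 by (simp only: distrib_left mult_1_right mult_1_left mult_ac)
      moreover have "exp (- (real n * (1 + s * sqrt (2 / n)))) = exp (- n) * exp (- s * sqrt (2 / n)) ^ n"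
        by (simp add: exp_of_nat_mult [symmetric] mult_exp_exp algebra_simps)
      ultimately show ?thesis unfolding g_def by (simp add: power_mult_distrib)
    qed
    have "fact n = (\<integral>v. ?f v \<partial>lborel)"
      using has_bochner_integral_power_exp [of n] by (simp add: has_bochner_integral_iff)
    also have "\<dots> = sqrt (2 * n) * (\<integral>s. n ^ n * exp (- n) * g n s \<partial>lborel)"
      using lborel_integral_real_affine [of "sqrt (2 * n)" ?f "real n"] n unfolding eq by simp
    finally have F: "fact n = sqrt (2 * n) * (n ^ n * exp (- n)) * (\<integral>s. g n s \<partial>lborel)" by simp
    have "stirling_ratio n * (\<integral>s. g n s \<partial>lborel) =
        sqrt (2 * n) * (n ^ n * exp (- n)) * (\<integral>s. g n s \<partial>lborel) / fact n"
      by (simp add: stirling_ratio_def)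
    then show ?thesis unfolding F [symmetric] by simp
  qed
  \<comment> \<open>The shift avoids \<open>n = 0\<close>: there \<open>2 / 0 = 0\<close> turns
    \<open>g\<close> into the indicator of a half-line, which has no integrable bound.\<close>
  have "(\<lambda>n. \<integral>s. g (Suc n) s \<partial>lborel) \<longlonglongrightarrow> (\<integral>s. exp (- s\<^sup>2) \<partial>lborel)"
  proof (rule integral_dominated_convergence)
    show "integrable lborel (\<lambda>s::real. exp (- s\<^sup>2) + exp (1 / 2) * (indicator {0..} s *\<^sub>R exp (- (1 / sqrt 2 * s))))"
      by (intro Bochner_Integration.integrable_add integrable_mult_right integrable_exp_minus_square integrable_exp_decay) simp
    show "g (Suc n) \<in> borel_measurable lborel" for n unfolding g_def [abs_def] by measurable
    show "AE s in lborel. norm (g (Suc n) s) \<le>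
        exp (- s\<^sup>2) + exp (1 / 2) * (indicator {0..} s *\<^sub>R exp (- (1 / sqrt 2 * s)))" for n
    proof (rule AE_I2)
      fix s :: real
      show "norm (g (Suc n) s) \<le> exp (- s\<^sup>2) + exp (1 / 2) * (indicator {0..} s *\<^sub>R exp (- (1 / sqrt 2 * s)))"
      proof (cases "s \<ge> 0")
        case True
        have "norm (g (Suc n) s) \<le> ((1 + s * sqrt (2 / Suc n)) * exp (- s * sqrt (2 / Suc n))) ^ Suc n"
          using True unfolding g_def by (auto simp: indicator_def abs_mult)
        also have "\<dots> \<le> exp (1 / 2 - s / sqrt 2)" by (rule real_laplace_factor_le_pos) (use True in auto)
        also have "\<dots> = exp (1 / 2) * exp (- (1 / sqrt 2 * s))" by (simp add: mult_exp_exp)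
        finally show ?thesis using True by (simp add: add_increasing)
      next
        case False
        have "norm (g (Suc n) s) \<le> exp (- s\<^sup>2)"
        proof (cases "- sqrt (Suc n / 2) \<le> s")
          case True
          then have "- sqrt (Suc n / 2) * sqrt (2 / Suc n) \<le> s * sqrt (2 / Suc n)"
            by (intro mult_right_mono) auto
          moreover have "sqrt (Suc n / 2) * sqrt (2 / Suc n) = 1" by (simp add: real_sqrt_mult [symmetric] del: of_nat_Suc)
          ultimately have 1: "- 1 \<le> s * sqrt (2 / Suc n)" by simp
          then have "norm (g (Suc n) s) = ((1 + s * sqrt (2 / Suc n)) * exp (- s * sqrt (2 / Suc n))) ^ Suc n"
            using True unfolding g_def by (simp add: abs_mult del: of_nat_Suc power_Suc)
          also have "\<dots> \<le> exp (- s\<^sup>2)" by (rule real_laplace_factor_le_neg) (use False 1 in auto)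
          finally show ?thesis .
        qed (simp add: g_def)
        then show ?thesis by (simp add: add_increasing2)
      qed
    qed
    show "AE s in lborel. (\<lambda>n. g (Suc n) s) \<longlonglongrightarrow> exp (- s\<^sup>2)"
    proof (rule AE_I2)
      fix s :: real
      have "(\<lambda>n. laplace_factor (Suc n) (of_real s)) \<longlonglongrightarrow> exp (- (of_real s)\<^sup>2)"
        by (intro tendsto_laplace_factor filterlim_Suc tendsto_const)
      from tendsto_Re [OF this]
      have "(\<lambda>n. ((1 + s * sqrt (2 / Suc n)) * exp (- s * sqrt (2 / Suc n))) ^ Suc n) \<longlonglongrightarrow> exp (- s\<^sup>2)"
      proof -
        have "laplace_factor (Suc n) (of_real s) =
            of_real (((1 + s * sqrt (2 / Suc n)) * exp (- s * sqrt (2 / Suc n))) ^ Suc n)" for n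
          unfolding laplace_factor_def by (simp flip: exp_of_real)
        moreover have "exp (- (complex_of_real s)\<^sup>2) = of_real (exp (- s\<^sup>2))" by (simp flip: exp_of_real)
        ultimately show ?thesis
          using tendsto_Re [OF \<open>(\<lambda>n. laplace_factor (Suc n) (of_real s)) \<longlonglongrightarrow> exp (- (of_real s)\<^sup>2)\<close>]
          by (simp only: Re_complex_of_real)
      qed
      moreover have "\<forall>\<^sub>F n in sequentially. - sqrt (Suc n / 2) \<le> s" by real_asymp
      then have "\<forall>\<^sub>F n in sequentially. ((1 + s * sqrt (2 / Suc n)) * exp (- s * sqrt (2 / Suc n))) ^ Suc n = g (Suc n) s"
        by eventually_elim (simp add: g_def)
      ultimately show "(\<lambda>n. g (Suc n) s) \<longlonglongrightarrow> exp (- s\<^sup>2)" by (rule Lim_transform_eventually)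
    qed
  qed simp
  then have "(\<lambda>n. 1 / (\<integral>s. g (Suc n) s \<partial>lborel)) \<longlonglongrightarrow> 1 / sqrt pi"
    unfolding integral_exp_minus_square by (intro tendsto_intros) simp_all
  moreover have "1 / (\<integral>s. g (Suc n) s \<partial>lborel) = stirling_ratio (Suc n)" for n
    using int_g [of "Suc n"] by (metis Suc_eq_plus1 le_add2 mult_not_zero nonzero_eq_divide_eq zero_neq_one)
  ultimately have "(\<lambda>n. stirling_ratio (Suc n)) \<longlonglongrightarrow> 1 / sqrt pi" by simp
  then show ?thesis by (simp only: filterlim_sequentially_Suc)
qed

section \<open>Truncated exponentials in their transition region\<close>

definition trunc_exp :: "nat \<Rightarrow> complex \<Rightarrow> complex" where
  "trunc_exp n t = (\<Sum>l\<le>n. t ^ l / fact l)"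

text \<open>The binomial expansion of \<open>(t + v) ^ n\<close> makes every term a Gamma integral.
  For real \<open>t\<close> this is the regularised upper incomplete Gamma function of order
  \<open>n + 1\<close>; the horizontal ray extends it to complex \<open>t\<close>.\<close>

lemma exp_trunc_exp_eq_integral:
  "exp (- t) * trunc_exp n t =
    1 / fact n * (\<integral>v. indicator {0..} v *\<^sub>R ((t + of_real v) ^ n * exp (- (t + of_real v))) \<partial>lborel)"
proof -
  define \<gamma> where "\<gamma> m v = indicator {0..} v *\<^sub>R (v ^ m * exp (- v))" for m and v :: real
  have \<gamma>: "integrable lborel (\<gamma> m)" "(\<integral>v. \<gamma> m v \<partial>lborel) = fact m" for m
    using has_bochner_integral_power_exp [of m] unfolding \<gamma>_def [abs_def] by (simp_all add: has_bochner_integral_iff)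
  have eq: "indicator {0..} v *\<^sub>R ((t + of_real v) ^ n * exp (- (t + of_real v))) =
      (\<Sum>l\<le>n. of_nat (n choose l) * t ^ l * exp (- t) * complex_of_real (\<gamma> (n - l) v))" for v :: real
  proof -
    have "exp (- (t + of_real v)) = exp (- t) * complex_of_real (exp (- v))"
      by (simp add: exp_of_real [symmetric] mult_exp_exp)
    then show ?thesis
      unfolding binomial_ring \<gamma>_def
      by (simp add: indicator_def sum_distrib_left sum_distrib_right mult_ac)
  qed
  have "(\<integral>v. indicator {0..} v *\<^sub>R ((t + of_real v) ^ n * exp (- (t + of_real v))) \<partial>lborel) =
      (\<Sum>l\<le>n. of_nat (n choose l) * t ^ l * exp (- t) * fact (n - l))"
    unfolding eq
  proof (subst Bochner_Integration.integral_sum)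
    show "integrable lborel (\<lambda>v. of_nat (n choose l) * t ^ l * exp (- t) * complex_of_real (\<gamma> (n - l) v))" for l
      using \<gamma>(1) by (intro integrable_mult_right) simp
    show "(\<Sum>l\<le>n. \<integral>v. of_nat (n choose l) * t ^ l * exp (- t) * complex_of_real (\<gamma> (n - l) v) \<partial>lborel) =
        (\<Sum>l\<le>n. of_nat (n choose l) * t ^ l * exp (- t) * fact (n - l))"
      unfolding integral_mult_right_zero integral_complex_of_real \<gamma>(2) by simp
  qed
  also have "\<dots> = (\<Sum>l\<le>n. fact n * (exp (- t) * (t ^ l / fact l)))"
  proof (rule sum.cong [OF refl])
    fix l assume "l \<in> {..n}"
    then have "(of_nat (n choose l) :: complex) = fact n / (fact l * fact (n - l))"
      by (intro binomial_fact) simp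
    then show "of_nat (n choose l) * t ^ l * exp (- t) * fact (n - l) = fact n * (exp (- t) * (t ^ l / fact l))"
      by simp
  qed
  finally show ?thesis by (simp add: trunc_exp_def sum_distrib_left)
qed

lemma exp_trunc_exp_eq_laplace:
  fixes c :: complex
  assumes n: "n \<ge> 1"
  defines "t \<equiv> of_nat n + of_real (sqrt (2 * n)) * c"
  shows "exp (- t) * trunc_exp n t = of_real (stirling_ratio n) *
    (\<integral>s. indicator {0..} s *\<^sub>R laplace_factor n (c + of_real s) \<partial>lborel)"
proof -
  let ?f = "\<lambda>v::real. indicator {0..} v *\<^sub>R ((t + of_real v) ^ n * exp (- (t + of_real v)))"
  note rt = sqrt_two_mult [OF n]
  have eq: "?f (0 + sqrt (2 * real n) * s) = of_real (real n ^ n * exp (- real n)) *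
      (indicator {0..} s *\<^sub>R laplace_factor n (c + of_real s))" for s
  proof -
    define y where "y = (c + of_real s) * complex_of_real (sqrt (2 / real n))"
    have "t + of_real (0 + sqrt (2 * real n) * s) = of_nat n * (1 + y)"
      unfolding t_def of_nat_mult of_nat_numeral rt y_def by (simp add: algebra_simps)
    moreover have "exp (- (of_nat n * (1 + y))) = of_real (exp (- real n)) * exp (- y) ^ n"
      by (simp add: exp_of_nat_mult [symmetric] exp_of_real [symmetric] mult_exp_exp algebra_simps)
    moreover have "indicator {0..} (0 + sqrt (2 * real n) * s) = (indicator {0..} s :: real)"
      using n by (simp add: indicator_def zero_le_mult_iff)
    moreover have "laplace_factor n (c + of_real s) = ((1 + y) * exp (- y)) ^ n"
      by (simp only: laplace_factor_def y_def mult_minus_left)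
    ultimately show ?thesis
      by (simp add: power_mult_distrib scaleR_conv_of_real mult_ac)
  qed
  have "(\<integral>v. ?f v \<partial>lborel) = of_real (sqrt (2 * real n)) * (\<integral>s. ?f (0 + sqrt (2 * real n) * s) \<partial>lborel)"
    using n by (subst lborel_integral_real_affine [of "sqrt (2 * real n)" ?f 0]) (simp_all add: scaleR_conv_of_real)
  also have "\<dots> = of_real (sqrt (2 * real n)) * (of_real (real n ^ n * exp (- real n)) *
      (\<integral>s. indicator {0..} s *\<^sub>R laplace_factor n (c + of_real s) \<partial>lborel))"
    unfolding eq integral_mult_right_zero ..
  finally show ?thesis
    unfolding exp_trunc_exp_eq_integral stirling_ratio_def by simp
qed

text \<open>Around \<open>t = n\<close> the left-hand side falls from 1 to 0 on the scale
  \<open>sqrt (2 * n)\<close>, and \<open>c\<close> is the position on that scale. The Laplace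
  integrals tend to \<open>gauss_tail c0\<close>, the Stirling ratio to
  \<open>1 / sqrt pi\<close>.\<close>

lemma tendsto_exp_trunc_exp:
  assumes M: "filterlim M at_top sequentially" and c: "c \<longlonglongrightarrow> c0"
    and t: "\<forall>\<^sub>F N in sequentially. t N = of_nat (M N) + of_real (sqrt (2 * real (M N))) * c N"
  shows "(\<lambda>N. exp (- t N) * trunc_exp (M N) (t N)) \<longlonglongrightarrow> erfc c0 / 2"
proof -
  obtain B where B: "\<And>N. norm (c N) \<le> B" "B > 0"
    using convergent_imp_Bseq [OF convergentI [OF c]] unfolding Bseq_def by blast
  have "(\<lambda>n. B * sqrt (2 / real n)) \<longlonglongrightarrow> 0" by real_asymp
  from order_tendstoD(2) [OF filterlim_compose [OF this M], of 1]
  have ev1: "\<forall>\<^sub>F N in sequentially. B * sqrt (2 / real (M N)) \<le> 1"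
    by (auto elim: eventually_mono)
  have ev2: "\<forall>\<^sub>F N in sequentially. M N \<ge> 1"
    using M by (simp add: filterlim_at_top)
  define good where "good N \<longleftrightarrow> B * sqrt (2 / real (M N)) \<le> 1 \<and> M N \<ge> 1" for N
  have good: "\<forall>\<^sub>F N in sequentially. good N"
    unfolding good_def using ev1 ev2 by (rule eventually_conj)
  \<comment> \<open>The integrable bound holds for large \<open>N\<close> only; replacing the
    earlier integrands by 0 makes it hold for all \<open>N\<close>.\<close>
  define L where "L N s = (if good N then indicator {0..} s *\<^sub>R laplace_factor (M N) (c N + of_real s) else 0)"
    for N and s :: real
  have "(\<lambda>N. \<integral>s. L N s \<partial>lborel) \<longlonglongrightarrow> gauss_tail c0"
    unfolding gauss_tail_def
  proof (rule integral_dominated_convergence)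
    show "integrable lborel (\<lambda>s::real. exp (9 * B\<^sup>2) * exp (1 / 2 + B / sqrt 2) *
        (indicator {0..} s *\<^sub>R exp (- (1 / sqrt 2 * s))))"
      by (intro integrable_mult_right integrable_exp_decay) simp
    show "L N \<in> borel_measurable lborel" for N
      unfolding L_def [abs_def] laplace_factor_def by (cases "good N") auto
    show "AE s in lborel. norm (L N s) \<le> exp (9 * B\<^sup>2) * exp (1 / 2 + B / sqrt 2) *
        (indicator {0..} s *\<^sub>R exp (- (1 / sqrt 2 * s)))" for N
    proof (rule AE_I2)
      fix s :: real
      show "norm (L N s) \<le> exp (9 * B\<^sup>2) * exp (1 / 2 + B / sqrt 2) *
        (indicator {0..} s *\<^sub>R exp (- (1 / sqrt 2 * s)))"
      proof (cases "good N \<and> s \<ge> 0")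
        case True
        have re: "Re (c N) \<ge> - B" "\<bar>Im (c N)\<bar> \<le> B"
          using abs_Re_le_cmod [of "c N"] abs_Im_le_cmod [of "c N"] B(1) [of N] by linarith+
        have "norm (L N s) = norm (laplace_factor (M N) (c N + of_real s))" using True by (simp add: L_def)
        also have "\<dots> \<le> exp (9 * B\<^sup>2) * exp (1 / 2 - Re (c N + of_real s) / sqrt 2)"
          by (rule norm_laplace_factor_le) (use True re in \<open>auto simp: good_def\<close>)
        also have "\<dots> \<le> exp (9 * B\<^sup>2) * exp ((1 / 2 + B / sqrt 2) + (- (1 / sqrt 2 * s)))"
          using re by (intro mult_left_mono) (simp_all add: field_simps)
        finally show ?thesis using True unfolding exp_add by simp
      qed (auto simp: L_def)
    qed
    show "AE s in lborel. (\<lambda>N. L N s) \<longlonglongrightarrow> indicator {0..} s *\<^sub>R exp (- (c0 + of_real s)\<^sup>2)"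
    proof (rule AE_I2)
      fix s :: real
      have "(\<lambda>N. indicator {0..} s *\<^sub>R laplace_factor (M N) (c N + of_real s)) \<longlonglongrightarrow>
          indicator {0..} s *\<^sub>R exp (- (c0 + of_real s)\<^sup>2)"
        by (intro tendsto_scaleR tendsto_const tendsto_laplace_factor [OF M] tendsto_add c)
      moreover have "\<forall>\<^sub>F N in sequentially. indicator {0..} s *\<^sub>R laplace_factor (M N) (c N + of_real s) = L N s"
        using good by eventually_elim (simp add: L_def)
      ultimately show "(\<lambda>N. L N s) \<longlonglongrightarrow> indicator {0..} s *\<^sub>R exp (- (c0 + of_real s)\<^sup>2)"
        by (rule Lim_transform_eventually)
    qed
  qed measurable
  then have "(\<lambda>N. of_real (stirling_ratio (M N)) * (\<integral>s. L N s \<partial>lborel)) \<longlonglongrightarrow>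
      of_real (1 / sqrt pi) * gauss_tail c0"
    by (intro tendsto_intros filterlim_compose [OF tendsto_stirling_ratio M])
  moreover have "\<forall>\<^sub>F N in sequentially. of_real (stirling_ratio (M N)) * (\<integral>s. L N s \<partial>lborel) =
      exp (- t N) * trunc_exp (M N) (t N)"
    using good t
  proof eventually_elim
    case (elim N)
    then have "M N \<ge> 1" by (simp add: good_def)
    from exp_trunc_exp_eq_laplace [OF this, of "c N"] elim show ?case by (simp add: L_def)
  qed
  ultimately have "(\<lambda>N. exp (- t N) * trunc_exp (M N) (t N)) \<longlonglongrightarrow> of_real (1 / sqrt pi) * gauss_tail c0"
    by (rule Lim_transform_eventually)
  also have "of_real (1 / sqrt pi) * gauss_tail c0 = erfc c0 / 2"
    by (simp add: erfc_eq_gauss_tail)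
  finally show ?thesis .
qed

section \<open>The rescaled kernel\<close>

text \<open>\<open>2 ^ i * fact i / fact (2 * i + 1)\<close> is the inverse of the double factorial of \<open>2 i + 1\<close>.\<close>

definition edge_sum :: "nat \<Rightarrow> complex \<Rightarrow> complex \<Rightarrow> complex" where
  "edge_sum N X Y = (\<Sum>i<N. 2 ^ i * fact i / fact (2 * i + 1) *
     (X ^ (2 * i + 1) * trunc_exp i (Y\<^sup>2 / 2) - trunc_exp i (X\<^sup>2 / 2) * Y ^ (2 * i + 1)))"

lemma edge_sum_diag: "edge_sum N X X = 0"
  by (simp add: edge_sum_def mult.commute)

lemma trunc_exp_has_field_derivative:
  "(trunc_exp n has_field_derivative trunc_exp n t - t ^ n / fact n) (at t)"
proof (induction n)
  case (Suc n)
  have eq: "trunc_exp (Suc n) = (\<lambda>t. trunc_exp n t + t ^ Suc n / fact (Suc n))"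
    by (simp add: trunc_exp_def fun_eq_iff)
  have "((\<lambda>t::complex. t ^ Suc n / fact (Suc n)) has_field_derivative of_nat (Suc n) * t ^ n / fact (Suc n)) (at t)"
    using DERIV_cdivide [OF DERIV_power [OF DERIV_ident, of "Suc n" t UNIV], of "fact (Suc n)"]
    by (simp del: fact_Suc of_nat_Suc)
  also have "of_nat (Suc n) * t ^ n / fact (Suc n) = t ^ n / fact n"
    by (simp add: divide_simps del: of_nat_Suc)
  finally have "(trunc_exp (Suc n) has_field_derivative (trunc_exp n t - t ^ n / fact n) + t ^ n / fact n) (at t)"
    unfolding eq by (rule DERIV_add [OF Suc])
  moreover have "trunc_exp (Suc n) t - t ^ Suc n / fact (Suc n) = trunc_exp n t"
    by (simp add: trunc_exp_def)
  ultimately show ?case by (simp only: diff_add_cancel)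
qed (simp add: trunc_exp_def)

text \<open>Let \<open>a i = 2 ^ i * fact i / fact (2 * i + 1)\<close> and
  \<open>b i = 2 ^ i * fact i / fact (2 * i)\<close>. Then \<open>(2 * i + 1) * a i = b i\<close>
  and \<open>a i = b (i + 1)\<close>, so the terms with \<open>b i * X ^ (2 * i)\<close> telescope
  and leave only the last one. The top terms of the truncated exponentials in \<open>Y\<close> and
  \<open>X\<close> supply the even and the odd terms of the exponential series of
  \<open>X * Y\<close>.\<close>

lemma edge_sum_derivative_identity:
  "(\<Sum>i<N. 2 ^ i * fact i / fact (2 * i + 1) *
     (of_nat (2 * i + 1) * X ^ (2 * i) * trunc_exp i (Y\<^sup>2 / 2) -
      (trunc_exp i (X\<^sup>2 / 2) - (X\<^sup>2 / 2) ^ i / fact i) * X * Y ^ (2 * i + 1))) =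
   X * edge_sum N X Y + (\<Sum>l<2 * N. (X * Y) ^ l / fact l) -
     2 ^ N * fact N / fact (2 * N) * X ^ (2 * N) * (\<Sum>l<N. (Y\<^sup>2 / 2) ^ l / fact l)"
proof (induction N)
  case (Suc N)
  define a b F D where "a = (2 ^ N * fact N / fact (2 * N + 1) :: complex)"
    and "b = (2 ^ N * fact N / fact (2 * N) :: complex)"
    and "F = (fact N :: complex)" and "D = (fact (2 * N) :: complex)"
  define e where "e = (\<Sum>l<N. (Y\<^sup>2 / 2) ^ l / fact l)"
  define u v where "u = trunc_exp N (X\<^sup>2 / 2)" and "v = (Y\<^sup>2 / 2) ^ N / fact N"
  have te: "trunc_exp N (Y\<^sup>2 / 2) = e + v"
    by (simp add: trunc_exp_def e_def v_def lessThan_Suc_atMost [symmetric])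
  have fact1: "(fact (2 * N + 1) :: complex) = of_nat (2 * N + 1) * D" unfolding D_def by simp
  have nz: "of_nat (2 * N + 1) \<noteq> (0::complex)" "D \<noteq> 0" "F \<noteq> 0" "of_nat (Suc N) \<noteq> (0::complex)"
    unfolding of_nat_eq_0_iff D_def F_def by auto
  have a1: "a * of_nat (2 * N + 1) = b"
    using nz unfolding a_def b_def fact1 by (simp add: D_def [symmetric])
  have a2: "2 ^ Suc N * fact (Suc N) / fact (2 * Suc N) = a"
  proof -
    have "(fact (2 * Suc N) :: complex) = of_nat (2 * Suc N) * fact (2 * N + 1)" by simp
    moreover have "(fact (Suc N) :: complex) = of_nat (Suc N) * fact N" by simp
    ultimately show ?thesis using nz(4) unfolding a_def of_nat_mult of_nat_numeral by (simp del: of_nat_Suc fact_Suc)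
  qed
  have xv: "b * X ^ (2 * N) * v = (X * Y) ^ (2 * N) / fact (2 * N)"
    using nz(3) unfolding b_def v_def F_def
    by (simp add: power_divide power_mult_distrib power_mult [symmetric])
  have xu: "a * ((X\<^sup>2 / 2) ^ N / fact N) * X * Y ^ (2 * N + 1) = (X * Y) ^ (2 * N + 1) / fact (2 * N + 1)"
    using nz(3) unfolding a_def F_def
    by (simp add: power_divide power_mult_distrib power_mult [symmetric] del: fact_Suc)
  have "a * (of_nat (2 * N + 1) * X ^ (2 * N) * (e + v) -
      (u - (X\<^sup>2 / 2) ^ N / fact N) * X * Y ^ (2 * N + 1)) =
      a * of_nat (2 * N + 1) * X ^ (2 * N) * e + a * of_nat (2 * N + 1) * X ^ (2 * N) * v
      - a * u * X * Y ^ (2 * N + 1) + a * ((X\<^sup>2 / 2) ^ N / fact N) * X * Y ^ (2 * N + 1)"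
    by (simp only: distrib_left right_diff_distrib left_diff_distrib mult_ac) (simp add: algebra_simps)
  also have "\<dots> = b * X ^ (2 * N) * e + (X * Y) ^ (2 * N) / fact (2 * N)
      - a * u * X * Y ^ (2 * N + 1) + (X * Y) ^ (2 * N + 1) / fact (2 * N + 1)"
    unfolding a1 xv xu ..
  also have "\<dots> = X * (a * (X ^ (2 * N + 1) * (e + v) - u * Y ^ (2 * N + 1))) +
      ((X * Y) ^ (2 * N) / fact (2 * N) + (X * Y) ^ (2 * N + 1) / fact (2 * N + 1)) -
      a * X ^ (2 * N + 2) * (e + v) + b * X ^ (2 * N) * e"
    by (simp add: algebra_simps)
  finally have step: "a * (of_nat (2 * N + 1) * X ^ (2 * N) * (e + v) -
      (u - (X\<^sup>2 / 2) ^ N / fact N) * X * Y ^ (2 * N + 1)) =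
      X * (a * (X ^ (2 * N + 1) * (e + v) - u * Y ^ (2 * N + 1))) +
      ((X * Y) ^ (2 * N) / fact (2 * N) + (X * Y) ^ (2 * N + 1) / fact (2 * N + 1)) -
      a * X ^ (2 * N + 2) * (e + v) + b * X ^ (2 * N) * e" .
  have E: "(\<Sum>l<2 * Suc N. (X * Y) ^ l / fact l) = (\<Sum>l<2 * N. (X * Y) ^ l / fact l) +
      ((X * Y) ^ (2 * N) / fact (2 * N) + (X * Y) ^ (2 * N + 1) / fact (2 * N + 1))"
    by (simp add: add.assoc)
  have S: "(\<Sum>l<Suc N. (Y\<^sup>2 / 2) ^ l / fact l) = e + v" by (simp add: e_def v_def)
  have G: "edge_sum (Suc N) X Y = edge_sum N X Y + a * (X ^ (2 * N + 1) * (e + v) - u * Y ^ (2 * N + 1))"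
    by (simp add: edge_sum_def a_def te u_def)
  have p: "X ^ (2 * Suc N) = X ^ (2 * N + 2)" by simp
  have regroup: "x * g + r - q + (x * h + t - c + q) = x * (g + h) + (r + t) - c" for x g r q h t c :: complex
    by (simp add: algebra_simps)
  show ?case
    unfolding E S G a2 sum.lessThan_Suc Suc.IH te
    unfolding a_def [symmetric] u_def [symmetric] step b_def [symmetric] e_def [symmetric] v_def [symmetric] p
    by (rule regroup)
qed (simp add: edge_sum_def)

lemma edge_sum_has_field_derivative:
  assumes "N \<ge> 1"
  shows "((\<lambda>X. edge_sum N X Y) has_field_derivative
    X * edge_sum N X Y + trunc_exp (2 * N - 1) (X * Y) -
     2 ^ N * fact N / fact (2 * N) * X ^ (2 * N) * trunc_exp (N - 1) (Y\<^sup>2 / 2)) (at X)"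
proof -
  have "((\<lambda>X. X ^ (2 * i + 1) * trunc_exp i (Y\<^sup>2 / 2) - trunc_exp i (X\<^sup>2 / 2) * Y ^ (2 * i + 1)) has_field_derivative
      of_nat (2 * i + 1) * X ^ (2 * i) * trunc_exp i (Y\<^sup>2 / 2) -
      (trunc_exp i (X\<^sup>2 / 2) - (X\<^sup>2 / 2) ^ i / fact i) * X * Y ^ (2 * i + 1)) (at X)" for i
  proof -
    have sq: "((\<lambda>X::complex. X\<^sup>2 / 2) has_field_derivative X) (at X)"
      by (auto intro!: derivative_eq_intros)
    have "((\<lambda>X. X ^ (2 * i + 1)) has_field_derivative of_nat (2 * i + 1) * X ^ (2 * i)) (at X)"
      using DERIV_power [OF DERIV_ident, of "2 * i + 1" X UNIV] by simp
    then show ?thesis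
      by (intro DERIV_diff DERIV_cmult_right DERIV_chain2 [OF trunc_exp_has_field_derivative sq])
  qed
  then have "((\<lambda>X. edge_sum N X Y) has_field_derivative
      X * edge_sum N X Y + (\<Sum>l<2 * N. (X * Y) ^ l / fact l) -
     2 ^ N * fact N / fact (2 * N) * X ^ (2 * N) * (\<Sum>l<N. (Y\<^sup>2 / 2) ^ l / fact l)) (at X)"
    unfolding edge_sum_derivative_identity [symmetric]
    unfolding edge_sum_def by (intro DERIV_sum DERIV_cmult)
  moreover have "{..<2 * N} = {..2 * N - 1}" "{..<N} = {..N - 1}" using assms by auto
  ultimately show ?thesis
    by (simp only: trunc_exp_def)
qed

text \<open>\<open>edge_point N z / sqrt N\<close> is the unscaled point
  \<open>sqrt 2 + micro_scale N * z\<close>. The factor \<open>sqrt N\<close> makes the Gaussian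
  weight independent of \<open>N\<close>.\<close>

definition edge_point :: "nat \<Rightarrow> complex \<Rightarrow> complex" where
  "edge_point N z = of_real (sqrt 2) * (of_real (sqrt N) + z)"

text \<open>The exponential is the integrating factor that cancels \<open>X * edge_sum\<close> in
  the derivative of \<open>edge_sum\<close>.\<close>

definition edge_kernel :: "nat \<Rightarrow> complex \<Rightarrow> complex \<Rightarrow> complex" where
  "edge_kernel N z w = of_real (sqrt 2) * exp (- ((edge_point N z)\<^sup>2 + (edge_point N w)\<^sup>2) / 2) *
     edge_sum N (edge_point N z) (edge_point N w)"

text \<open>What telescoping leaves over, with the half of the Gaussian factor that belongs to
  \<open>z\<close>.\<close>

definition central_term :: "nat \<Rightarrow> complex \<Rightarrow> complex" where
  "central_term N z = 2 ^ N * fact N / fact (2 * N) * edge_point N z ^ (2 * N) * exp (- (edge_point N z)\<^sup>2 / 2)"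

definition edge_kernel_deriv :: "nat \<Rightarrow> complex \<Rightarrow> complex \<Rightarrow> complex" where
  "edge_kernel_deriv N z w = 2 * (exp (- (z - w)\<^sup>2) *
      (exp (- (edge_point N z * edge_point N w)) * trunc_exp (2 * N - 1) (edge_point N z * edge_point N w)) -
     central_term N z * (exp (- ((edge_point N w)\<^sup>2 / 2)) * trunc_exp (N - 1) ((edge_point N w)\<^sup>2 / 2)))"

definition edge_kernel_deriv_limit :: "complex \<Rightarrow> complex \<Rightarrow> complex" where
  "edge_kernel_deriv_limit z w = exp (- (z - w)\<^sup>2) * erfc (z + w) -
     1 / of_real (sqrt 2) * exp (- 2 * z\<^sup>2) * erfc (of_real (sqrt 2) * w)"

lemma edge_kernel_diag: "edge_kernel N w w = 0"
  by (simp add: edge_kernel_def edge_sum_diag)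

lemma sqrt2_sqrt2: "complex_of_real (sqrt 2) * complex_of_real (sqrt 2) = 2"
  by (simp flip: of_real_mult)

lemma edge_kernel_has_field_derivative:
  assumes "N \<ge> 1"
  shows "((\<lambda>z. edge_kernel N z w) has_field_derivative edge_kernel_deriv N z w) (at z)"
proof -
  define r where "r = complex_of_real (sqrt 2)"
  define X Y where "X = edge_point N z" and "Y = edge_point N w"
  define G where "G = edge_sum N X Y"
  define A where "A = trunc_exp (2 * N - 1) (X * Y)"
  define C where "C = 2 ^ N * fact N / fact (2 * N) * X ^ (2 * N) * trunc_exp (N - 1) (Y\<^sup>2 / 2)"
  define E where "E = exp (- (X\<^sup>2 + Y\<^sup>2) / 2)"
  have rr: "r * r = 2" unfolding r_def by (rule sqrt2_sqrt2)
  have dX: "(edge_point N has_field_derivative r) (at z)"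
    unfolding edge_point_def [abs_def] r_def by (auto intro!: derivative_eq_intros)
  have dE: "((\<lambda>z. exp (- ((edge_point N z)\<^sup>2 + Y\<^sup>2) / 2)) has_field_derivative E * (- (X * r))) (at z)"
    unfolding E_def X_def by (auto intro!: derivative_eq_intros dX)
  have dG: "((\<lambda>z. edge_sum N (edge_point N z) Y) has_field_derivative (X * G + A - C) * r) (at z)"
    unfolding G_def A_def C_def
    by (rule DERIV_chain2 [OF _ dX]) (simp only: X_def edge_sum_has_field_derivative [OF assms])
  have "((\<lambda>z. edge_kernel N z w) has_field_derivative
      r * (E * (- (X * r)) * G + (X * G + A - C) * r * E)) (at z)"
  proof -
    have "((\<lambda>z. r * (exp (- ((edge_point N z)\<^sup>2 + Y\<^sup>2) / 2) * edge_sum N (edge_point N z) Y)) has_field_derivative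
        r * (E * (- (X * r)) * G + (X * G + A - C) * r * E)) (at z)"
      using DERIV_cmult [OF DERIV_mult [OF dE dG], of r] unfolding G_def [symmetric] X_def [symmetric] E_def [symmetric]
      by (simp add: X_def G_def E_def)
    then show ?thesis unfolding edge_kernel_def r_def Y_def by (simp only: mult.assoc)
  qed
  also have "r * (E * (- (X * r)) * G + (X * G + A - C) * r * E) = (r * r) * (E * A - E * C)"
    by (simp add: algebra_simps)
  also have "\<dots> = edge_kernel_deriv N z w"
  proof -
    have "(X - Y)\<^sup>2 = 2 * (z - w)\<^sup>2"
      unfolding X_def Y_def edge_point_def rr [symmetric] r_def by (simp add: power2_eq_square algebra_simps)
    moreover have "X\<^sup>2 + Y\<^sup>2 = (X - Y)\<^sup>2 + 2 * (X * Y)"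
      by (simp add: power2_eq_square algebra_simps)
    ultimately have "- (X\<^sup>2 + Y\<^sup>2) / 2 = - (z - w)\<^sup>2 + - (X * Y)"
      by (simp add: add_divide_distrib diff_divide_distrib)
    then have 1: "E = exp (- (z - w)\<^sup>2) * exp (- (X * Y))" unfolding E_def by (simp only: exp_add)
    have 2: "E = exp (- X\<^sup>2 / 2) * exp (- (Y\<^sup>2 / 2))"
      unfolding E_def mult_exp_exp by (simp add: add_divide_distrib diff_divide_distrib)
    have "E * A = exp (- (z - w)\<^sup>2) * (exp (- (X * Y)) * A)" unfolding 1 by simp
    moreover have "E * C = central_term N z * (exp (- (Y\<^sup>2 / 2)) * trunc_exp (N - 1) (Y\<^sup>2 / 2))"
      unfolding 2 C_def central_term_def X_def by (simp only: mult_ac)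
    ultimately show ?thesis
      unfolding edge_kernel_deriv_def rr A_def X_def Y_def by simp
  qed
  finally show ?thesis .
qed

text \<open>From \<open>X\<^sup>2 = 2 * N * (1 + z / sqrt N)\<^sup>2\<close> the power and the
  exponential combine to the square of a Laplace factor, apart from
  \<open>exp (- z\<^sup>2)\<close>, which the quadratic part of the exponent contributes. The
  factorials form a quotient of Stirling ratios.\<close>

lemma central_term_eq:
  assumes N: "N \<ge> 1"
  shows "central_term N z = of_real (stirling_ratio (2 * N) / (sqrt 2 * stirling_ratio N)) *
    (laplace_factor N (z / of_real (sqrt 2)))\<^sup>2 * exp (- z\<^sup>2)"
proof -
  define h where "h = z / complex_of_real (sqrt N)"
  have sN: "complex_of_real (sqrt N) \<noteq> 0" "complex_of_real (sqrt N) * complex_of_real (sqrt N) = of_nat N"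
    using N by (simp_all flip: of_real_mult)
  have lf: "laplace_factor N (z / of_real (sqrt 2)) = ((1 + h) * exp (- h)) ^ N"
  proof -
    have "z / of_real (sqrt 2) * complex_of_real (sqrt (2 / N)) = h"
      by (simp add: h_def real_sqrt_divide)
    then show ?thesis unfolding laplace_factor_def by (simp add: minus_mult_left [symmetric] del: of_real_divide)
  qed
  have X: "(edge_point N z)\<^sup>2 = of_nat (2 * N) * (1 + h)\<^sup>2"
  proof -
    have "edge_point N z = of_real (sqrt 2) * of_real (sqrt N) * (1 + h)"
      using sN(1) by (simp add: edge_point_def h_def algebra_simps)
    then have "(edge_point N z)\<^sup>2 = (of_real (sqrt 2) * of_real (sqrt 2)) * (of_real (sqrt N) * of_real (sqrt N)) * (1 + h)\<^sup>2"
      by (simp only: power2_eq_square mult_ac)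
    then show ?thesis unfolding sqrt2_sqrt2 sN(2) by simp
  qed
  have Nh: "of_nat N * h\<^sup>2 = z\<^sup>2" unfolding h_def power_divide using sN by (simp add: power2_eq_square)
  have "- (2 * n * (1 + h)\<^sup>2) / 2 = - n + (n * (- h) + n * (- h)) + - (n * h\<^sup>2)" for n
  proof -
    have "- (2 * n * (1 + h)\<^sup>2) / 2 = - (n * (1 + h)\<^sup>2)" by simp
    then show ?thesis by (simp add: power2_eq_square algebra_simps)
  qed
  from this [of "of_nat N"]
  have "- (edge_point N z)\<^sup>2 / 2 = - of_nat N + (of_nat N * (- h) + of_nat N * (- h)) + - z\<^sup>2"
    unfolding X Nh of_nat_mult of_nat_numeral .
  then have e: "exp (- (edge_point N z)\<^sup>2 / 2) = of_real (exp (- real N)) * (exp (- h) ^ N)\<^sup>2 * exp (- z\<^sup>2)"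
    by (simp only: exp_add exp_of_nat_mult power2_eq_square) (simp add: exp_of_real [symmetric])
  have p: "edge_point N z ^ (2 * N) = of_nat (2 * N) ^ N * ((1 + h) ^ N)\<^sup>2"
    unfolding power_mult X power_mult_distrib by (simp only: power_mult [symmetric] mult.commute)
  have c: "2 ^ N * fact N / fact (2 * N) * real (2 * N) ^ N * exp (- real N) =
      stirling_ratio (2 * N) / (sqrt 2 * stirling_ratio N)"
  proof -
    have gen: "t * F / D * u * e = (r * s * (u * (t * v)) * (e * e) / D) / (r * (s * v * e / F))"
      if "r \<noteq> 0" "s \<noteq> 0" "v \<noteq> 0" "e \<noteq> 0" "F \<noteq> 0" "D \<noteq> 0" for t F D u e r s v :: real
      using that by (simp add: divide_simps)
    have "sqrt (2 * real (2 * N)) = sqrt 2 * sqrt (2 * real N)"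
      unfolding of_nat_mult of_nat_numeral by (rule real_sqrt_mult)
    moreover have "exp (- real (2 * N)) = exp (- real N) * exp (- real N)" by (simp add: mult_exp_exp)
    moreover have "x ^ (2 * N) = x ^ N * x ^ N" for x :: real by (simp only: mult_2 power_add)
    moreover have "real (2 * N) ^ N = 2 ^ N * real N ^ N" by (simp add: power_mult_distrib)
    ultimately have "stirling_ratio (2 * N) = sqrt 2 * sqrt (2 * real N) * (real (2 * N) ^ N * (2 ^ N * real N ^ N)) *
        (exp (- real N) * exp (- real N)) / fact (2 * N)"
      unfolding stirling_ratio_def of_nat_mult [of 2 "2 * N"] of_nat_numeral by metis
    then show ?thesis
      unfolding stirling_ratio_def [of N] of_nat_mult [of 2 N] of_nat_numeral
      by (simp only:) (rule gen; use N in simp)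
  qed
  have "central_term N z = of_real (2 ^ N * fact N / fact (2 * N) * real (2 * N) ^ N * exp (- real N)) *
      (((1 + h) * exp (- h)) ^ N)\<^sup>2 * exp (- z\<^sup>2)"
    unfolding central_term_def e p by (simp add: power_mult_distrib)
  then show ?thesis unfolding c lf .
qed

text \<open>The degrees \<open>2 * N - 1\<close> and \<open>N - 1\<close> are one below the leading
  terms \<open>2 * N\<close> and \<open>N\<close> of the arguments. This 1 and the bounded products
  are small against the scale \<open>\<rho>\<close> and go into the moving position, which tends to
  \<open>z0 + w0\<close> in the mixed term and to \<open>sqrt 2 * w0\<close> in the other.\<close>

lemma tendsto_edge_kernel_deriv:
  assumes z: "z \<longlonglongrightarrow> z0" and w: "w \<longlonglongrightarrow> w0"
  shows "(\<lambda>N. edge_kernel_deriv N (z N) (w N)) \<longlonglongrightarrow> edge_kernel_deriv_limit z0 w0"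
proof -
  have pp: "edge_point N a * edge_point N b =
      of_nat (2 * N) + 2 * of_real (sqrt N) * (a + b) + 2 * a * b" for N a b
  proof -
    have "edge_point N a * edge_point N b = (of_real (sqrt 2) * of_real (sqrt 2)) *
        (of_real (sqrt N) * of_real (sqrt N) + of_real (sqrt N) * (a + b) + a * b)"
      unfolding edge_point_def by (simp add: algebra_simps)
    moreover have "complex_of_real (sqrt N) * of_real (sqrt N) = of_nat N" by (simp flip: of_real_mult)
    ultimately show ?thesis unfolding sqrt2_sqrt2 by (simp add: algebra_simps)
  qed
  have 1: "(\<lambda>N. exp (- (edge_point N (z N) * edge_point N (w N))) *
      trunc_exp (2 * N - 1) (edge_point N (z N) * edge_point N (w N))) \<longlonglongrightarrow> erfc (z0 + w0) / 2"
  proof (rule tendsto_exp_trunc_exp)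
    show "filterlim (\<lambda>N::nat. 2 * N - 1) at_top sequentially" by real_asymp
    define \<rho> where "\<rho> N = sqrt (2 * real (2 * N - 1))" for N :: nat
    have l1: "(\<lambda>N. 1 / \<rho> N) \<longlonglongrightarrow> 0" "(\<lambda>N. 2 * sqrt N / \<rho> N) \<longlonglongrightarrow> 1" unfolding \<rho>_def by real_asymp+
    show "(\<lambda>N. of_real (1 / \<rho> N) * (1 + 2 * z N * w N) + of_real (2 * sqrt N / \<rho> N) * (z N + w N))
        \<longlonglongrightarrow> z0 + w0"
      using tendsto_add [OF tendsto_mult [OF tendsto_of_real [OF l1(1)]
            tendsto_add [OF tendsto_const [of 1] tendsto_mult [OF tendsto_mult [OF tendsto_const [of 2] z] w]]]
          tendsto_mult [OF tendsto_of_real [OF l1(2)] tendsto_add [OF z w]]]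
      by simp
    show "\<forall>\<^sub>F N in sequentially. edge_point N (z N) * edge_point N (w N) = of_nat (2 * N - 1) +
        of_real (sqrt (2 * real (2 * N - 1))) *
        (of_real (1 / \<rho> N) * (1 + 2 * z N * w N) + of_real (2 * sqrt N / \<rho> N) * (z N + w N))"
      using eventually_ge_at_top [of 1]
    proof eventually_elim
      case (elim N)
      then have "complex_of_real (\<rho> N) \<noteq> 0" by (simp add: \<rho>_def)
      moreover have "(of_nat (2 * N) :: complex) = of_nat (2 * N - 1) + 1"
        using elim by (metis Suc_diff_le Suc_eq_plus1 diff_Suc_1 mult_2 of_nat_1 of_nat_add trans_le_add1)
      ultimately show ?case
        unfolding pp \<rho>_def [symmetric] by (simp add: field_simps)
    qed
  qed
  have 2: "(\<lambda>N. exp (- ((edge_point N (w N))\<^sup>2 / 2)) * trunc_exp (N - 1) ((edge_point N (w N))\<^sup>2 / 2))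
      \<longlonglongrightarrow> erfc (of_real (sqrt 2) * w0) / 2"
  proof (rule tendsto_exp_trunc_exp)
    show "filterlim (\<lambda>N::nat. N - 1) at_top sequentially" by real_asymp
    define \<rho> where "\<rho> N = sqrt (2 * real (N - 1))" for N :: nat
    have "2 * inverse (2 powr (1 / 2)) = sqrt (2::real)"
      by (simp add: powr_half_sqrt real_div_sqrt divide_inverse [symmetric])
    moreover have "(\<lambda>N. 1 / \<rho> N) \<longlonglongrightarrow> 0" "(\<lambda>N. 2 * sqrt N / \<rho> N) \<longlonglongrightarrow> 2 * inverse (2 powr (1 / 2))"
      unfolding \<rho>_def by real_asymp+
    ultimately have l1: "(\<lambda>N. 1 / \<rho> N) \<longlonglongrightarrow> 0" "(\<lambda>N. 2 * sqrt N / \<rho> N) \<longlonglongrightarrow> sqrt 2" by simp_all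
    show "(\<lambda>N. of_real (1 / \<rho> N) * (1 + (w N)\<^sup>2) + of_real (2 * sqrt N / \<rho> N) * w N)
        \<longlonglongrightarrow> of_real (sqrt 2) * w0"
      using tendsto_add [OF tendsto_mult [OF tendsto_of_real [OF l1(1)]
            tendsto_add [OF tendsto_const [of 1] tendsto_power [OF w, of 2]]]
          tendsto_mult [OF tendsto_of_real [OF l1(2)] w]]
      by simp
    show "\<forall>\<^sub>F N in sequentially. (edge_point N (w N))\<^sup>2 / 2 = of_nat (N - 1) +
        of_real (sqrt (2 * real (N - 1))) *
        (of_real (1 / \<rho> N) * (1 + (w N)\<^sup>2) + of_real (2 * sqrt N / \<rho> N) * w N)"
      using eventually_ge_at_top [of 2]
    proof eventually_elim
      case (elim N)
      then have "complex_of_real (\<rho> N) \<noteq> 0" by (simp add: \<rho>_def)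
      moreover have "(of_nat N :: complex) = of_nat (N - 1) + 1" using elim by (simp add: of_nat_diff)
      ultimately show ?case
        unfolding power2_eq_square [of "edge_point N (w N)"] pp \<rho>_def [symmetric]
        by (simp add: field_simps power2_eq_square)
    qed
  qed
  have 3: "(\<lambda>N. central_term N (z N)) \<longlonglongrightarrow> 1 / of_real (sqrt 2) * exp (- 2 * z0\<^sup>2)"
  proof (rule Lim_transform_eventually)
    have "filterlim (\<lambda>N::nat. 2 * N) at_top sequentially" by real_asymp
    from filterlim_compose [OF tendsto_stirling_ratio this]
    have "(\<lambda>N. stirling_ratio (2 * N) / (sqrt 2 * stirling_ratio N)) \<longlonglongrightarrow> (1 / sqrt pi) / (sqrt 2 * (1 / sqrt pi))"
      by (intro tendsto_intros tendsto_stirling_ratio) simp_all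
    then have quot: "(\<lambda>N. stirling_ratio (2 * N) / (sqrt 2 * stirling_ratio N)) \<longlonglongrightarrow> 1 / sqrt 2" by simp
    have lf: "(\<lambda>N. laplace_factor N (z N / of_real (sqrt 2))) \<longlonglongrightarrow> exp (- (z0 / of_real (sqrt 2))\<^sup>2)"
      by (intro tendsto_laplace_factor [OF filterlim_ident] tendsto_divide z tendsto_const) simp
    have "(\<lambda>N. of_real (stirling_ratio (2 * N) / (sqrt 2 * stirling_ratio N)) *
        (laplace_factor N (z N / of_real (sqrt 2)))\<^sup>2 * exp (- (z N)\<^sup>2)) \<longlonglongrightarrow>
        of_real (1 / sqrt 2) * (exp (- (z0 / of_real (sqrt 2))\<^sup>2))\<^sup>2 * exp (- z0\<^sup>2)"
      by (intro tendsto_mult tendsto_power lf tendsto_of_real quot tendsto_exp tendsto_minus z)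
    also have "of_real (1 / sqrt 2) * (exp (- (z0 / of_real (sqrt 2))\<^sup>2))\<^sup>2 * exp (- z0\<^sup>2) =
        1 / of_real (sqrt 2) * exp (- 2 * z0\<^sup>2)"
    proof -
      have s1: "(z0 / of_real (sqrt 2))\<^sup>2 = z0\<^sup>2 / 2" using sqrt2_sqrt2 by (simp add: power2_eq_square)
      have s2: "(exp (- (z0\<^sup>2 / 2)))\<^sup>2 = exp (- z0\<^sup>2)" by (simp add: power2_eq_square mult_exp_exp)
      have s3: "exp (- z0\<^sup>2) * exp (- z0\<^sup>2) = exp (- 2 * z0\<^sup>2)" unfolding mult_exp_exp by simp
      show ?thesis unfolding s1 mult.assoc s2 s3 by simp
    qed
    finally show "(\<lambda>N. of_real (stirling_ratio (2 * N) / (sqrt 2 * stirling_ratio N)) *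
        (laplace_factor N (z N / of_real (sqrt 2)))\<^sup>2 * exp (- (z N)\<^sup>2)) \<longlonglongrightarrow>
        1 / of_real (sqrt 2) * exp (- 2 * z0\<^sup>2)" .
    show "\<forall>\<^sub>F N in sequentially. of_real (stirling_ratio (2 * N) / (sqrt 2 * stirling_ratio N)) *
        (laplace_factor N (z N / of_real (sqrt 2)))\<^sup>2 * exp (- (z N)\<^sup>2) = central_term N (z N)"
      using eventually_ge_at_top [of 1] by eventually_elim (simp only: central_term_eq)
  qed
  have "(\<lambda>N. edge_kernel_deriv N (z N) (w N)) \<longlonglongrightarrow>
      2 * (exp (- (z0 - w0)\<^sup>2) * (erfc (z0 + w0) / 2) -
        1 / of_real (sqrt 2) * exp (- 2 * z0\<^sup>2) * (erfc (of_real (sqrt 2) * w0) / 2))"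
    unfolding edge_kernel_deriv_def by (intro tendsto_intros 1 2 3 z w)
  then show ?thesis unfolding edge_kernel_deriv_limit_def by (simp add: algebra_simps)
qed

section \<open>Convergence of the kernel\<close>

lemma uniform_limit_compactI:
  fixes f :: "nat \<Rightarrow> 'a::metric_space \<Rightarrow> 'b::metric_space"
  assumes K: "compact K" and g: "continuous_on K g"
    and seq: "\<And>x x0. (\<And>n. x n \<in> K) \<Longrightarrow> x \<longlonglongrightarrow> x0 \<Longrightarrow> (\<lambda>n. f n (x n)) \<longlonglongrightarrow> g x0"
  shows "uniform_limit K f g sequentially"
proof (rule ccontr)
  assume "\<not> ?thesis"
  then obtain \<epsilon> where \<epsilon>: "\<epsilon> > 0" "\<not> (\<forall>\<^sub>F n in sequentially. \<forall>x\<in>K. dist (f n x) (g x) < \<epsilon>)"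
    unfolding uniform_limit_iff by blast
  have "\<exists>n\<ge>m. \<exists>x\<in>K. dist (f n x) (g x) \<ge> \<epsilon>" for m
    using \<epsilon>(2) unfolding eventually_sequentially by (meson not_less)
  then have inf: "infinite {n. \<exists>x\<in>K. dist (f n x) (g x) \<ge> \<epsilon>}"
    unfolding infinite_nat_iff_unbounded_le by blast
  define s where "s = enumerate {n. \<exists>x\<in>K. dist (f n x) (g x) \<ge> \<epsilon>}"
  have s: "strict_mono s" unfolding s_def by (rule strict_mono_enumerate [OF inf])
  have "\<forall>m. \<exists>x. x \<in> K \<and> dist (f (s m) x) (g x) \<ge> \<epsilon>"
    using enumerate_in_set [OF inf] unfolding s_def by blast
  then obtain y where y: "\<And>m. y m \<in> K" "\<And>m. dist (f (s m) (y m)) (g (y m)) \<ge> \<epsilon>" by metis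
  obtain x0 r where r: "x0 \<in> K" "strict_mono r" "(y \<circ> r) \<longlonglongrightarrow> x0"
    using K y(1) unfolding compact_def by metis
  define t where "t = s \<circ> r"
  have t: "strict_mono t" unfolding t_def by (rule strict_mono_o [OF s r(2)])
  define x where "x n = (if n \<in> range t then y (r (inv_into UNIV t n)) else x0)" for n
  have xt: "x (t m) = y (r m)" for m
    unfolding x_def using inv_into_f_f [OF strict_mono_imp_inj_on [OF t]] by simp
  have "x \<longlonglongrightarrow> x0"
  proof (rule metric_LIMSEQ_I)
    fix e :: real assume "e > 0"
    then obtain m0 where m0: "\<And>m. m \<ge> m0 \<Longrightarrow> dist (y (r m)) x0 < e"
      using metric_LIMSEQ_D [OF r(3)] by (auto simp: o_def)
    have "dist (x n) x0 < e" if "n \<ge> t m0" for n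
    proof (cases "n \<in> range t")
      case True
      then obtain m where m: "n = t m" by blast
      then have "m \<ge> m0" using that strict_mono_less_eq [OF t] by simp
      then show ?thesis using m0 by (simp add: m xt)
    qed (simp add: x_def \<open>e > 0\<close>)
    then show "\<exists>no. \<forall>n\<ge>no. dist (x n) x0 < e" by blast
  qed
  moreover have "x n \<in> K" for n using r(1) y(1) by (simp add: x_def)
  ultimately have "(\<lambda>n. f n (x n)) \<longlonglongrightarrow> g x0" by (intro seq) auto
  from LIMSEQ_subseq_LIMSEQ [OF this t] have "(\<lambda>m. f (t m) (y (r m))) \<longlonglongrightarrow> g x0"
    by (simp add: o_def xt)
  moreover have "(\<lambda>m. g (y (r m))) \<longlonglongrightarrow> g x0"
    using continuous_on_tendsto_compose [OF g r(3) r(1)] y(1) by (simp add: o_def)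
  ultimately have "(\<lambda>m. dist (f (t m) (y (r m))) (g (y (r m)))) \<longlonglongrightarrow> dist (g x0) (g x0)"
    by (intro tendsto_dist)
  from order_tendstoD(2) [OF this, of \<epsilon>] \<epsilon>(1)
  have "\<forall>\<^sub>F m in sequentially. dist (f (t m) (y (r m))) (g (y (r m))) < \<epsilon>" by simp
  then obtain m where "dist (f (t m) (y (r m))) (g (y (r m))) < \<epsilon>"
    using eventually_happens' [OF sequentially_bot] by blast
  then show False using y(2) [of "r m"] by (simp add: t_def)
qed

lemma continuous_on_erfc [continuous_intros]:
  assumes "continuous_on S f"
  shows "continuous_on S (\<lambda>x. erfc (f x))"
proof -
  have "(erfc has_field_derivative - 2 / of_real (sqrt pi) * exp (- z\<^sup>2)) (at z)" for z
    using erfc_has_field_derivative [of "\<lambda>z. z" 1 z UNIV] by simp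
  then have "continuous_on UNIV erfc"
    by (intro continuous_at_imp_continuous_on ballI) (rule DERIV_isCont)
  then show ?thesis by (rule continuous_on_compose2 [OF _ assms]) simp
qed

lemma uniform_limit_edge_kernel_deriv:
  "uniform_limit (cball 0 B \<times> cball 0 B) (\<lambda>N (z, w). edge_kernel_deriv N z w)
    (\<lambda>(z, w). edge_kernel_deriv_limit z w) sequentially"
proof (rule uniform_limit_compactI)
  show "compact (cball 0 B \<times> cball (0::complex) B :: (complex \<times> complex) set)"
    by (intro compact_Times compact_cball)
  show "continuous_on (cball 0 B \<times> cball 0 B) (\<lambda>(z, w). edge_kernel_deriv_limit z w)"
    unfolding edge_kernel_deriv_limit_def case_prod_unfold by (intro continuous_intros) simp_all
next
  fix x :: "nat \<Rightarrow> complex \<times> complex" and x0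
  assume x: "x \<longlonglongrightarrow> x0"
  show "(\<lambda>n. case x n of (z, w) \<Rightarrow> edge_kernel_deriv n z w) \<longlonglongrightarrow>
      (case x0 of (z, w) \<Rightarrow> edge_kernel_deriv_limit z w)"
    using tendsto_edge_kernel_deriv [OF tendsto_fst [OF x] tendsto_snd [OF x]] by (simp add: case_prod_unfold)
qed

text \<open>The \<open>u\<close>-derivative of \<open>f_edge z\<close>, and minus its
  \<open>z\<close>-derivative, because \<open>f_edge\<close> depends on \<open>z - u\<close>
  only.\<close>

definition edge_density :: "complex \<Rightarrow> real \<Rightarrow> complex" where
  "edge_density z u = of_real (sqrt 2 / sqrt pi) * exp (- 2 * (z - of_real u)\<^sup>2)"

lemma sqrt2_mult_square: "(of_real (sqrt 2) * a)\<^sup>2 = 2 * a\<^sup>2" for a :: complex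
  using sqrt2_sqrt2 by (simp add: power2_eq_square mult_ac)

lemma f_edge_has_vector_derivative:
  "(f_edge z has_vector_derivative edge_density z u) (at u within S)"
proof -
  have "((\<lambda>\<zeta>. 1 / 2 * erfc (of_real (sqrt 2) * (z - \<zeta>))) has_field_derivative edge_density z u) (at (of_real u))"
    by (auto intro!: derivative_eq_intros simp: edge_density_def sqrt2_mult_square)
  from has_vector_derivative_real_field [OF this] show ?thesis by (simp add: f_edge_def [abs_def])
qed

lemma Wronskian_f_edge:
  "Wronskian (f_edge w) (f_edge z) u = f_edge w u * edge_density z u - edge_density w u * f_edge z u"
  unfolding Wronskian_def
  by (simp add: vector_derivative_at [OF f_edge_has_vector_derivative])

lemma Wronskian_f_edge_has_field_derivative:
  "((\<lambda>z. Wronskian (f_edge w) (f_edge z) u) has_field_derivative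
     f_edge w u * (edge_density z u * (- 4 * (z - of_real u))) + edge_density w u * edge_density z u) (at z within S)"
proof -
  have 1: "((\<lambda>z. edge_density z u) has_field_derivative edge_density z u * (- 4 * (z - of_real u))) (at z within S)"
    unfolding edge_density_def by (auto intro!: derivative_eq_intros)
  have 2: "((\<lambda>z. f_edge z u) has_field_derivative - edge_density z u) (at z within S)"
    unfolding f_edge_def edge_density_def
    by (auto intro!: derivative_eq_intros simp: sqrt2_mult_square)
  show ?thesis
    unfolding Wronskian_f_edge
    using DERIV_diff [OF DERIV_cmult [OF 1, of "f_edge w u"] DERIV_cmult [OF 2, of "edge_density w u"]] by simp
qed

text \<open>With \<open>f = f_edge w\<close>, \<open>g = edge_density z\<close> and \<open>h = edge_density w\<close>, the \<open>z\<close>-derivative of the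
  Wronskian is \<open>- (f * g)' + 2 * h * g\<close>, where \<open>h * g\<close> is a Gaussian in \<open>u\<close>.\<close>

definition edge_antideriv :: "complex \<Rightarrow> complex \<Rightarrow> real \<Rightarrow> complex" where
  "edge_antideriv z w u = - f_edge w u * edge_density z u +
     1 / of_real (sqrt pi) * exp (- (z - w)\<^sup>2) * erfc (z + w - 2 * of_real u)"

text \<open>The two Gaussians combine by \<open>2 * a\<^sup>2 + 2 * b\<^sup>2 = (a - b)\<^sup>2 + (a
  + b)\<^sup>2\<close> with \<open>a = w - u\<close> and \<open>b = z - u\<close>, and only the
  second square contains \<open>u\<close>.\<close>

lemma edge_antideriv_has_vector_derivative:
  "(edge_antideriv z w has_vector_derivative
     f_edge w u * (edge_density z u * (- 4 * (z - of_real u))) + edge_density w u * edge_density z u) (at u within S)"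
proof -
  have 1: "((\<lambda>u. edge_density z u) has_vector_derivative edge_density z u * (4 * (z - of_real u))) (at u within S)"
  proof -
    have "((\<lambda>\<zeta>. of_real (sqrt 2 / sqrt pi) * exp (- 2 * (z - \<zeta>)\<^sup>2)) has_field_derivative
        edge_density z u * (4 * (z - of_real u))) (at (of_real u))"
      unfolding edge_density_def by (auto intro!: derivative_eq_intros)
    from has_vector_derivative_real_field [OF this] show ?thesis by (simp add: edge_density_def [abs_def])
  qed
  have 2: "((\<lambda>u. 1 / of_real (sqrt pi) * exp (- (z - w)\<^sup>2) * erfc (z + w - 2 * of_real u)) has_vector_derivative
      2 * (edge_density w u * edge_density z u)) (at u within S)"
  proof -
    define r where "r = complex_of_real (sqrt pi)"
    have r: "r \<noteq> 0" by (simp add: r_def)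
    have "((\<lambda>\<zeta>. 1 / r * exp (- (z - w)\<^sup>2) * erfc (z + w - 2 * \<zeta>)) has_field_derivative
        1 / r * exp (- (z - w)\<^sup>2) * ((- 2 / r * exp (- (z + w - 2 * of_real u)\<^sup>2)) * (- 2))) (at (of_real u))"
      unfolding r_def
      by (intro DERIV_cmult erfc_has_field_derivative) (auto intro!: derivative_eq_intros)
    also have "1 / r * exp (- (z - w)\<^sup>2) * ((- 2 / r * exp (- (z + w - 2 * of_real u)\<^sup>2)) * (- 2)) =
        4 / (r * r) * (exp (- (z - w)\<^sup>2) * exp (- (z + w - 2 * of_real u)\<^sup>2))"
      using r by (simp add: field_simps)
    also have "exp (- (z - w)\<^sup>2) * exp (- (z + w - 2 * of_real u)\<^sup>2) =
        exp (- 2 * (w - of_real u)\<^sup>2) * exp (- 2 * (z - of_real u)\<^sup>2)"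
      unfolding mult_exp_exp by (intro arg_cong [where f = exp]) (simp add: power2_eq_square algebra_simps)
    also have "4 / (r * r) * \<dots> = 2 * (edge_density w u * edge_density z u)"
    proof -
      have "edge_density w u * edge_density z u = (of_real (sqrt 2) * of_real (sqrt 2)) / (r * r) *
          (exp (- 2 * (w - of_real u)\<^sup>2) * exp (- 2 * (z - of_real u)\<^sup>2))"
        unfolding edge_density_def r_def by simp
      then show ?thesis unfolding sqrt2_sqrt2 by simp
    qed
    finally show ?thesis unfolding r_def by (rule has_vector_derivative_real_field)
  qed
  have "((\<lambda>u. f_edge w u * edge_density z u) has_vector_derivative
      f_edge w u * (edge_density z u * (4 * (z - of_real u))) + edge_density w u * edge_density z u) (at u within S)"
    by (rule has_vector_derivative_mult [OF f_edge_has_vector_derivative 1])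
  from has_vector_derivative_add [OF has_vector_derivative_minus [OF this] 2]
  show ?thesis unfolding edge_antideriv_def [abs_def] by (simp add: algebra_simps)
qed

text \<open>The upper end of the integral reproduces the limit of the finite derivatives: here the
  two sides of the convergence meet.\<close>

lemma edge_antideriv_0:
  "of_real (sqrt pi) * edge_antideriv z w 0 = edge_kernel_deriv_limit z w"
proof -
  have const: "of_real (sqrt pi) * (of_real (sqrt 2 / sqrt pi) / 2) = 1 / complex_of_real (sqrt 2)"
    using sqrt2_sqrt2 by (simp add: field_simps)
  have gen: "r * (- (1 / 2 * e) * (k * x) + 1 / r * d * f) = d * f - (r * (k / 2)) * x * e"
    if "r \<noteq> 0" for r e k x d f :: complex
    using that by (simp add: field_simps)
  have "complex_of_real (sqrt pi) \<noteq> 0" by simp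
  from gen [OF this] show ?thesis
    unfolding edge_antideriv_def edge_kernel_deriv_limit_def f_edge_def edge_density_def
    by (simp only: of_real_0 diff_zero mult_zero_right const)
qed

lemma norm_sqrt_two_div_pi: "norm (complex_of_real (sqrt 2 / sqrt pi)) = sqrt 2 / sqrt pi"
  unfolding norm_of_real by simp

text \<open>The contribution of the cut-off end, which vanishes as \<open>T\<close> grows, uniformly
  in \<open>z\<close> and \<open>w\<close>. There \<open>f_edge\<close> is merely bounded, while the
  density and the \<open>erfc\<close> at a far right argument decay like Gaussians.\<close>

lemma norm_edge_antideriv_le:
  assumes z: "norm z \<le> B" and w: "norm w \<le> B" and T: "B \<le> T"
  shows "norm (edge_antideriv z w (- T)) \<le>
    2 * exp (4 * B\<^sup>2 - 2 * (T - B)\<^sup>2) + 2 * exp (8 * B\<^sup>2 - 4 * (T - B)\<^sup>2)"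
proof -
  have B: "B \<ge> 0" using z norm_ge_zero order_trans by blast
  have im: "(Im a)\<^sup>2 \<le> b\<^sup>2" if "norm a \<le> b" for a b
    using power_mono [of "\<bar>Im a\<bar>" b 2] abs_Im_le_cmod [of a] that by simp
  have re: "(Re (a + of_real t))\<^sup>2 \<ge> (t - b)\<^sup>2" "Re (a + of_real t) \<ge> 0" if "norm a \<le> b" "b \<le> t" for a b t
  proof -
    have "Re (a + of_real t) \<ge> t - b" using abs_Re_le_cmod [of a] that by simp
    then show "(Re (a + of_real t))\<^sup>2 \<ge> (t - b)\<^sup>2" "Re (a + of_real t) \<ge> 0"
      using that by (auto intro: power_mono)
  qed
  have "norm (f_edge w (- T)) \<le> exp (2 * B\<^sup>2)"
  proof -
    have "norm (f_edge w (- T)) \<le> exp ((Im (of_real (sqrt 2) * (w + of_real T)))\<^sup>2)"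
      using norm_erfc_le [of "of_real (sqrt 2) * (w + of_real T)"] unfolding f_edge_def by (simp add: norm_mult)
    also have "(Im (of_real (sqrt 2) * (w + of_real T)))\<^sup>2 = 2 * (Im w)\<^sup>2" by (simp add: power_mult_distrib)
    also have "exp (2 * (Im w)\<^sup>2) \<le> exp (2 * B\<^sup>2)" using im [OF w] by simp
    finally show ?thesis .
  qed
  moreover have "norm (edge_density z (- T)) \<le> 2 * exp (2 * B\<^sup>2 - 2 * (T - B)\<^sup>2)"
  proof -
    have "norm (exp (- 2 * (z + of_real T)\<^sup>2)) = exp (2 * (Im z)\<^sup>2 - 2 * (Re (z + of_real T))\<^sup>2)"
      by (simp add: norm_exp_eq_Re power2_eq_square algebra_simps)
    also have "\<dots> \<le> exp (2 * B\<^sup>2 - 2 * (T - B)\<^sup>2)" using im [OF z] re(1) [OF z T] by simp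
    finally have "norm (exp (- 2 * (z + of_real T)\<^sup>2)) \<le> exp (2 * B\<^sup>2 - 2 * (T - B)\<^sup>2)" .
    moreover have "norm (complex_of_real (sqrt 2 / sqrt pi)) \<le> 2"
    proof -
      have "sqrt 2 / sqrt pi \<le> sqrt 2 / 1" using pi_ge_two by (intro divide_left_mono) auto
      also have "\<dots> \<le> 2" using real_sqrt_le_mono [of 2 4] by simp
      finally show ?thesis unfolding norm_sqrt_two_div_pi .
    qed
    ultimately show ?thesis unfolding edge_density_def norm_mult by (intro mult_mono) simp_all
  qed
  ultimately have "norm (f_edge w (- T)) * norm (edge_density z (- T)) \<le>
      exp (2 * B\<^sup>2) * (2 * exp (2 * B\<^sup>2 - 2 * (T - B)\<^sup>2))"
    by (intro mult_mono) simp_all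
  also have "\<dots> = 2 * exp (2 * B\<^sup>2 + (2 * B\<^sup>2 - 2 * (T - B)\<^sup>2))" by (simp only: exp_add mult_ac)
  finally have 1: "norm (- f_edge w (- T) * edge_density z (- T)) \<le> 2 * exp (4 * B\<^sup>2 - 2 * (T - B)\<^sup>2)"
    by (simp add: norm_mult)
  have "norm (exp (- (z - w)\<^sup>2)) \<le> exp (4 * B\<^sup>2)"
  proof -
    have "norm (z - w) \<le> 2 * B" using norm_triangle_ineq4 [of z w] z w by simp
    from im [OF this] have "(Im (z - w))\<^sup>2 - (Re (z - w))\<^sup>2 \<le> 4 * B\<^sup>2"
      using zero_le_power2 [of "Re (z - w)"] unfolding power_mult_distrib power2_eq_square [of "2::real"] by linarith
    then show ?thesis unfolding norm_exp_minus_square by (simp only: exp_le_cancel_iff)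
  qed
  moreover have "norm (erfc (z + w + of_real (2 * T))) \<le> 2 * exp (4 * B\<^sup>2 - 4 * (T - B)\<^sup>2)"
  proof -
    have zw: "norm (z + w) \<le> 2 * B" using norm_triangle_ineq [of z w] z w by simp
    have "2 * B \<le> 2 * T" using T by simp
    note r = re [OF zw this]
    have "norm (erfc (z + w + of_real (2 * T))) \<le>
        2 * exp ((Im (z + w + of_real (2 * T)))\<^sup>2 - (Re (z + w + of_real (2 * T)))\<^sup>2)"
      by (rule norm_erfc_le_right [OF r(2)])
    also have "\<dots> \<le> 2 * exp ((2 * B)\<^sup>2 - (2 * T - 2 * B)\<^sup>2)"
      using r(1) im [OF zw] by simp
    also have "(2 * B)\<^sup>2 - (2 * T - 2 * B)\<^sup>2 = 4 * B\<^sup>2 - 4 * (T - B)\<^sup>2"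
      by (simp add: power2_eq_square algebra_simps)
    finally show ?thesis .
  qed
  ultimately have "norm (exp (- (z - w)\<^sup>2)) * norm (erfc (z + w + of_real (2 * T))) \<le>
      exp (4 * B\<^sup>2) * (2 * exp (4 * B\<^sup>2 - 4 * (T - B)\<^sup>2))"
    by (intro mult_mono) simp_all
  also have "\<dots> = 2 * exp (4 * B\<^sup>2 + (4 * B\<^sup>2 - 4 * (T - B)\<^sup>2))" by (simp only: exp_add mult_ac)
  finally have 2: "norm (exp (- (z - w)\<^sup>2)) * norm (erfc (z + w + of_real (2 * T))) \<le>
      2 * exp (8 * B\<^sup>2 - 4 * (T - B)\<^sup>2)" by simp
  have arg: "z + w - 2 * of_real (- T) = z + w + of_real (2 * T)" by simp
  have "norm (1 / complex_of_real (sqrt pi)) \<le> 1" using pi_ge_two by (simp add: norm_divide)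
  then have "norm (1 / complex_of_real (sqrt pi)) * (norm (exp (- (z - w)\<^sup>2)) * norm (erfc (z + w + of_real (2 * T)))) \<le>
      1 * (2 * exp (8 * B\<^sup>2 - 4 * (T - B)\<^sup>2))"
    by (rule mult_mono [OF _ 2]) simp_all
  then have 3: "norm (1 / complex_of_real (sqrt pi) * exp (- (z - w)\<^sup>2) * erfc (z + w - 2 * of_real (- T))) \<le>
      2 * exp (8 * B\<^sup>2 - 4 * (T - B)\<^sup>2)"
    unfolding arg norm_mult mult.assoc by (simp only: mult_1_left)
  show ?thesis
    unfolding edge_antideriv_def by (rule order_trans [OF norm_triangle_ineq add_mono [OF 1 3]])
qed

text \<open>\<open>kappa_edge\<close> without \<open>exp (z\<^sup>2 + w\<^sup>2)\<close>, a factor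
  that is moved into \<open>edge_weight\<close>.\<close>

definition edge_kernel_limit :: "complex \<Rightarrow> complex \<Rightarrow> complex" where
  "edge_kernel_limit z w = of_real (sqrt pi) * (LINT u:{..0}|lborel. Wronskian (f_edge w) (f_edge z) u)"

lemma integrable_Wronskian_f_edge:
  "set_integrable lborel {..0} (Wronskian (f_edge w) (f_edge z))"
proof -
  have cont: "continuous_on UNIV (Wronskian (f_edge w) (f_edge z))"
    unfolding Wronskian_f_edge [abs_def] edge_density_def f_edge_def by (intro continuous_intros)
  have fb: "norm (f_edge a u) \<le> exp (2 * (Im a)\<^sup>2)" for a u
  proof -
    have "norm (f_edge a u) \<le> exp ((Im (of_real (sqrt 2) * (a - of_real u)))\<^sup>2)"
      using norm_erfc_le [of "of_real (sqrt 2) * (a - of_real u)"] unfolding f_edge_def by (simp add: norm_mult)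
    then show ?thesis by (simp add: power_mult_distrib)
  qed
  have int_exp: "integrable lborel (\<lambda>u::real. exp (- 2 * (a - u)\<^sup>2))" for a
  proof -
    have "integrable lborel (\<lambda>u. exp (- (sqrt 2 * a + (- sqrt 2) * u)\<^sup>2))"
      by (rule lborel_integrable_real_affine [OF integrable_exp_minus_square]) simp
    moreover have "- (sqrt 2 * a + (- sqrt 2) * u)\<^sup>2 = - 2 * (a - u)\<^sup>2" for u
    proof -
      have "sqrt 2 * a + (- sqrt 2) * u = sqrt 2 * (a - u)" by (simp add: algebra_simps)
      then show ?thesis by (simp add: power_mult_distrib)
    qed
    ultimately show ?thesis by simp
  qed
  have int: "integrable lborel (edge_density a)" for a
  proof (rule Bochner_Integration.integrable_bound)
    show "integrable lborel (\<lambda>u. sqrt 2 / sqrt pi * exp (2 * (Im a)\<^sup>2) * exp (- 2 * (Re a - u)\<^sup>2))"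
      by (intro integrable_mult_right int_exp)
    show "edge_density a \<in> borel_measurable lborel" unfolding edge_density_def [abs_def] by measurable
    have "norm (exp (- 2 * (a - of_real u)\<^sup>2)) = exp (2 * (Im a)\<^sup>2) * exp (- 2 * (Re a - u)\<^sup>2)" for u
      unfolding mult_exp_exp by (simp add: norm_exp_eq_Re power2_eq_square algebra_simps)
    then show "AE u in lborel. norm (edge_density a u) \<le>
        norm (sqrt 2 / sqrt pi * exp (2 * (Im a)\<^sup>2) * exp (- 2 * (Re a - u)\<^sup>2))"
      unfolding edge_density_def norm_mult norm_sqrt_two_div_pi by (intro AE_I2) simp
  qed
  have "integrable lborel (Wronskian (f_edge w) (f_edge z))"
  proof (rule Bochner_Integration.integrable_bound)
    show "integrable lborel (\<lambda>u. exp (2 * (Im w)\<^sup>2) * norm (edge_density z u) + norm (edge_density w u) * exp (2 * (Im z)\<^sup>2))"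
      by (intro Bochner_Integration.integrable_add integrable_mult_right integrable_mult_left integrable_norm int)
    show "Wronskian (f_edge w) (f_edge z) \<in> borel_measurable lborel"
      using borel_measurable_continuous_onI [OF cont] by simp
    show "AE u in lborel. norm (Wronskian (f_edge w) (f_edge z) u) \<le>
        norm (exp (2 * (Im w)\<^sup>2) * norm (edge_density z u) + norm (edge_density w u) * exp (2 * (Im z)\<^sup>2))"
    proof (rule AE_I2)
      fix u
      have "norm (Wronskian (f_edge w) (f_edge z) u) \<le>
          norm (f_edge w u) * norm (edge_density z u) + norm (edge_density w u) * norm (f_edge z u)"
        unfolding Wronskian_f_edge norm_mult [symmetric] by (rule norm_triangle_ineq4)
      also have "\<dots> \<le> exp (2 * (Im w)\<^sup>2) * norm (edge_density z u) + norm (edge_density w u) * exp (2 * (Im z)\<^sup>2)"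
        by (intro add_mono mult_mono fb) simp_all
      finally show "norm (Wronskian (f_edge w) (f_edge z) u) \<le>
        norm (exp (2 * (Im w)\<^sup>2) * norm (edge_density z u) + norm (edge_density w u) * exp (2 * (Im z)\<^sup>2))" by simp
    qed
  qed
  then show ?thesis unfolding set_integrable_def by (intro integrable_mult_indicator) simp_all
qed

text \<open>On a compact interval the Leibniz rule applies. Only the undifferentiated integral is
  then taken to the half-line.\<close>

definition truncated_limit :: "real \<Rightarrow> complex \<Rightarrow> complex \<Rightarrow> complex" where
  "truncated_limit T z w = of_real (sqrt pi) * integral (cbox (- T) 0) (Wronskian (f_edge w) (f_edge z))"

lemma truncated_limit_diag: "truncated_limit T w w = 0"
  unfolding truncated_limit_def Wronskian_f_edge [abs_def] by (simp add: mult.commute)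

lemma truncated_limit_has_field_derivative:
  assumes "T \<ge> 0"
  shows "((\<lambda>z. truncated_limit T z w) has_field_derivative
    edge_kernel_deriv_limit z w - of_real (sqrt pi) * edge_antideriv z w (- T)) (at z)"
proof -
  let ?d = "\<lambda>z u. f_edge w u * (edge_density z u * (- 4 * (z - of_real u))) + edge_density w u * edge_density z u"
  have "((\<lambda>z. integral (cbox (- T) 0) (Wronskian (f_edge w) (f_edge z))) has_field_derivative
      integral (cbox (- T) 0) (?d z)) (at z within UNIV)"
  proof (rule leibniz_rule_field_derivative)
    show "((\<lambda>z. Wronskian (f_edge w) (f_edge z) u) has_field_derivative ?d z u) (at z within UNIV)" for z u
      by (rule Wronskian_f_edge_has_field_derivative)
    show "Wronskian (f_edge w) (f_edge z) integrable_on cbox (- T) 0" for z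
      unfolding Wronskian_f_edge [abs_def] edge_density_def f_edge_def
      by (intro integrable_continuous continuous_intros)
    show "continuous_on (UNIV \<times> cbox (- T) 0) (\<lambda>(z, u). ?d z u)"
      unfolding edge_density_def f_edge_def case_prod_unfold by (intro continuous_intros)
  qed auto
  moreover have "(?d z has_integral edge_antideriv z w 0 - edge_antideriv z w (- T)) (cbox (- T) 0)"
    unfolding cbox_interval
    by (rule fundamental_theorem_of_calculus) (use assms edge_antideriv_has_vector_derivative in auto)
  ultimately have "((\<lambda>z. integral (cbox (- T) 0) (Wronskian (f_edge w) (f_edge z))) has_field_derivative
      edge_antideriv z w 0 - edge_antideriv z w (- T)) (at z)"
    by (simp add: integral_unique)
  from DERIV_cmult [OF this, of "of_real (sqrt pi)"] show ?thesis
    unfolding truncated_limit_def edge_antideriv_0 [symmetric] by (simp add: right_diff_distrib)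
qed

lemma tendsto_truncated_limit:
  "(\<lambda>n. truncated_limit (real n) z w) \<longlonglongrightarrow> edge_kernel_limit z w"
proof -
  let ?W = "Wronskian (f_edge w) (f_edge z)"
  have int: "integrable lborel (\<lambda>u. indicator {..0} u *\<^sub>R ?W u)"
    using integrable_Wronskian_f_edge unfolding set_integrable_def .
  have "(\<lambda>n. \<integral>u. indicator {- real n..0} u *\<^sub>R ?W u \<partial>lborel) \<longlonglongrightarrow> (\<integral>u. indicator {..0} u *\<^sub>R ?W u \<partial>lborel)"
  proof (rule integral_dominated_convergence)
    show "integrable lborel (\<lambda>u. norm (indicator {..0} u *\<^sub>R ?W u))" using int by (rule integrable_norm)
    show "AE u in lborel. (\<lambda>n. indicator {- real n..0} u *\<^sub>R ?W u) \<longlonglongrightarrow> indicator {..0} u *\<^sub>R ?W u"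
    proof (intro AE_I2 tendsto_eventually)
      fix u :: real
      have "\<forall>\<^sub>F n in sequentially. - real n \<le> u" by real_asymp
      then show "\<forall>\<^sub>F n in sequentially. indicator {- real n..0} u *\<^sub>R ?W u = indicator {..0} u *\<^sub>R ?W u"
        by eventually_elim (simp add: indicator_def)
    qed
    have "?W \<in> borel_measurable borel"
      unfolding Wronskian_f_edge [abs_def] edge_density_def f_edge_def
      by (intro borel_measurable_continuous_onI continuous_intros)
    then show "(\<lambda>u. indicator {..0} u *\<^sub>R ?W u) \<in> borel_measurable lborel"
      "(\<lambda>u. indicator {- real n..0} u *\<^sub>R ?W u) \<in> borel_measurable lborel" for n by simp_all
  qed (auto simp: indicator_def intro!: AE_I2)
  moreover have "(\<integral>u. indicator {- real n..0} u *\<^sub>R ?W u \<partial>lborel) = integral (cbox (- real n) 0) ?W" for n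
  proof -
    have "set_integrable lborel {- real n..0} ?W"
      by (rule set_integrable_subset [OF integrable_Wronskian_f_edge]) auto
    from set_borel_integral_eq_integral(2) [OF this] show ?thesis
      by (simp add: set_lebesgue_integral_def)
  qed
  ultimately show ?thesis
    unfolding truncated_limit_def edge_kernel_limit_def set_lebesgue_integral_def
    by (intro tendsto_mult tendsto_const) simp
qed

text \<open>For fixed \<open>w\<close> the difference of the finite and the truncated kernel
  vanishes at \<open>z = w\<close>, so it is at most the bound on its derivative times the distance.
  That bound, \<open>\<eta> + sqrt pi * \<rho> n\<close>, is the same for all points of the disc;
  the cut-off \<open>n\<close> goes to infinity with \<open>N\<close> held fixed.\<close>

theorem uniform_limit_edge_kernel:
  "uniform_limit (cball 0 B \<times> cball 0 B) (\<lambda>N (z, w). edge_kernel N z w)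
    (\<lambda>(z, w). edge_kernel_limit z w) sequentially"
proof (cases "B \<ge> 0")
  case B: True
  show ?thesis
    unfolding uniform_limit_iff
  proof (intro allI impI)
    fix \<epsilon> :: real assume \<epsilon>: "\<epsilon> > 0"
    \<comment> \<open>The diameter \<open>2 * B\<close> of the disc has to fit strictly under the
      denominator, also for \<open>B = 0\<close>.\<close>
    define \<eta> where "\<eta> = \<epsilon> / (4 * B + 4)"
    have "\<eta> > 0" using \<epsilon> B by (simp add: \<eta>_def)
    moreover have "\<eta> * (4 * B + 4) = \<epsilon>" using B by (simp add: \<eta>_def)
    moreover have "\<eta> * (2 * B) < \<eta> * (4 * B + 4)"
      by (rule mult_strict_left_mono) (use B \<open>\<eta> > 0\<close> in auto)
    ultimately have \<eta>: "\<eta> > 0" "\<eta> * (2 * B) < \<epsilon>" by simp_all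
    from uniform_limitD [OF uniform_limit_edge_kernel_deriv \<eta>(1), of B]
    have "\<forall>\<^sub>F N in sequentially. N \<ge> 1 \<and> (\<forall>x\<in>cball 0 B \<times> cball 0 B.
        dist (case x of (z, w) \<Rightarrow> edge_kernel_deriv N z w) (case x of (z, w) \<Rightarrow> edge_kernel_deriv_limit z w) < \<eta>)"
      by (intro eventually_conj eventually_ge_at_top)
    then show "\<forall>\<^sub>F N in sequentially. \<forall>x\<in>cball 0 B \<times> cball 0 B.
        dist (case x of (z, w) \<Rightarrow> edge_kernel N z w) (case x of (z, w) \<Rightarrow> edge_kernel_limit z w) < \<epsilon>"
    proof eventually_elim
      case (elim N)
      have "norm (edge_kernel N z w - edge_kernel_limit z w) < \<epsilon>" if zw: "z \<in> cball 0 B" "w \<in> cball 0 B" for z w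
      proof -
        define \<rho> where "\<rho> n = 2 * exp (4 * B\<^sup>2 - 2 * (real n - B)\<^sup>2) + 2 * exp (8 * B\<^sup>2 - 4 * (real n - B)\<^sup>2)" for n
        have \<rho>: "\<rho> \<longlonglongrightarrow> 0" unfolding \<rho>_def by real_asymp
        have bound: "norm (edge_kernel N z w - truncated_limit (real n) z w) \<le> (\<eta> + sqrt pi * \<rho> n) * (2 * B)"
          if n: "real n \<ge> B" for n
        proof -
          let ?h = "\<lambda>\<zeta>. edge_kernel N \<zeta> w - truncated_limit (real n) \<zeta> w"
          have "norm (?h z - ?h w) \<le> (\<eta> + sqrt pi * \<rho> n) * norm (z - w)"
          proof (rule field_differentiable_bound [of "cball 0 B"])
            fix \<zeta> assume \<zeta>: "\<zeta> \<in> cball (0::complex) B"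
            show "(?h has_field_derivative edge_kernel_deriv N \<zeta> w -
                (edge_kernel_deriv_limit \<zeta> w - of_real (sqrt pi) * edge_antideriv \<zeta> w (- real n))) (at \<zeta> within cball 0 B)"
              using elim by (intro has_field_derivative_at_within [OF DERIV_diff]
                  edge_kernel_has_field_derivative truncated_limit_has_field_derivative) auto
            have "norm (edge_kernel_deriv N \<zeta> w - edge_kernel_deriv_limit \<zeta> w) \<le> \<eta>"
              using elim \<zeta> zw(2) by (force simp: dist_norm)
            moreover have "norm (of_real (sqrt pi) * edge_antideriv \<zeta> w (- real n)) \<le> sqrt pi * \<rho> n"
              using norm_edge_antideriv_le [of \<zeta> B w "real n"] \<zeta> zw(2) n
              by (simp add: norm_mult \<rho>_def dist_norm)
            ultimately show "norm (edge_kernel_deriv N \<zeta> w -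
                (edge_kernel_deriv_limit \<zeta> w - of_real (sqrt pi) * edge_antideriv \<zeta> w (- real n))) \<le> \<eta> + sqrt pi * \<rho> n"
              using norm_triangle_ineq [of "edge_kernel_deriv N \<zeta> w - edge_kernel_deriv_limit \<zeta> w"
                  "of_real (sqrt pi) * edge_antideriv \<zeta> w (- real n)"] by (simp add: algebra_simps)
          qed (use zw in auto)
          also have "\<dots> \<le> (\<eta> + sqrt pi * \<rho> n) * (2 * B)"
          proof (rule mult_left_mono)
            show "norm (z - w) \<le> 2 * B" using norm_triangle_ineq4 [of z w] zw by (simp add: dist_norm)
            show "0 \<le> \<eta> + sqrt pi * \<rho> n" using \<eta> by (simp add: \<rho>_def add_nonneg_nonneg)
          qed
          finally show ?thesis by (simp add: edge_kernel_diag truncated_limit_diag)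
        qed
        have "norm (edge_kernel N z w - edge_kernel_limit z w) \<le> (\<eta> + sqrt pi * 0) * (2 * B)"
        proof (rule tendsto_le [OF sequentially_bot])
          show "(\<lambda>n. (\<eta> + sqrt pi * \<rho> n) * (2 * B)) \<longlonglongrightarrow> (\<eta> + sqrt pi * 0) * (2 * B)"
            by (intro tendsto_intros \<rho>)
          show "(\<lambda>n. norm (edge_kernel N z w - truncated_limit (real n) z w)) \<longlonglongrightarrow>
              norm (edge_kernel N z w - edge_kernel_limit z w)"
            by (intro tendsto_intros tendsto_truncated_limit)
          have "\<forall>\<^sub>F n in sequentially. real n \<ge> B" by real_asymp
          then show "\<forall>\<^sub>F n in sequentially. norm (edge_kernel N z w - truncated_limit (real n) z w) \<le>
              (\<eta> + sqrt pi * \<rho> n) * (2 * B)"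
            by eventually_elim (rule bound)
        qed
        then show ?thesis using \<eta>(2) by simp
      qed
      then show ?case by (auto simp: dist_norm)
    qed
  qed
qed simp

section \<open>Convergence of the correlation functions\<close>

lemma poly_skew_poly_even:
  assumes N: "N \<ge> 1"
  shows "poly (skew_poly (real N) (2 * n)) (X / of_real (sqrt N)) =
    2 ^ n * fact n / of_nat N ^ n * trunc_exp n (X\<^sup>2 / 2)"
proof -
  have sN: "complex_of_real (sqrt N) * complex_of_real (sqrt N) = of_nat N" by (simp flip: of_real_mult)
  have "poly (skew_poly (real N) (2 * n)) (X / of_real (sqrt N)) =
      (\<Sum>l\<le>n. of_real ((2 / real N) ^ (n - l) * fact n / fact l) * (X / of_real (sqrt N)) ^ (2 * l))"
    by (simp add: skew_poly_def poly_sum poly_monom)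
  also have "\<dots> = (\<Sum>l\<le>n. 2 ^ n * fact n / of_nat N ^ n * ((X\<^sup>2 / 2) ^ l / fact l))"
  proof (rule sum.cong [OF refl])
    fix l assume "l \<in> {..n}"
    then have "n = (n - l) + l" by simp
    then have p: "(2::complex) ^ n = 2 ^ (n - l) * 2 ^ l" "(of_nat N :: complex) ^ n = of_nat N ^ (n - l) * of_nat N ^ l"
      by (metis power_add)+
    have "(X / of_real (sqrt N)) ^ (2 * l) = (X\<^sup>2) ^ l / of_nat N ^ l"
      unfolding power_mult power_divide by (simp add: power2_eq_square sN)
    moreover have "complex_of_real ((2 / real N) ^ (n - l) * fact n / fact l) =
        2 ^ (n - l) / of_nat N ^ (n - l) * fact n / fact l" by (simp add: power_divide)
    ultimately show "of_real ((2 / real N) ^ (n - l) * fact n / fact l) * (X / of_real (sqrt N)) ^ (2 * l) =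
        2 ^ n * fact n / of_nat N ^ n * ((X\<^sup>2 / 2) ^ l / fact l)"
      unfolding p by (simp add: power_divide mult_ac)
  qed
  finally show ?thesis by (simp only: trunc_exp_def sum_distrib_left)
qed

text \<open>The skew norm contributes \<open>r ^ 4\<close> beyond the powers that the polynomials
  cancel, and the odd polynomial takes one \<open>r\<close> back, which leaves the cube. The minus
  sign reflects the opposite orders of the partners in the two sums.\<close>

lemma prekernel_eq_edge_sum:
  assumes N: "N \<ge> 1"
  shows "prekernel N (X / of_real (sqrt N)) (Y / of_real (sqrt N)) =
    - (of_real (sqrt N) ^ 3 / 2) * edge_sum N X Y"
proof -
  define r where "r = complex_of_real (sqrt N)"
  have r: "r \<noteq> 0" "r\<^sup>2 = of_nat N" using N by (simp_all add: r_def power2_eq_square flip: of_real_mult)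
  have "1 / (2 * norming N n) * (poly (skew_poly (real N) (2 * n)) (X / r) * poly (skew_poly (real N) (2 * n + 1)) (Y / r) -
      poly (skew_poly (real N) (2 * n + 1)) (X / r) * poly (skew_poly (real N) (2 * n)) (Y / r)) =
      - (r ^ 3 / 2) * (2 ^ n * fact n / fact (2 * n + 1) *
     (X ^ (2 * n + 1) * trunc_exp n (Y\<^sup>2 / 2) - trunc_exp n (X\<^sup>2 / 2) * Y ^ (2 * n + 1)))" for n
  proof -
    define R A where "R = r ^ (2 * n)" and "A = (2 ^ n * fact n :: complex)"
    define D where "D = (fact (2 * n + 1) :: complex)"
    have nz: "R \<noteq> 0" "D \<noteq> 0" using r unfolding R_def D_def by (simp_all del: fact_Suc)
    have even: "poly (skew_poly (real N) (2 * n)) (Z / r) = A / R * trunc_exp n (Z\<^sup>2 / 2)" for Z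
      using poly_skew_poly_even [OF N, of n Z] unfolding r_def [symmetric] R_def A_def
      by (simp add: power_mult r(2))
    have odd: "poly (skew_poly (real N) (2 * n + 1)) (Z / r) = Z ^ (2 * n + 1) / (R * r)" for Z
      by (simp add: poly_monom power_divide R_def)
    have norming: "norming N n = D / (R * R * r ^ 4)"
    proof -
      have "(of_nat N :: complex) ^ (2 * n + 2) = R * R * r ^ 4"
        unfolding r(2) [symmetric] R_def power_mult [symmetric] power_add [symmetric]
        by (rule arg_cong [where f = "power r"]) simp
      then show ?thesis unfolding norming_def D_def by (simp only:)
    qed
    have gen: "1 / (2 * (D / (R * R * (r * r * r * r)))) * (A / R * x * (y / (R * r)) - z / (R * r) * (A / R * t)) =
        - (r * r * r / 2) * (A / D * (z * t - x * y))" for x y z t :: complex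
      using nz r(1) by (simp add: divide_simps) (simp add: algebra_simps)
    show ?thesis
      unfolding even odd norming A_def [symmetric] D_def [symmetric]
      by (simp only: power3_eq_cube power4_eq_xxxx mult.assoc [symmetric] gen [unfolded mult.assoc [symmetric]])
  qed
  then show ?thesis
    unfolding prekernel_def edge_sum_def r_def [symmetric] by (simp only: sum_distrib_left)
qed

text \<open>Every term is an even polynomial times an odd one. This reduces the boundary point
  \<open>- sqrt 2\<close> to \<open>sqrt 2\<close> up to a sign.\<close>

lemma prekernel_minus: "prekernel N (- x) (- y) = - prekernel N x y"
proof -
  have even: "poly (skew_poly c (2 * n)) (- x) = poly (skew_poly c (2 * n)) x" for c n x
    by (simp add: skew_poly_def poly_sum poly_monom)
  have odd: "poly (skew_poly c (2 * n + 1)) (- x) = - poly (skew_poly c (2 * n + 1)) x" for c n x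
    by (simp add: poly_monom)
  show ?thesis
    unfolding prekernel_def even odd sum_negf [symmetric] by (simp add: algebra_simps)
qed

text \<open>The rule \<open>Pf (D A D) = det D * Pf A\<close> for diagonal \<open>D\<close>,
  together with homogeneity of degree \<open>k\<close>.\<close>

lemma Pf_mat_scale:
  "Pf (index_matrix k (\<lambda>a b. c * (m a * m b * f a b))) =
    c ^ k * (\<Prod>a<2 * k. m a) * Pf (index_matrix k f)"
proof -
  have "(\<Prod>i<k. c * (m (\<sigma> (2 * i)) * m (\<sigma> (2 * i + 1)) * f (\<sigma> (2 * i)) (\<sigma> (2 * i + 1)))) =
      c ^ k * (\<Prod>a<2 * k. m a) * (\<Prod>i<k. f (\<sigma> (2 * i)) (\<sigma> (2 * i + 1)))" if "\<sigma> permutes {..<2 * k}" for \<sigma>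
  proof -
    have "(\<Prod>i<k. m (\<sigma> (2 * i)) * m (\<sigma> (2 * i + 1))) = (\<Prod>a<2 * k. m (\<sigma> a))" by (rule prod_double [symmetric])
    also have "\<dots> = (\<Prod>a<2 * k. m a)" using prod.permute [OF that, of m] by (simp add: o_def)
    finally have m: "(\<Prod>a<2 * k. m a) = (\<Prod>i<k. m (\<sigma> (2 * i))) * (\<Prod>i<k. m (\<sigma> (2 * i + 1)))"
      by (simp only: prod.distrib)
    show ?thesis
      unfolding m prod.distrib prod_constant card_lessThan by (simp only: mult_ac)
  qed
  then show ?thesis
    unfolding Pf_mat by (simp add: sum_distrib_left sum_distrib_right mult_ac)
qed

text \<open>The part of an entry of \<open>K_edge\<close> that belongs to one of its two indices:
  \<open>exp (- (cmod z)\<^sup>2)\<close> from the block prefactor, and the exponential of the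
  squared argument from \<open>kappa_edge\<close>.\<close>

definition edge_weight :: "(nat \<Rightarrow> complex) \<Rightarrow> nat \<Rightarrow> complex" where
  "edge_weight z a = of_real (exp (- (cmod (z (a div 2)))\<^sup>2)) * exp ((conj_pairs z a)\<^sup>2)"

text \<open>Diagonal factors \<open>m a\<close> are pulled out of the Pfaffian so that the entries
  take the shape of the limit. They cancel the Gaussian weights of the particles, and the scalars
  that remain multiply to 1 for each particle.\<close>

lemma rescaled_correlation_eq_Pf:
  assumes p: "p = of_real (sqrt 2) \<and> \<theta> = 0 \<or> p = - of_real (sqrt 2) \<and> \<theta> = pi"
    and N: "N \<ge> 1" and kN: "k \<le> N"
  shows "complex_of_real (rescaled_correlation p \<theta> N k z) = (\<Prod>j<k. cnj (z j) - z j) *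
    Pf (index_matrix k (\<lambda>a b. edge_weight z a * edge_weight z b *
      edge_kernel N (conj_pairs z a) (conj_pairs z b)))"
proof -
  have Npos: "N > 0" using N by simp
  \<comment> \<open>The rotation \<open>exp (\<i> * \<theta>)\<close>. Being real, it commutes with
    conjugation, so a conjugate pair is rescaled to a conjugate pair.\<close>
  define \<epsilon> :: complex where "\<epsilon> = (if \<theta> = 0 then 1 else - 1)"
  define r where "r = micro_scale N"
  define q where "q = complex_of_real (sqrt N)"
  have \<epsilon>: "exp (\<i> * of_real \<theta>) = \<epsilon>" "p = \<epsilon> * of_real (sqrt 2)" "\<epsilon> = 1 \<or> \<epsilon> = - 1" "\<epsilon> * \<epsilon> = 1" "cnj \<epsilon> = \<epsilon>"
    "cmod \<epsilon> = 1"
    using p by (auto simp: \<epsilon>_def)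
  have q: "q \<noteq> 0" "q * q = of_nat N" using N by (simp_all add: q_def flip: of_real_mult)
  have rq: "of_real r * q = of_real (sqrt 2)"
    using N by (simp add: r_def q_def micro_scale_def real_sqrt_divide)
  define \<zeta> where "\<zeta> j = p + exp (\<i> * of_real \<theta>) * of_real r * z j" for j
  have pt: "of_real (sqrt 2) + of_real r * x = edge_point N x / q" for x
  proof -
    have "(of_real (sqrt 2) + of_real r * x) * q = edge_point N x"
      unfolding distrib_right edge_point_def q_def [symmetric] rq [symmetric] by (simp add: algebra_simps)
    then show ?thesis using q(1) by (simp add: field_simps)
  qed
  have \<zeta>: "\<zeta> j = \<epsilon> * (edge_point N (z j) / q)" for j
    unfolding pt [symmetric] \<zeta>_def \<epsilon>(1,2) by (simp add: algebra_simps)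
  have cnj_pt: "cnj (edge_point N x / q) = edge_point N (cnj x) / q" for x
    by (simp add: edge_point_def q_def)
  have pairs: "conj_pairs \<zeta> a = \<epsilon> * (edge_point N (conj_pairs z a) / q)" for a
    unfolding conj_pairs_def \<zeta> complex_cnj_mult cnj_pt \<epsilon>(5) by (cases "even a") simp_all
  define E where "E x = exp (- (edge_point N x)\<^sup>2 / 2)" for x
  define c where "c = - \<epsilon> * q ^ 3 / (2 * of_real (sqrt 2))"
  define m where "m a = 1 / (E (conj_pairs z a) * edge_weight z a)" for a
  define T where "T a b = edge_weight z a * edge_weight z b * edge_kernel N (conj_pairs z a) (conj_pairs z b)" for a b
  have Enz: "E x \<noteq> 0" "edge_weight z a \<noteq> 0" for x a by (simp_all add: E_def edge_weight_def)
  have ker: "prekernel N (conj_pairs \<zeta> a) (conj_pairs \<zeta> b) = c * (m a * m b * T a b)" for a b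
  proof -
    define x y where "x = conj_pairs z a" and "y = conj_pairs z b"
    have "prekernel N (\<epsilon> * (edge_point N x / q)) (\<epsilon> * (edge_point N y / q)) =
        \<epsilon> * prekernel N (edge_point N x / q) (edge_point N y / q)"
      using \<epsilon>(3) prekernel_minus by auto
    also have "\<dots> = \<epsilon> * (- (q ^ 3 / 2) * edge_sum N (edge_point N x) (edge_point N y))"
      unfolding q_def prekernel_eq_edge_sum [OF N] ..
    finally have 1: "prekernel N (conj_pairs \<zeta> a) (conj_pairs \<zeta> b) =
        \<epsilon> * (- (q ^ 3 / 2) * edge_sum N (edge_point N x) (edge_point N y))"
      unfolding pairs x_def y_def .
    have "edge_kernel N x y = of_real (sqrt 2) * (E x * E y) * edge_sum N (edge_point N x) (edge_point N y)"
      unfolding edge_kernel_def E_def mult_exp_exp by (simp add: add_divide_distrib diff_divide_distrib)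
    then have "m a * m b * T a b = of_real (sqrt 2) * edge_sum N (edge_point N x) (edge_point N y)"
      unfolding m_def T_def x_def [symmetric] y_def [symmetric] using Enz by simp
    then show ?thesis unfolding 1 c_def by simp
  qed
  \<comment> \<open>With \<open>u = sqrt N + x\<close> the exponents match by \<open>u\<^sup>2 +
    (cnj u)\<^sup>2 - (x - cnj x)\<^sup>2 = 2 * (u * cnj u)\<close>, since
    \<open>u - cnj u = x - cnj x\<close>.\<close>
  have weight: "of_real (exp (- (real N * (cmod (\<zeta> j))\<^sup>2))) * (m (2 * j) * m (2 * j + 1)) = 1" for j
  proof -
    define x u where "x = z j" and "u = of_real (sqrt N) + x"
    have "complex_of_real (real N * (cmod (\<zeta> j))\<^sup>2) = of_nat N * (\<zeta> j * cnj (\<zeta> j))"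
      by (simp only: of_real_mult complex_norm_square of_real_of_nat_eq)
    also have "\<dots> = (\<epsilon> * \<epsilon>) * (edge_point N x * edge_point N (cnj x))"
      unfolding \<zeta> complex_cnj_mult cnj_pt \<epsilon>(5) x_def q(2) [symmetric] using q(1) by simp
    also have "\<dots> = 2 * (u * cnj u)"
      unfolding \<epsilon>(4) edge_point_def u_def sqrt2_sqrt2 [symmetric] by (simp add: mult_ac)
    finally have n: "complex_of_real (exp (- (real N * (cmod (\<zeta> j))\<^sup>2))) = exp (- (2 * (u * cnj u)))"
      by (simp only: exp_of_real [symmetric] of_real_minus)
    have E2: "E y = exp (- (of_real (sqrt N) + y)\<^sup>2)" for y
      unfolding E_def edge_point_def sqrt2_mult_square by simp
    have g: "edge_weight z (2 * j) * edge_weight z (2 * j + 1) = exp (- (2 * (x * cnj x)) + x\<^sup>2 + (cnj x)\<^sup>2)"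
    proof -
      have "complex_of_real (exp (- (cmod x)\<^sup>2)) = exp (- (x * cnj x))"
        by (simp only: exp_of_real [symmetric] of_real_minus complex_norm_square)
      then have "edge_weight z (2 * j) = exp (- (x * cnj x)) * exp (x\<^sup>2)"
        "edge_weight z (2 * j + 1) = exp (- (x * cnj x)) * exp ((cnj x)\<^sup>2)"
        by (simp_all add: edge_weight_def x_def)
      then show ?thesis by (simp only: mult_exp_exp) (simp add: algebra_simps)
    qed
    have "m (2 * j) * m (2 * j + 1) = 1 / ((E x * E (cnj x)) * (edge_weight z (2 * j) * edge_weight z (2 * j + 1)))"
      unfolding m_def x_def by simp
    also have "(E x * E (cnj x)) * (edge_weight z (2 * j) * edge_weight z (2 * j + 1)) = exp (- (2 * (u * cnj u)))"
      unfolding g E2 mult_exp_exp u_def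
      by (intro arg_cong [where f = exp]) (simp add: power2_eq_square algebra_simps)
    finally show ?thesis unfolding n by simp
  qed
  have diff: "\<zeta> j - cnj (\<zeta> j) = - (\<epsilon> * of_real r) * (cnj (z j) - z j)" for j
  proof -
    have "\<zeta> j = \<epsilon> * (of_real (sqrt 2) + of_real r * z j)" unfolding \<zeta> pt ..
    then show ?thesis using \<epsilon>(5) by (simp add: algebra_simps)
  qed
  \<comment> \<open>Two powers of \<open>r\<close> come from the rescaling and one from
    \<open>\<zeta> - cnj \<zeta>\<close>; they meet the \<open>q ^ 3\<close> of the kernel through
    \<open>r * q = sqrt 2\<close>.\<close>
  have const: "of_real r ^ 2 * (- (\<epsilon> * of_real r)) * c = 1"
  proof -
    have "of_real r ^ 2 * (- (\<epsilon> * of_real r)) * c = (\<epsilon> * \<epsilon>) * (of_real r * q) ^ 3 / (2 * of_real (sqrt 2))"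
      unfolding c_def by (simp add: power3_eq_cube power2_eq_square)
    also have "\<dots> = 1"
      unfolding \<epsilon>(4) rq using sqrt2_sqrt2 by (simp add: power3_eq_cube)
    finally show ?thesis .
  qed
  have "complex_of_real (rescaled_correlation p \<theta> N k z) = of_real r ^ (2 * k) *
      complex_of_real (correlation Ginibre_potential N k \<zeta>)"
    unfolding rescaled_correlation_def r_def [symmetric] \<zeta>_def [abs_def] by simp
  also have "complex_of_real (correlation Ginibre_potential N k \<zeta>) =
      (\<Prod>j<k. (\<zeta> j - cnj (\<zeta> j)) * of_real (exp (- (real N * (cmod (\<zeta> j))\<^sup>2)))) *
      (c ^ k * (\<Prod>a<2 * k. m a) * Pf (index_matrix k T))"
    unfolding correlation_Ginibre_eq_Pf [OF Npos kN] ker Pf_mat_scale ..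
  also have "of_real r ^ (2 * k) * \<dots> =
      (\<Prod>j<k. (of_real r ^ 2 * (- (\<epsilon> * of_real r)) * c) * (cnj (z j) - z j) *
        (of_real (exp (- (real N * (cmod (\<zeta> j))\<^sup>2))) * (m (2 * j) * m (2 * j + 1)))) *
      Pf (index_matrix k T)"
    unfolding prod_double diff power_mult prod.distrib prod_constant card_lessThan by (simp only: mult_ac)
  also have "\<dots> = (\<Prod>j<k. cnj (z j) - z j) * Pf (index_matrix k T)"
    unfolding const weight by simp
  finally show ?thesis unfolding T_def .
qed

lemma limiting_correlation_eq:
  "limiting_correlation k z = (\<Prod>j<k. cnj (z j) - z j) *
    Pf (index_matrix k (\<lambda>a b. edge_weight z a * edge_weight z b *
      edge_kernel_limit (conj_pairs z a) (conj_pairs z b)))"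
proof -
  have kappa: "kappa_edge x y = exp (x\<^sup>2) * exp (y\<^sup>2) * edge_kernel_limit x y" for x y
    unfolding kappa_edge_def edge_kernel_limit_def by (simp add: exp_add)
  have "K_edge (z (a div 2)) (z (b div 2)) $$ (a mod 2, b mod 2) =
      edge_weight z a * edge_weight z b * edge_kernel_limit (conj_pairs z a) (conj_pairs z b)" for a b
  proof -
    have "a mod 2 = 0 \<or> a mod 2 = 1" "b mod 2 = 0 \<or> b mod 2 = 1" by auto
    then have "K_edge (z (a div 2)) (z (b div 2)) $$ (a mod 2, b mod 2) =
      of_real (exp (- (cmod (z (a div 2)))\<^sup>2 - (cmod (z (b div 2)))\<^sup>2)) * kappa_edge (conj_pairs z a) (conj_pairs z b)"
      unfolding K_edge_def conj_pairs_def by (auto simp: mat_of_rows_list_def even_iff_mod_2_eq_zero)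
    also have "exp (- (cmod (z (a div 2)))\<^sup>2 - (cmod (z (b div 2)))\<^sup>2) =
        exp (- (cmod (z (a div 2)))\<^sup>2) * exp (- (cmod (z (b div 2)))\<^sup>2)" unfolding mult_exp_exp by simp
    finally show ?thesis unfolding kappa edge_weight_def by simp
  qed
  then show ?thesis unfolding limiting_correlation_def block_matrix_def by simp
qed

section \<open>Uniform limits of finite sums and products\<close>

lemma uniform_limit_sum:
  fixes f :: "'i \<Rightarrow> 'n \<Rightarrow> 'a \<Rightarrow> 'b::real_normed_vector"
  assumes "\<And>i. i \<in> I \<Longrightarrow> uniform_limit S (f i) (g i) F"
  shows "uniform_limit S (\<lambda>n x. \<Sum>i\<in>I. f i n x) (\<lambda>x. \<Sum>i\<in>I. g i x) F"
  using assms by (induction I rule: infinite_finite_induct) (auto intro: uniform_limit_add uniform_limit_const)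

lemma bounded_image_mult:
  fixes f g :: "'a \<Rightarrow> 'b::real_normed_algebra"
  assumes "bounded (f ` S)" "bounded (g ` S)"
  shows "bounded ((\<lambda>x. f x * g x) ` S)"
proof -
  obtain a b where "\<And>x. x \<in> S \<Longrightarrow> norm (f x) \<le> a" "\<And>x. x \<in> S \<Longrightarrow> norm (g x) \<le> b"
    using assms unfolding bounded_iff by auto
  then have "norm (f x * g x) \<le> a * b" if "x \<in> S" for x
    using that by (meson mult_mono' norm_ge_zero norm_mult_ineq order_trans)
  then show ?thesis unfolding bounded_iff by auto
qed

text \<open>Uniform limits multiply when the limits are bounded, so boundedness is carried along in
  the induction.\<close>

lemma uniform_limit_prod_bounded:
  fixes f :: "'i \<Rightarrow> nat \<Rightarrow> 'a \<Rightarrow> complex"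
  assumes "finite I" "\<And>i. i \<in> I \<Longrightarrow> uniform_limit S (f i) (g i) F" "\<And>i. i \<in> I \<Longrightarrow> bounded (g i ` S)"
  shows "uniform_limit S (\<lambda>n x. \<Prod>i\<in>I. f i n x) (\<lambda>x. \<Prod>i\<in>I. g i x) F \<and> bounded ((\<lambda>x. \<Prod>i\<in>I. g i x) ` S)"
  using assms
proof (induction I rule: finite_induct)
  case empty
  have "bounded ((\<lambda>x. 1::complex) ` S)" by (rule finite_imp_bounded) (rule finite_subset [of _ "{1}"], auto)
  then show ?case by (simp add: uniform_limit_const)
next
  case (insert i I)
  then have "uniform_limit S (f i) (g i) F" "bounded (g i ` S)"
    "uniform_limit S (\<lambda>n x. \<Prod>i\<in>I. f i n x) (\<lambda>x. \<Prod>i\<in>I. g i x) F" "bounded ((\<lambda>x. \<Prod>i\<in>I. g i x) ` S)"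
    by auto
  then show ?case
    using insert(1,2) by (simp add: uniform_lim_mult bounded_image_mult)
qed


text \<open>Some finite kernel is within 1 of the limit on the whole set; it is continuous, hence
  bounded on a compact product.\<close>

lemma bounded_edge_kernel_limit:
  "bounded ((\<lambda>(z, w). edge_kernel_limit z w) ` (cball 0 B \<times> cball 0 B))"
proof -
  let ?K = "cball (0::complex) B \<times> cball (0::complex) B"
  have "\<forall>\<^sub>F N in sequentially. \<forall>x\<in>?K.
      dist (case x of (z, w) \<Rightarrow> edge_kernel N z w) (case x of (z, w) \<Rightarrow> edge_kernel_limit z w) < 1"
    by (rule uniform_limitD [OF uniform_limit_edge_kernel]) simp
  then obtain N where N: "\<And>z w. (z, w) \<in> ?K \<Longrightarrow> norm (edge_kernel N z w - edge_kernel_limit z w) < 1"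
    using eventually_happens' [OF sequentially_bot] by (fastforce simp: dist_norm)
  have "continuous_on ?K (\<lambda>(z, w). edge_kernel N z w)"
    unfolding edge_kernel_def edge_sum_def edge_point_def trunc_exp_def case_prod_unfold
    by (intro continuous_intros) auto
  then have "bounded ((\<lambda>(z, w). edge_kernel N z w) ` ?K)"
    by (intro compact_imp_bounded compact_continuous_image compact_Times compact_cball)
  then obtain b where "\<forall>x\<in>?K. norm (case x of (z, w) \<Rightarrow> edge_kernel N z w) \<le> b"
    unfolding bounded_iff by blast
  then have b: "norm (edge_kernel N z w) \<le> b" if "(z, w) \<in> ?K" for z w
    using that by auto
  have "norm (edge_kernel_limit z w) \<le> b + 1" if "(z, w) \<in> ?K" for z w
    using N [OF that] b [OF that] norm_triangle_ineq4 [of "edge_kernel N z w" "edge_kernel N z w - edge_kernel_limit z w"]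
    by simp
  then show ?thesis unfolding bounded_iff by (intro exI [of _ "b + 1"]) auto
qed

text \<open>Every compact set of \<open>k\<close>-tuples lies in a product of copies of one compact
  \<open>C\<close>, so convergence on such products covers all of them.\<close>

theorem theorem2p1:
  fixes p :: complex and \<theta> :: real and k :: nat and C :: "complex set"
  assumes "p = of_real (sqrt 2) \<and> \<theta> = 0 \<or> p = - of_real (sqrt 2) \<and> \<theta> = pi"
    and "k \<ge> 1"
    and "compact C"
  shows "uniform_limit ({..<k} \<rightarrow>\<^sub>E C)
           (\<lambda>N z. complex_of_real (rescaled_correlation p \<theta> N k z))
           (limiting_correlation k) sequentially"
proof -
  define S where "S = {..<k} \<rightarrow>\<^sub>E C"
  obtain B where B: "\<And>x. x \<in> C \<Longrightarrow> norm x \<le> B"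
    using compact_imp_bounded [OF assms(3)] unfolding bounded_iff by blast
  have zB: "norm (z j) \<le> B" if "z \<in> S" "j < k" for z j
    using that B by (auto simp: S_def)
  have xB: "norm (conj_pairs z a) \<le> B" if "z \<in> S" "a < 2 * k" for z a
    using zB [OF that(1), of "a div 2"] that(2) by (simp add: conj_pairs_def)
  define T where "T F a b z = edge_weight z a * edge_weight z b * F (conj_pairs z a) (conj_pairs z b)"
    for F :: "complex \<Rightarrow> complex \<Rightarrow> complex" and a b z
  have weight: "bounded ((\<lambda>z. edge_weight z a) ` S)" if "a < 2 * k" for a
  proof -
    have "norm (edge_weight z a) \<le> 1 * exp (B\<^sup>2)" if "z \<in> S" for z
      unfolding edge_weight_def norm_mult
    proof (rule mult_mono)
      have "norm (exp ((conj_pairs z a)\<^sup>2)) \<le> exp (norm ((conj_pairs z a)\<^sup>2))" by (rule norm_exp)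
      also have "\<dots> \<le> exp (B\<^sup>2)" using xB [OF that \<open>a < 2 * k\<close>] by (simp add: norm_power power_mono)
      finally show "norm (exp ((conj_pairs z a)\<^sup>2)) \<le> exp (B\<^sup>2)" .
    qed simp_all
    then show ?thesis unfolding bounded_iff by auto
  qed
  have T: "uniform_limit S (\<lambda>N. T (edge_kernel N) a b) (T edge_kernel_limit a b) sequentially \<and>
      bounded (T edge_kernel_limit a b ` S)" if ab: "a < 2 * k" "b < 2 * k" for a b
  proof -
    let ?w = "\<lambda>z. edge_weight z a * edge_weight z b"
    have w: "bounded (?w ` S)" by (intro bounded_image_mult weight ab)
    have "uniform_limit S (\<lambda>N z. edge_kernel N (conj_pairs z a) (conj_pairs z b))
        (\<lambda>z. edge_kernel_limit (conj_pairs z a) (conj_pairs z b)) sequentially"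
    proof (rule uniform_limitI)
      fix e :: real assume "e > 0"
      from uniform_limitD [OF uniform_limit_edge_kernel this, of B]
      show "\<forall>\<^sub>F N in sequentially. \<forall>z\<in>S. dist (edge_kernel N (conj_pairs z a) (conj_pairs z b))
          (edge_kernel_limit (conj_pairs z a) (conj_pairs z b)) < e"
        by eventually_elim (use xB ab in \<open>auto simp: dist_norm\<close>)
    qed
    moreover have l: "bounded ((\<lambda>z. edge_kernel_limit (conj_pairs z a) (conj_pairs z b)) ` S)"
      by (rule bounded_subset [OF bounded_edge_kernel_limit [of B]]) (use xB ab in \<open>force simp: dist_norm\<close>)
    ultimately show ?thesis
      unfolding T_def [abs_def]
      by (intro conjI uniform_lim_mult uniform_limit_const bounded_image_mult w)
  qed
  have prods: "uniform_limit S (\<lambda>N z. \<Prod>i<k. T (edge_kernel N) (\<sigma> (2 * i)) (\<sigma> (2 * i + 1)) z)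
      (\<lambda>z. \<Prod>i<k. T edge_kernel_limit (\<sigma> (2 * i)) (\<sigma> (2 * i + 1)) z) sequentially \<and>
      bounded ((\<lambda>z. \<Prod>i<k. T edge_kernel_limit (\<sigma> (2 * i)) (\<sigma> (2 * i + 1)) z) ` S)"
    if "\<sigma> permutes {..<2 * k}" for \<sigma>
  proof (rule uniform_limit_prod_bounded)
    fix i assume "i \<in> {..<k}"
    then have "\<sigma> (2 * i) \<in> {..<2 * k}" "\<sigma> (2 * i + 1) \<in> {..<2 * k}"
      unfolding permutes_in_image [OF that] by auto
    then show "uniform_limit S (\<lambda>N. T (edge_kernel N) (\<sigma> (2 * i)) (\<sigma> (2 * i + 1)))
        (T edge_kernel_limit (\<sigma> (2 * i)) (\<sigma> (2 * i + 1))) sequentially"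
      "bounded (T edge_kernel_limit (\<sigma> (2 * i)) (\<sigma> (2 * i + 1)) ` S)"
      using T by auto
  qed simp
  have perm: "uniform_limit S (\<lambda>N z. (\<Prod>j<k. cnj (z j) - z j) / (2 ^ k * fact k) * of_int (sign \<sigma>) *
        (\<Prod>i<k. T (edge_kernel N) (\<sigma> (2 * i)) (\<sigma> (2 * i + 1)) z))
      (\<lambda>z. (\<Prod>j<k. cnj (z j) - z j) / (2 ^ k * fact k) * of_int (sign \<sigma>) *
        (\<Prod>i<k. T edge_kernel_limit (\<sigma> (2 * i)) (\<sigma> (2 * i + 1)) z)) sequentially"
    if "\<sigma> permutes {..<2 * k}" for \<sigma>
  \<comment> \<open>The prefactor is the same for all \<open>N\<close>, so it is its own uniform
    limit; it remains to bound it on \<open>S\<close>.\<close>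
  proof (rule uniform_lim_mult [OF uniform_limit_const])
    have "norm ((\<Prod>j<k. cnj (z j) - z j) / (2 ^ k * fact k) * of_int (sign \<sigma>)) \<le> (\<Prod>j<k. 2 * B)"
      if z: "z \<in> S" for z
    proof -
      have "norm (cnj (z j) - z j) \<le> 2 * B" if "j < k" for j
        using norm_triangle_ineq4 [of "cnj (z j)" "z j"] zB [OF z that] by simp
      then have "norm (\<Prod>j<k. cnj (z j) - z j) \<le> (\<Prod>j<k. 2 * B)"
        unfolding prod_norm [symmetric] by (intro prod_mono) auto
      moreover have "norm (2 ^ k * fact k :: complex) \<ge> 1"
        by (simp add: norm_mult norm_power mult_ge1_I)
      then have "norm (\<Prod>j<k. cnj (z j) - z j) / norm (2 ^ k * fact k :: complex) \<le>
          norm (\<Prod>j<k. cnj (z j) - z j) / 1"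
        by (intro divide_left_mono) auto
      moreover have "norm (of_int (sign \<sigma>) :: complex) = 1" by (simp add: sign_def)
      ultimately show ?thesis unfolding norm_mult [of _ "of_int (sign \<sigma>)"] norm_divide by simp
    qed
    then show "bounded ((\<lambda>z. (\<Prod>j<k. cnj (z j) - z j) / (2 ^ k * fact k) * of_int (sign \<sigma>)) ` S)"
      unfolding bounded_iff by blast
  qed (use prods [OF that] in auto)
  \<comment> \<open>A Pfaffian is a fixed finite sum of products of \<open>k\<close> entries, so
    convergence of the entries to bounded limits carries over.\<close>
  have Pf_T: "(\<Prod>j<k. cnj (z j) - z j) * Pf (index_matrix k (\<lambda>a b. T F a b z)) =
      (\<Sum>\<sigma> | \<sigma> permutes {..<2 * k}. (\<Prod>j<k. cnj (z j) - z j) / (2 ^ k * fact k) * of_int (sign \<sigma>) *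
        (\<Prod>i<k. T F (\<sigma> (2 * i)) (\<sigma> (2 * i + 1)) z))" for F z
    unfolding Pf_mat sum_divide_distrib sum_distrib_left by (simp add: mult_ac)
  have "uniform_limit S
      (\<lambda>N z. (\<Prod>j<k. cnj (z j) - z j) * Pf (index_matrix k (\<lambda>a b. T (edge_kernel N) a b z)))
      (\<lambda>z. (\<Prod>j<k. cnj (z j) - z j) * Pf (index_matrix k (\<lambda>a b. T edge_kernel_limit a b z)))
      sequentially"
    unfolding Pf_T by (rule uniform_limit_sum) (use perm in simp)
  moreover have "\<forall>\<^sub>F N in sequentially. \<forall>z\<in>S.
      (\<Prod>j<k. cnj (z j) - z j) * Pf (index_matrix k (\<lambda>a b. T (edge_kernel N) a b z)) =
      complex_of_real (rescaled_correlation p \<theta> N k z)"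
    \<comment> \<open>The Pfaffian formula applies once \<open>k \<le> N\<close> and
      \<open>N \<ge> 1\<close>.\<close>
    using eventually_ge_at_top [of k] eventually_ge_at_top [of 1]
    by eventually_elim (simp add: rescaled_correlation_eq_Pf [OF assms(1)] T_def)
  ultimately show ?thesis
    unfolding S_def [symmetric]
    by (subst (asm) uniform_limit_cong) (auto simp: limiting_correlation_eq T_def)
qed

end
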